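(* Let $m\geq 1$ be an integer and let $f:\mathbb{R}^m\to[0,\infty)$ be a probability density function with respect to Lebesgue measure on $\mathbb{R}^m$. Let $X_1,X_2,\ldots$ be independent random vectors in $\mathbb{R}^m$ with common density $f$. Let $0<q<1$ and let the integer $k\geq 1$ be fixed. Let $G_q(f)=\int_{\mathbb{R}^m} f^q(x)\,dx$, let $r_c(f)$ be the critical moment of $f$, and for $N>k$ let $\hat{G}_{k,N,q}$ be the $k$-nearest-neighbour estimator of $G_q(f)$ based on $X_1,\ldots,X_N$ (both as defined in the context). Then: (1) If $G_q(f)<\infty$ and $$r_c(f) > \frac{m(1-q)}{q},$$ then $\mathbb{E}\big[\hat{G}_{k,N,q}\big]\to G_q(f)$ as $N\to\infty$. (2) If $G_q(f)<\infty$, $q>\frac{1}{2}$ and $$r_c(f) > \frac{2m(1-q)}{2q-1},$$ then $\mathbb{E}\big[\hat{G}_{k,N,q}-G_q(f)\big]^2\to 0$ as $N\to\infty$ (that is, the expectation of the squared difference tends to $0$).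
   Context: $\|\cdot\|$ denotes the Euclidean norm on $\mathbb{R}^m$. Moments: for $r>0$, the $r$-moment of a density $f$ is $M_r(f)=\int_{\mathbb{R}^m}\|x\|^r f(x)\,dx\in[0,\infty]$, and the critical moment of $f$ is $r_c(f)=\sup\{r>0: M_r(f)<\infty\}$ (possibly $+\infty$). Nearest-neighbour distances: for $k<N$ and $1\leq i\leq N$, $\rho_{i,k,N}$ is the $k$-nearest neighbour distance of $X_i$ among $X_1,\ldots,X_N$, i.e. the $k$th order statistic (the $k$th smallest value) of the $N-1$ distances $\|X_i-X_j\|$, $j\neq i$, so that $\rho_{i,1,N}\leq\rho_{i,2,N}\leq\cdots\leq\rho_{i,N-1,N}$. Estimator: $$\hat{G}_{k,N,q}=\frac{1}{N}\sum_{i=1}^{N}\left(\zeta_{i,k,N}\right)^{1-q},\qquad \zeta_{i,k,N}=(N-1)\,C_k\,V_m\,\rho_{i,k,N}^m,$$ where $$C_k=\left[\frac{\Gamma(k)}{\Gamma(k+1-q)}\right]^{\frac{1}{1-q}},\qquad V_m=\frac{\pi^{m/2}}{\Gamma\left(\frac{m}{2}+1\right)},$$ $\Gamma$ is the Gamma function, and $V_m$ is the volume of the unit ball in $\mathbb{R}^m$. Note that $G_q(f)=\mathbb{E}[f^{q-1}(X)]$ for $X$ with density $f$. *)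

theory Defs
  imports "HOL-Probability.Probability"
begin

definition density_moment :: "real \<Rightarrow> (real ^ 'm \<Rightarrow> real) \<Rightarrow> ennreal" where
  "density_moment r f = (\<integral>\<^sup>+ x. ennreal (norm x powr r * f x) \<partial>lborel)"

text \<open>Taking the supremum in \<^typ>\<open>ennreal\<close> allows the value infinity, and gives 0 if no
  moment of positive order is finite.\<close>

definition critical_moment :: "(real ^ 'm \<Rightarrow> real) \<Rightarrow> ennreal" where
  "critical_moment f = (SUP r \<in> {r. 0 < r \<and> density_moment r f < \<infinity>}. ennreal r)"

definition G_functional :: "real \<Rightarrow> (real ^ 'm \<Rightarrow> real) \<Rightarrow> ennreal" where
  "G_functional q f = (\<integral>\<^sup>+ x. ennreal (f x powr q) \<partial>lborel)"

text \<open>A sample is a function \<open>x\<close> on the naturals, of which only \<open>x 1, \<dots>, x N\<close> are used.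
  The order statistic is read off the sorted list of the \<open>N - 1\<close> distances, with repetitions;
  list positions start at 0. The definition is meaningful for \<open>1 \<le> k < N\<close> and \<open>1 \<le> i \<le> N\<close>.\<close>

definition knn_dist :: "(nat \<Rightarrow> real ^ 'm) \<Rightarrow> nat \<Rightarrow> nat \<Rightarrow> nat \<Rightarrow> real" where
  "knn_dist x i k N =
     sort (map (\<lambda>j. norm (x i - x j)) (filter (\<lambda>j. j \<noteq> i) [1..<Suc N])) ! (k - 1)"

definition knn_const :: "nat \<Rightarrow> real \<Rightarrow> real" where
  "knn_const k q = (Gamma (real k) / Gamma (real k + 1 - q)) powr (1 / (1 - q))"

definition knn_zeta :: "nat \<Rightarrow> real \<Rightarrow> (nat \<Rightarrow> real ^ 'm) \<Rightarrow> nat \<Rightarrow> nat \<Rightarrow> real" where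
  "knn_zeta k q x i N =
     (real N - 1) * knn_const k q * unit_ball_vol (real CARD('m)) * knn_dist x i k N ^ CARD('m)"

definition knn_estimator :: "nat \<Rightarrow> nat \<Rightarrow> real \<Rightarrow> (nat \<Rightarrow> real ^ 'm) \<Rightarrow> real" where
  "knn_estimator k N q x = (1 / real N) * (\<Sum>i = 1..N. knn_zeta k q x i N powr (1 - q))"

end

theory Submission
  imports Defs
begin

text \<open>
  Write \<open>P\<close> for the law with density \<open>f\<close>, \<open>V\<close> for the volume of the unit ball, \<open>m\<close> for the dimension,
  and let \<open>u = n V r^m\<close>. By the layer cake formula
  \<open>E (n V \<rho>^m)^b = \<integral> b u^(b - 1) Phi n u du\<close>, where \<open>Phi n u\<close> averages over \<open>y\<close>, distributed
  according to \<open>P\<close>, the probability that a binomial variable with parameters \<open>n\<close> and \<open>P (cball y r)\<close>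
  is less than \<open>k\<close>. For fixed \<open>u\<close>, Lebesgue differentiation and the Poisson limit theorem give
  the limit of \<open>Phi n u\<close>, and the Gamma integral evaluates the limiting moment.

  Dominated convergence in \<open>u\<close> rests on \<open>Phi n u \<le> C u^(- s / (m + s))\<close> for large \<open>n\<close> and any finite
  moment of order \<open>s\<close>; the conditions on the critical moment say precisely that some such exponent
  exceeds \<open>1 - q\<close>, respectively \<open>2 (1 - q)\<close>.

  For the second moment, pairs of distinct sample points are compared with two independent copies:
  counts in disjoint balls are negatively correlated, and for fixed values of \<open>u\<close> the balls are
  disjoint with probability tending to 1. The variance of the estimator thus tends to 0 without a
  lower bound for the covariances.
\<close>

subsection \<open>Binomial and Poisson tails\<close>

text \<open>The density may be unbounded, irregular and spread over the whole space, so
  \<open>P (cball y r)\<close> has no lower bound uniform in \<open>y\<close>. For this reason decay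
  in \<open>u\<close> is sought only after averaging over \<open>y\<close>: within distance
  \<open>T\<close> of the origin the average of \<open>1 / (n P (cball y r))\<close> can be
  controlled by volumes alone, and outside only the mass matters. Balancing the two gives the
  exponent \<open>s / (m + s)\<close>. It exceeds \<open>1 - q\<close> iff
  \<open>s > m (1 - q) / q\<close>, and it exceeds \<open>2 (1 - q)\<close> iff
  \<open>s (2 q - 1) > 2 m (1 - q)\<close>.

  For the mean square, write \<open>G\<close> for the estimator and \<open>g\<close> for its target.
  Since \<open>E (G - g)^2 = E G^2 - 2 g E G + g^2\<close> is nonnegative,
  \<open>E G \<longlonglongrightarrow> g\<close> and an upper bound for \<open>E G^2\<close> tending
  to \<open>g^2\<close> suffice. In \<open>E G^2\<close> the diagonal terms involve the moment of
  order \<open>2 (1 - q)\<close>, damped by \<open>1 / N\<close>; the other terms involve two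
  moments of order \<open>1 - q\<close>, dominated with half the decay exponent. Both ask for an
  exponent above \<open>2 (1 - q)\<close>.\<close>

definition binomial_tail :: "nat \<Rightarrow> nat \<Rightarrow> real \<Rightarrow> real" where
  "binomial_tail n k p = (\<Sum>j<k. real (n choose j) * p ^ j * (1 - p) ^ (n - j))"

lemma binomial_tail_0 [simp]: "binomial_tail n 0 p = 0"
  by (simp add: binomial_tail_def)

lemma binomial_tail_0_Suc [simp]: "binomial_tail 0 (Suc k) p = 1"
  unfolding binomial_tail_def by (subst sum.lessThan_Suc_shift) simp

text \<open>Conditioning on one trial; algebraically this is Pascal's rule. Integrating out a single
  sample point in \<open>emeasure_hits_less\<close> produces exactly this recursion.\<close>

lemma binomial_tail_Suc_Suc:
  "binomial_tail (Suc n) (Suc k) p = p * binomial_tail n k p + (1 - p) * binomial_tail n (Suc k) p"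
proof -
  \<comment> \<open>For \<open>Suc j > n\<close> the truncated exponents no longer differ by one,
    but both sides vanish with the binomial coefficient.\<close>
  have *: "real (n choose Suc j) * p ^ Suc j * (1 - p) ^ (n - j) =
        (1 - p) * (real (n choose Suc j) * p ^ Suc j * (1 - p) ^ (n - Suc j))" for j
  proof (cases "Suc j \<le> n")
    case True
    then have "n - j = Suc (n - Suc j)" by simp
    then show ?thesis by simp
  qed (simp add: binomial_eq_0)
  have "binomial_tail (Suc n) (Suc k) p =
      (1 - p) ^ Suc n + (\<Sum>j<k. real (Suc n choose Suc j) * p ^ Suc j * (1 - p) ^ (n - j))"
    unfolding binomial_tail_def by (subst sum.lessThan_Suc_shift) simp
  also have "\<dots> = (\<Sum>j<k. p * (real (n choose j) * p ^ j * (1 - p) ^ (n - j))) +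
     ((1 - p) ^ Suc n + (\<Sum>j<k. real (n choose Suc j) * p ^ Suc j * (1 - p) ^ (n - j)))"
    by (simp add: sum.distrib[symmetric] algebra_simps)
  also have "(1 - p) ^ Suc n + (\<Sum>j<k. real (n choose Suc j) * p ^ Suc j * (1 - p) ^ (n - j)) =
     (1 - p) * binomial_tail n (Suc k) p"
    unfolding * binomial_tail_def
    by (subst sum.lessThan_Suc_shift) (simp add: sum_distrib_left distrib_left)
  finally show ?thesis
    by (simp add: binomial_tail_def sum_distrib_left)
qed

lemma binomial_tail_nonneg:
  assumes "0 \<le> p" "p \<le> 1" shows "0 \<le> binomial_tail n k p"
  unfolding binomial_tail_def using assms by (intro sum_nonneg mult_nonneg_nonneg) auto

lemma binomial_tail_mono:
  assumes "0 \<le> p" "p \<le> 1" "k \<le> l" shows "binomial_tail n k p \<le> binomial_tail n l p"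
  unfolding binomial_tail_def using assms by (intro sum_mono2 mult_nonneg_nonneg) auto

lemma binomial_tail_le_1:
  assumes "0 \<le> p" "p \<le> 1" shows "binomial_tail n k p \<le> 1"
proof -
  \<comment> \<open>Raising the bound past \<open>n\<close> turns the tail into the full binomial
    sum; the extra coefficients are zero.\<close>
  have "binomial_tail n k p \<le> binomial_tail n (k + Suc n) p"
    by (rule binomial_tail_mono) (use assms in auto)
  also have "\<dots> = (\<Sum>j\<le>n. real (n choose j) * p ^ j * (1 - p) ^ (n - j))"
    unfolding binomial_tail_def by (intro sum.mono_neutral_right) (auto simp: binomial_eq_0)
  also have "\<dots> = (p + (1 - p)) ^ n" by (subst binomial_ring) (rule refl)
  finally show ?thesis by simp
qed

text \<open>\<open>(n + 1) p P(Bin(n,p) = j) = (j + 1) P(Bin(n + 1,p) = j + 1)\<close>.\<close>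

lemma binomial_tail_bound:
  assumes "0 \<le> p" "p \<le> 1" shows "real (Suc n) * p * binomial_tail n k p \<le> real k"
proof -
  have "real (Suc n) * p * binomial_tail n k p =
      (\<Sum>j<k. real (Suc j) * (real (Suc n choose Suc j) * p ^ Suc j * (1 - p) ^ (Suc n - Suc j)))"
    unfolding binomial_tail_def sum_distrib_left
  proof (rule sum.cong[OF refl])
    fix j
    have "real (Suc n) * real (n choose j) = real (Suc j) * real (Suc n choose Suc j)"
      by (metis Suc_times_binomial of_nat_mult)
    then have "real (Suc n) * real (n choose j) * (p * p ^ j * (1 - p) ^ (n - j)) =
        real (Suc j) * real (Suc n choose Suc j) * (p * p ^ j * (1 - p) ^ (n - j))"
      by (simp only:)
    then show "real (Suc n) * p * (real (n choose j) * p ^ j * (1 - p) ^ (n - j)) =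
        real (Suc j) * (real (Suc n choose Suc j) * p ^ Suc j * (1 - p) ^ (Suc n - Suc j))"
      by (simp only: power_Suc diff_Suc_Suc mult.assoc mult.left_commute[of p])
  qed
  also have "\<dots> \<le> (\<Sum>j<k. real k * (real (Suc n choose Suc j) * p ^ Suc j * (1 - p) ^ (n - j)))"
    unfolding diff_Suc_Suc
    using assms by (intro sum_mono mult_right_mono mult_nonneg_nonneg) auto
  also have "\<dots> = real k * (\<Sum>j<k. real (Suc n choose Suc j) * p ^ Suc j * (1 - p) ^ (n - j))"
    by (simp add: sum_distrib_left)
  \<comment> \<open>The sum lacks only the nonnegative term at 0 of the tail for
    \<open>Suc n\<close> and \<open>Suc k\<close>.\<close>
  also have "(\<Sum>j<k. real (Suc n choose Suc j) * p ^ Suc j * (1 - p) ^ (n - j))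
      \<le> binomial_tail (Suc n) (Suc k) p"
    unfolding binomial_tail_def using assms by (subst sum.lessThan_Suc_shift) simp
  also have "\<dots> \<le> 1" by (rule binomial_tail_le_1[OF assms])
  finally show ?thesis by (simp add: mult_left_mono)
qed

text \<open>The ratio of the coefficients is a product of the \<open>j\<close> quotients
  \<open>(n - i) / (n - L - i)\<close> with \<open>i < j\<close>, each at most 2 because
  \<open>2 * L + i \<le> n\<close>.\<close>

lemma binomial_le_two_power_mult:
  "2 * L + j \<le> n \<Longrightarrow> real (n choose j) \<le> 2 ^ j * real ((n - L) choose j)"
proof (induction j)
  case (Suc j)
  have rec: "real (Suc j) * real (n choose Suc j) = real (n - j) * real (n choose j)" for n
    by (metis binomial_absorb_comp binomial_absorption of_nat_mult)
  have "real (Suc j) * real (n choose Suc j) = real (n - j) * real (n choose j)"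
    by (rule rec)
  also have "\<dots> \<le> (2 * real (n - L - j)) * (2 ^ j * real ((n - L) choose j))"
    using Suc by (intro mult_mono) auto
  also have "\<dots> = real (Suc j) * (2 ^ Suc j * real ((n - L) choose Suc j))"
    using rec[of "n - L"] by simp
  finally show ?case by (rule mult_left_le_imp_le) simp
qed simp

text \<open>Among \<open>n\<close> trials with fewer than \<open>k\<close> successes,
  \<open>L\<close> failures are split off as the factor \<open>(1 - p) ^ L\<close>. The tail for the
  other \<open>n - L\<close> trials can still be estimated by \<open>binomial_tail_bound\<close>, so
  for \<open>p\<close> close to 1 any power of \<open>1 - p\<close> is gained on top of that
  estimate.\<close>

lemma binomial_tail_le_power:
  assumes p: "0 \<le> p" "p \<le> 1" and n: "2 * L + k \<le> n"
  shows "binomial_tail n k p \<le> 2 ^ k * (1 - p) ^ L * binomial_tail (n - L) k p"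
  unfolding binomial_tail_def sum_distrib_left
proof (rule sum_mono)
  fix j assume j: "j \<in> {..<k}"
  have "real (n choose j) \<le> 2 ^ j * real ((n - L) choose j)"
    using n j by (intro binomial_le_two_power_mult) auto
  also have "\<dots> \<le> 2 ^ k * real ((n - L) choose j)"
    using j by (intro mult_right_mono power_increasing) auto
  finally have "real (n choose j) * (p ^ j * (1 - p) ^ (n - j)) \<le>
      2 ^ k * real ((n - L) choose j) * (p ^ j * (1 - p) ^ (n - j))"
    using p by (intro mult_right_mono) auto
  moreover have "n - j = L + (n - L - j)" using n j by auto
  then have "(1 - p) ^ (n - j) = (1 - p) ^ L * (1 - p) ^ (n - L - j)"
    by (metis power_add)
  ultimately show "real (n choose j) * p ^ j * (1 - p) ^ (n - j) \<le>
      2 ^ k * (1 - p) ^ L * (real ((n - L) choose j) * p ^ j * (1 - p) ^ (n - L - j))"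
    by (simp add: mult_ac)
qed

section \<open>Poisson tails as limits, and the sum behind their moments\<close>

definition poisson_tail :: "nat \<Rightarrow> real \<Rightarrow> real" where
  "poisson_tail k l = (\<Sum>j<k. l ^ j / fact j * exp (- l))"

lemma poisson_tail_nonneg: "0 \<le> l \<Longrightarrow> 0 \<le> poisson_tail k l"
  unfolding poisson_tail_def by (intro sum_nonneg) auto

text \<open>Each term splits into three convergent factors: \<open>(n choose j) * p n ^ j\<close> is
  a product of \<open>j\<close> factors \<open>n p n - i p n\<close> over \<open>fact j\<close>,
  \<open>(1 - p n) ^ n\<close> tends to \<open>exp (- l)\<close>, and the correction by
  \<open>(1 - p n) ^ j\<close> tends to 1, since \<open>p n\<close> tends to 0.\<close>

lemma poisson_limit:
  assumes p: "\<And>n. 0 \<le> p n" "\<And>n. p n \<le> 1" and lim: "(\<lambda>n. real n * p n) \<longlonglongrightarrow> l"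
  shows "(\<lambda>n. binomial_tail n k (p n)) \<longlonglongrightarrow> poisson_tail k l"
  unfolding binomial_tail_def poisson_tail_def
proof (rule tendsto_sum)
  fix j
  have p0: "p \<longlonglongrightarrow> 0"
  proof -
    have "(\<lambda>n. (real n * p n) * inverse (real n)) \<longlonglongrightarrow> l * 0"
      by (intro tendsto_mult lim lim_inverse_n)
    moreover have "eventually (\<lambda>n. (real n * p n) * inverse (real n) = p n) sequentially"
      using eventually_gt_at_top[of 0] by eventually_elim auto
    ultimately show ?thesis by (simp add: tendsto_cong)
  qed
  have choose: "(\<lambda>n. real (n choose j) * p n ^ j) \<longlonglongrightarrow> l ^ j / fact j"
  proof -
    have "(\<lambda>n. (\<Prod>i<j. (real n * p n - real i * p n)) / fact j) \<longlonglongrightarrow> (\<Prod>i<j. (l - real i * 0)) / fact j"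
      by (intro tendsto_intros lim p0) auto
    moreover have "(\<Prod>i<j. (real n * p n - real i * p n)) / fact j = real (n choose j) * p n ^ j" for n
    proof -
      have "real (n choose j) = (\<Prod>i<j. (real n - real i)) / fact j"
        by (simp add: binomial_gbinomial gbinomial_prod_rev atLeast0LessThan)
      moreover have "(\<Prod>i<j. (real n * p n - real i * p n)) = (\<Prod>i<j. (real n - real i)) * p n ^ j"
        by (simp add: left_diff_distrib[symmetric] prod.distrib)
      ultimately show ?thesis by simp
    qed
    ultimately show ?thesis by simp
  qed
  \<comment> \<open>The logarithm is squeezed by
    \<open>- x - 2 x^2 \<le> ln (1 - x) \<le> - x\<close> for \<open>0 \<le> x \<le> 1/2\<close>;
    the quadratic error is \<open>n p n\<close> times \<open>p n\<close>, hence vanishes.\<close>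
  have expo: "(\<lambda>n. (1 - p n) ^ n) \<longlonglongrightarrow> exp (- l)"
  proof -
    have sm: "eventually (\<lambda>n. p n < 1/2) sequentially"
      by (rule order_tendstoD(2)[OF p0]) simp
    have "(\<lambda>n. - (real n * p n) - 2 * (real n * p n) * p n) \<longlonglongrightarrow> - l - 2 * l * 0"
      by (intro tendsto_intros lim p0)
    then have lo: "(\<lambda>n. - (real n * p n) - 2 * (real n * p n) * p n) \<longlonglongrightarrow> - l" by simp
    have "(\<lambda>n. real n * ln (1 - p n)) \<longlonglongrightarrow> - l"
    proof (rule tendsto_sandwich[OF _ _ lo tendsto_minus[OF lim]])
      show "eventually (\<lambda>n. - (real n * p n) - 2 * (real n * p n) * p n \<le> real n * ln (1 - p n)) sequentially"
        using sm
      proof eventually_elim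
        case (elim n)
        have "- p n - 2 * (p n)\<^sup>2 \<le> ln (1 - p n)"
          using elim p[of n] by (intro ln_one_minus_pos_lower_bound) auto
        from mult_left_mono[OF this, of "real n"] show ?case
          by (simp add: algebra_simps power2_eq_square)
      qed
      show "eventually (\<lambda>n. real n * ln (1 - p n) \<le> - (real n * p n)) sequentially"
        using sm
      proof eventually_elim
        case (elim n)
        have "ln (1 - p n) \<le> - p n" using elim p[of n] ln_le_minus_one[of "1 - p n"] by simp
        from mult_left_mono[OF this, of "real n"] show ?case by simp
      qed
    qed
    from tendsto_exp[OF this] have "(\<lambda>n. exp (real n * ln (1 - p n))) \<longlonglongrightarrow> exp (- l)" .
    moreover have "eventually (\<lambda>n. exp (real n * ln (1 - p n)) = (1 - p n) ^ n) sequentially"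
      using sm by eventually_elim (simp add: exp_of_nat_mult)
    ultimately show ?thesis by (simp add: tendsto_cong)
  qed
  have pj: "(\<lambda>n. (1 - p n) ^ j) \<longlonglongrightarrow> (1 - 0) ^ j"
    by (intro tendsto_intros p0)
  have "(\<lambda>n. (1 - p n) ^ n / (1 - p n) ^ j) \<longlonglongrightarrow> exp (- l) / (1 - 0) ^ j"
    by (rule tendsto_divide[OF expo pj]) simp
  moreover have "eventually (\<lambda>n. (1 - p n) ^ n / (1 - p n) ^ j = (1 - p n) ^ (n - j)) sequentially"
    using eventually_ge_at_top[of j] order_tendstoD(2)[OF p0, of 1, simplified]
    by eventually_elim (simp add: power_diff)
  ultimately have "(\<lambda>n. (1 - p n) ^ (n - j)) \<longlonglongrightarrow> exp (- l)"
    by (simp add: tendsto_cong)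
  from tendsto_mult[OF choose this]
  show "(\<lambda>n. real (n choose j) * p n ^ j * (1 - p n) ^ (n - j)) \<longlonglongrightarrow> l ^ j / fact j * exp (- l)" .
qed

lemma poisson_tail_le_1:
  assumes "0 \<le> l" shows "poisson_tail k l \<le> 1"
proof -
  have "(\<Sum>j<k. l ^ j / fact j) \<le> exp l"
    unfolding exp_def using assms summable_exp_generic[of l] sum_le_suminf[of "\<lambda>n. l ^ n /\<^sub>R fact n" "{..<k}"]
    by (simp add: divide_inverse mult.commute)
  then have "(\<Sum>j<k. l ^ j / fact j) * exp (- l) \<le> exp l * exp (- l)" by (intro mult_right_mono) auto
  then show ?thesis by (simp add: poisson_tail_def sum_distrib_right exp_minus)
qed

text \<open>The right-hand side is the moment of order \<open>b\<close> of a Gamma variable with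
  shape \<open>Suc k\<close>; the left-hand side is the same moment computed from its Poisson tail,
  term by term. The induction only uses \<open>Gamma (z + 1) = z * Gamma z\<close>.\<close>

lemma sum_Gamma_div_fact:
  assumes b: "0 < (b::real)"
  shows "(\<Sum>j<Suc k. b * Gamma (b + real j) / fact j) = Gamma (real (Suc k) + b) / Gamma (real (Suc k))"
proof (induction k)
  case 0
  have "b \<notin> \<int>\<^sub>\<le>\<^sub>0" using b nonpos_Ints_nonpos by fastforce
  then show ?case using Gamma_plus1[of b] by (simp add: add.commute)
next
  case (Suc k)
  have nz: "b + real (Suc k) \<notin> \<int>\<^sub>\<le>\<^sub>0" using b nonpos_Ints_nonpos by fastforce
  have F: "Gamma (real (Suc n)) = fact n" for n using Gamma_fact[of n] by (simp add: add.commute)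
  have G: "Gamma (real (Suc (Suc k)) + b) = (b + real (Suc k)) * Gamma (b + real (Suc k))"
    using Gamma_plus1[OF nz] by (simp add: add_ac)
  have "(\<Sum>j<Suc (Suc k). b * Gamma (b + real j) / fact j) = Gamma (b + real (Suc k)) / fact k + b * Gamma (b + real (Suc k)) / fact (Suc k)"
    using Suc by (simp only: sum.lessThan_Suc F) (simp add: add_ac)
  also have "\<dots> = (b + real (Suc k)) * Gamma (b + real (Suc k)) / fact (Suc k)"
      by (simp add: field_simps del: of_nat_Suc)
  finally show ?case unfolding G F .
qed

subsection \<open>Counts and order statistics\<close>

lemma card_hits_insert:
  assumes "finite J" "i \<notin> J"
  shows "card {j \<in> insert i J. (x(i := y)) j \<in> A} = (if y \<in> A then Suc (card {j \<in> J. x j \<in> A}) else card {j \<in> J. x j \<in> A})"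
proof -
  have *: "{j \<in> J. (x(i := y)) j \<in> A} = {j \<in> J. x j \<in> A}" using assms by auto
  have "{j \<in> insert i J. (x(i := y)) j \<in> A} = (if y \<in> A then insert i {j \<in> J. x j \<in> A} else {j \<in> J. x j \<in> A})"
    unfolding *[symmetric] by auto
  then show ?thesis using assms by auto
qed

text \<open>A hit of the new point is absorbed into the threshold. The event keeps its form, and an
  induction over the points works once the threshold is arbitrary.\<close>

lemma card_hits_insert_less:
  assumes "finite J" "i \<notin> J"
  shows "card {j \<in> insert i J. (x(i := y)) j \<in> A} < Suc k \<longleftrightarrow> card {j \<in> J. x j \<in> A} < (if y \<in> A then k else Suc k)"
  unfolding card_hits_insert[OF assms] by (cases "y \<in> A") (simp_all only: if_True if_False Suc_less_eq)

section \<open>Distribution of counts under a product measure\<close>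

lemma measurable_card_hits [measurable (raw)]:
  assumes "finite J" and [measurable]: "\<And>j. j \<in> J \<Longrightarrow> Measurable.pred M (\<lambda>x. Q j x)"
  shows "(\<lambda>x. card {j \<in> J. Q j x}) \<in> measurable M (count_space UNIV)"
proof -
  have "(\<lambda>x. real (card {j \<in> J. Q j x})) \<in> borel_measurable M"
  proof -
    have "(\<lambda>x. \<Sum>j\<in>J. indicator {x. Q j x} x :: real) \<in> borel_measurable M"
      by measurable
    moreover have "(\<Sum>j\<in>J. indicator {x. Q j x} x :: real) = real (card {j \<in> J. Q j x})" for x
      using assms(1) by (simp add: indicator_def sum.If_cases Int_def)
    ultimately show ?thesis by simp
  qed
  then have "(\<lambda>x. nat \<lfloor>real (card {j \<in> J. Q j x})\<rfloor>) \<in> measurable M (count_space UNIV)"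
    by measurable
  then show ?thesis by simp
qed

lemma nn_integral_split_indicator:
  assumes [measurable]: "A \<in> sets M" and P: "prob_space M" and c: "0 \<le> c" "0 \<le> d"
  shows "(\<integral>\<^sup>+ y. (if y \<in> A then ennreal c else ennreal d) \<partial>M) = ennreal (measure M A * c + (1 - measure M A) * d)"
proof -
  interpret prob_space M by fact
  have "(\<integral>\<^sup>+ y. (if y \<in> A then ennreal c else ennreal d) \<partial>M) =
     (\<integral>\<^sup>+ y. ennreal c * indicator A y + ennreal d * indicator (space M - A) y \<partial>M)"
    by (intro nn_integral_cong) (auto split: split_indicator)
  also have "\<dots> = ennreal c * emeasure M A + ennreal d * emeasure M (space M - A)"
    by (subst nn_integral_add) (auto simp: nn_integral_cmult_indicator)
  also have "\<dots> = ennreal (measure M A * c + (1 - measure M A) * d)"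
    using c by (simp add: emeasure_eq_measure prob_compl ennreal_mult[symmetric] ennreal_plus[symmetric] mult_ac del: ennreal_plus)
  finally show ?thesis .
qed

text \<open>One coordinate of the product is integrated out at a time: with probability
  \<open>measure P A\<close> the threshold drops by one, otherwise it stays, which is
  \<open>binomial_tail_Suc_Suc\<close>.\<close>

lemma emeasure_hits_less:
  assumes P: "prob_space P" and A [measurable]: "A \<in> sets P" and J: "finite J"
  shows "emeasure (PiM J (\<lambda>_. P)) {x \<in> space (PiM J (\<lambda>_. P)). card {j \<in> J. x j \<in> A} < a} =
    ennreal (binomial_tail (card J) a (measure P A))"
proof -
  interpret prob_space P by fact
  interpret PP: product_prob_space "\<lambda>_. P" by standard
  \<comment> \<open>The indicator is that of a set of arbitrary functions, not of a subset of the
    product space, because that space changes in the induction.\<close>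
  have "(\<integral>\<^sup>+ x. indicator {x. card {j \<in> J. x j \<in> A} < a} x \<partial>PiM J (\<lambda>_. P)) =
     ennreal (binomial_tail (card J) a (measure P A))"
    using J
  proof (induction J arbitrary: a)
    case empty
    then show ?case
    proof (cases a)
      case (Suc k)
      then show ?thesis by (simp add: PiM_empty nn_integral_count_space_finite)
    qed simp
  next
    case (insert i J)
    note [simp] = insert.hyps
    show ?case
    proof (cases a)
      case (Suc k)
      have "(\<integral>\<^sup>+ x. indicator {x. card {j \<in> insert i J. x j \<in> A} < a} x \<partial>PiM (insert i J) (\<lambda>_. P)) =
        (\<integral>\<^sup>+ y. (\<integral>\<^sup>+ x. indicator {x. card {j \<in> insert i J. x j \<in> A} < a} (x(i := y)) \<partial>PiM J (\<lambda>_. P)) \<partial>P)"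
        by (rule PP.product_nn_integral_insert_rev) (rule insert.hyps, rule insert.hyps, measurable)
      also have "\<dots> = (\<integral>\<^sup>+ y. (\<integral>\<^sup>+ x. indicator {x. card {j \<in> J. x j \<in> A} < (if y \<in> A then k else Suc k)} x \<partial>PiM J (\<lambda>_. P)) \<partial>P)"
        by (simp only: indicator_def mem_Collect_eq card_hits_insert_less[OF insert.hyps] Suc)
      also have "\<dots> = (\<integral>\<^sup>+ y. (if y \<in> A then ennreal (binomial_tail (card J) k (measure P A))
           else ennreal (binomial_tail (card J) (Suc k) (measure P A))) \<partial>P)"
        unfolding insert.IH by (simp only: if_distrib[of "\<lambda>k. ennreal (binomial_tail (card J) k (measure P A))"])
      also have "\<dots> = ennreal (binomial_tail (card (insert i J)) a (measure P A))"
        by (subst nn_integral_split_indicator) (auto simp: P binomial_tail_nonneg Suc binomial_tail_Suc_Suc)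
      finally show ?thesis .
    qed simp
  qed
  also have "(\<integral>\<^sup>+ x. indicator {x. card {j \<in> J. x j \<in> A} < a} x \<partial>PiM J (\<lambda>_. P)) =
     (\<integral>\<^sup>+ x. indicator {x \<in> space (PiM J (\<lambda>_. P)). card {j \<in> J. x j \<in> A} < a} x \<partial>PiM J (\<lambda>_. P))"
    by (intro nn_integral_cong) (auto simp: indicator_def)
  also have "\<dots> = emeasure (PiM J (\<lambda>_. P)) {x \<in> space (PiM J (\<lambda>_. P)). card {j \<in> J. x j \<in> A} < a}"
    using J by (intro nn_integral_indicator) measurable
  finally show ?thesis by simp
qed

text \<open>Negative correlation: one point cannot hit both \<open>A\<close> and \<open>B\<close>,
  whereas two independent trials could both succeed. The induction compares the two recursions one
  point at a time.\<close>

lemma emeasure_hits_less_disjoint: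
  assumes P: "prob_space P" and A [measurable]: "A \<in> sets P" and B [measurable]: "B \<in> sets P"
    and disj: "A \<inter> B = {}" and J: "finite J"
  shows "emeasure (PiM J (\<lambda>_. P)) {x \<in> space (PiM J (\<lambda>_. P)).
      card {j \<in> J. x j \<in> A} < a \<and> card {j \<in> J. x j \<in> B} < b} \<le>
    ennreal (binomial_tail (card J) a (measure P A) * binomial_tail (card J) b (measure P B))"
proof -
  interpret prob_space P by fact
  interpret PP: product_prob_space "\<lambda>_. P" by standard
  let ?p = "measure P A" and ?q = "measure P B"
  have pq: "?p + ?q \<le> 1"
    using finite_measure_Union[OF A B disj] prob_le_1[of "A \<union> B"] by simp
  let ?S = "\<lambda>J a b. {x. card {j \<in> J. x j \<in> A} < a \<and> card {j \<in> J. x j \<in> B} < b}"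
  let ?bt = binomial_tail
  have "(\<integral>\<^sup>+ x. indicator (?S J a b) x \<partial>PiM J (\<lambda>_. P)) \<le>
     ennreal (?bt (card J) a ?p * ?bt (card J) b ?q)"
    using J
  proof (induction J arbitrary: a b)
    case empty
    show ?case by (cases a; cases b) (simp_all add: PiM_empty nn_integral_count_space_finite)
  next
    case (insert i J)
    note [simp] = insert.hyps
    show ?case
    proof (cases "a = 0 \<or> b = 0")
      case False
      then obtain k l where k: "a = Suc k" and l: "b = Suc l"
        by (metis not0_implies_Suc)
      let ?n = "card J"
      let ?G' = "?bt ?n k ?p" and ?G = "?bt ?n (Suc k) ?p" and ?H' = "?bt ?n l ?q" and ?H = "?bt ?n (Suc l) ?q"
      have G: "0 \<le> ?G'" "?G' \<le> ?G" and H: "0 \<le> ?H'" "?H' \<le> ?H"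
        by (auto intro!: binomial_tail_nonneg binomial_tail_mono)
      have "(\<integral>\<^sup>+ x. indicator (?S (insert i J) a b) x \<partial>PiM (insert i J) (\<lambda>_. P)) =
        (\<integral>\<^sup>+ y. (\<integral>\<^sup>+ x. indicator (?S (insert i J) a b) (x(i := y)) \<partial>PiM J (\<lambda>_. P)) \<partial>P)"
        by (rule PP.product_nn_integral_insert_rev) (rule insert.hyps, rule insert.hyps, measurable)
      also have "\<dots> = (\<integral>\<^sup>+ y. (\<integral>\<^sup>+ x. indicator
          (?S J (if y \<in> A then k else Suc k) (if y \<in> B then l else Suc l)) x \<partial>PiM J (\<lambda>_. P)) \<partial>P)"
        by (simp only: indicator_def mem_Collect_eq card_hits_insert_less[OF insert.hyps] k l)
      also have "\<dots> \<le> (\<integral>\<^sup>+ y. ennreal (?bt ?n (if y \<in> A then k else Suc k) ?p * ?bt ?n (if y \<in> B then l else Suc l) ?q) \<partial>P)"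
        by (intro nn_integral_mono insert.IH)
      also have "\<dots> \<le> (\<integral>\<^sup>+ y. ennreal (?G' * ?H) * indicator A y + ennreal (?G * ?H') * indicator B y +
           ennreal (?G * ?H) * indicator (space P - (A \<union> B)) y \<partial>P)"
        using disj by (intro nn_integral_mono) (auto simp: indicator_def)
      also have "\<dots> = ennreal (?G' * ?H) * emeasure P A + ennreal (?G * ?H') * emeasure P B +
           ennreal (?G * ?H) * emeasure P (space P - (A \<union> B))"
        by (simp add: nn_integral_add nn_integral_cmult_indicator)
      also have "emeasure P (space P - (A \<union> B)) = ennreal (1 - ?p - ?q)"
        using finite_measure_Union[OF A B disj] by (simp add: emeasure_eq_measure prob_compl diff_diff_eq)
      also have "ennreal (?G' * ?H) * emeasure P A + ennreal (?G * ?H') * emeasure P B + ennreal (?G * ?H) * ennreal (1 - ?p - ?q)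
        = ennreal (?G' * ?H * ?p + ?G * ?H' * ?q + ?G * ?H * (1 - ?p - ?q))"
        using G H pq by (simp add: emeasure_eq_measure ennreal_mult[symmetric] ennreal_plus[symmetric] del: ennreal_plus)
      also have "\<dots> \<le> ennreal ((?p * ?G' + (1 - ?p) * ?G) * (?q * ?H' + (1 - ?q) * ?H))"
      proof (rule ennreal_leI)
        \<comment> \<open>The recursions differ exactly by the event of probability
          \<open>?p * ?q\<close> that both trials succeed, and the factors \<open>?G - ?G'\<close>
          and \<open>?H - ?H'\<close> are nonnegative since lowering a threshold lowers the
          tail.\<close>
        have "0 \<le> ?p * ?q * ((?G - ?G') * (?H - ?H'))"
          using G H by (intro mult_nonneg_nonneg) auto
        also have "\<dots> = (?p * ?G' + (1 - ?p) * ?G) * (?q * ?H' + (1 - ?q) * ?H)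
             - (?G' * ?H * ?p + ?G * ?H' * ?q + ?G * ?H * (1 - ?p - ?q))" by algebra
        finally show "?G' * ?H * ?p + ?G * ?H' * ?q + ?G * ?H * (1 - ?p - ?q)
             \<le> (?p * ?G' + (1 - ?p) * ?G) * (?q * ?H' + (1 - ?q) * ?H)" by simp
      qed
      finally show ?thesis by (simp add: k l binomial_tail_Suc_Suc)
    qed auto
  qed
  also have "(\<integral>\<^sup>+ x. indicator (?S J a b) x \<partial>PiM J (\<lambda>_. P)) =
     (\<integral>\<^sup>+ x. indicator {x \<in> space (PiM J (\<lambda>_. P)). card {j \<in> J. x j \<in> A} < a \<and> card {j \<in> J. x j \<in> B} < b} x \<partial>PiM J (\<lambda>_. P))"
    by (intro nn_integral_cong) (auto simp: indicator_def)
  also have "\<dots> = emeasure (PiM J (\<lambda>_. P)) {x \<in> space (PiM J (\<lambda>_. P)). card {j \<in> J. x j \<in> A} < a \<and> card {j \<in> J. x j \<in> B} < b}"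
    using J by (intro nn_integral_indicator) measurable
  finally show ?thesis .
qed

text \<open>In a sorted list the entries at most \<open>r\<close> form an initial segment, and
  sorting does not change their number.\<close>

lemma sort_nth_le_iff:
  fixes xs :: "'b::linorder list"
  assumes "i < length xs"
  shows "sort xs ! i \<le> r \<longleftrightarrow> i < length (filter (\<lambda>x. x \<le> r) xs)"
proof -
  define ys where "ys = sort xs"
  have s: "sorted ys" and i: "i < length ys" using assms by (auto simp: ys_def)
  have len: "length (filter (\<lambda>x. x \<le> r) xs) = card {j. j < length ys \<and> ys ! j \<le> r}"
  proof -
    have "mset (filter (\<lambda>x. x \<le> r) xs) = mset (filter (\<lambda>x. x \<le> r) ys)" by (simp add: ys_def)
    then have "length (filter (\<lambda>x. x \<le> r) xs) = length (filter (\<lambda>x. x \<le> r) ys)"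
      by (metis size_mset)
    then show ?thesis by (simp add: length_filter_conv_card)
  qed
  show ?thesis
  proof (cases "ys ! i \<le> r")
    case True
    have "{..i} \<subseteq> {j. j < length ys \<and> ys ! j \<le> r}"
      using True i s by (auto intro: order_trans[OF sorted_nth_mono])
    from card_mono[OF _ this] show ?thesis using True by (simp add: len ys_def)
  next
    case False
    have "{j. j < length ys \<and> ys ! j \<le> r} \<subseteq> {..<i}"
    proof (intro subsetI, rule ccontr)
      fix j assume j: "j \<in> {j. j < length ys \<and> ys ! j \<le> r}" "j \<notin> {..<i}"
      then have "ys ! i \<le> ys ! j" by (intro sorted_nth_mono[OF s]) auto
      with j False show "False" by auto
    qed
    from card_mono[OF _ this] show ?thesis using False by (simp add: len ys_def)
  qed
qed

text \<open>Order statistics are replaced by counts here; all later probabilities concern counts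
  only. Ties among the distances are counted with multiplicity on both sides.\<close>

lemma knn_dist_gt_iff:
  assumes "1 \<le> k" "k < N" "1 \<le> i" "i \<le> N"
  shows "r < knn_dist x i k N \<longleftrightarrow> card {j \<in> {1..N} - {i}. x j \<in> cball (x i) r} < k"
proof -
  define js where "js = filter (\<lambda>j. j \<noteq> i) [1..<Suc N]"
  have djs: "distinct js" and sjs: "set js = {1..N} - {i}" by (auto simp: js_def)
  have "length js = N - 1"
    using distinct_card[OF djs] assms by (simp add: sjs)
  \<comment> \<open>Position \<open>k - 1\<close> counts from 0, so at least \<open>k\<close>
    distances must be at most \<open>r\<close>; negating this gives fewer than \<open>k\<close>
    hits.\<close>
  then have "knn_dist x i k N \<le> r \<longleftrightarrow> k - 1 < length (filter (\<lambda>d. d \<le> r) (map (\<lambda>j. norm (x i - x j)) js))"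
    unfolding knn_dist_def js_def[symmetric] using assms by (intro sort_nth_le_iff) simp
  also have "length (filter (\<lambda>d. d \<le> r) (map (\<lambda>j. norm (x i - x j)) js)) = length (filter (\<lambda>j. x j \<in> cball (x i) r) js)"
    by (simp add: filter_map o_def dist_norm)
  also have "\<dots> = card {j \<in> {1..N} - {i}. x j \<in> cball (x i) r}"
  proof -
    have "set (filter (\<lambda>j. x j \<in> cball (x i) r) js) = {j \<in> {1..N} - {i}. x j \<in> cball (x i) r}"
      by (simp add: sjs)
    then show ?thesis using distinct_card[OF distinct_filter[OF djs]] by metis
  qed
  finally show ?thesis using assms by auto
qed

lemma knn_dist_nonneg:
  assumes "1 \<le> k" "k < N" "1 \<le> i" "i \<le> N"
  shows "0 \<le> knn_dist x i k N"
proof (rule ccontr)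
  assume neg: "\<not> 0 \<le> knn_dist x i k N"
  \<comment> \<open>Half of a negative distance is larger than it and still negative, so an empty
    ball would have to contain \<open>k\<close> points.\<close>
  then have "\<not> (knn_dist x i k N / 2 < knn_dist x i k N)" by simp
  then have "k \<le> card {j \<in> {1..N} - {i}. x j \<in> cball (x i) (knn_dist x i k N / 2)}"
    using knn_dist_gt_iff[OF assms, where x = x] by (simp add: not_less)
  moreover have "cball (x i) (knn_dist x i k N / 2) = {}" using neg by simp
  ultimately show False using assms by simp
qed

subsection \<open>Lebesgue differentiation on balls\<close>

text \<open>\<open>S\<close> is the set of reversed coordinates. Writing the map as a sum over the
  basis makes it an instance of \<open>lborel_affine_euclidean\<close> with all scale factors of
  modulus 1.\<close>

definition flip_signs :: "'a::euclidean_space set \<Rightarrow> 'a \<Rightarrow> 'a" where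
  "flip_signs S x = (\<Sum>b\<in>Basis. ((if b \<in> S then - 1 else 1) * (x \<bullet> b)) *\<^sub>R b)"

lemma inner_flip_signs: "b \<in> Basis \<Longrightarrow> flip_signs S x \<bullet> b = (if b \<in> S then - 1 else 1) * (x \<bullet> b)"
  unfolding flip_signs_def by simp

lemma flip_signs_flip_signs [simp]: "flip_signs S (flip_signs S x) = x"
  by (rule euclidean_eqI) (simp add: inner_flip_signs)

lemma measurable_flip_signs [measurable]: "flip_signs S \<in> borel \<rightarrow>\<^sub>M borel"
  unfolding flip_signs_def by measurable

lemma distr_flip_signs: "distr lborel borel (flip_signs S) = (lborel :: 'a::euclidean_space measure)"
proof -
  have "lborel = density (distr lborel borel (\<lambda>x::'a. 0 + (\<Sum>b\<in>Basis. ((if b \<in> S then - 1 else 1) * (x \<bullet> b)) *\<^sub>R b)))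
      (\<lambda>_. (\<Prod>j\<in>Basis. abs (if (j::'a) \<in> S then - 1 else 1 :: real)))"
    by (rule lborel_affine_euclidean) auto
  also have "(\<lambda>x::'a. 0 + (\<Sum>b\<in>Basis. ((if b \<in> S then - 1 else 1) * (x \<bullet> b)) *\<^sub>R b)) = flip_signs S"
    by (simp add: flip_signs_def fun_eq_iff)
  also have "(\<Prod>j\<in>Basis. abs (if (j::'a) \<in> S then - 1 else 1 :: real)) = 1"
    by (intro prod.neutral) auto
  finally show ?thesis by (simp add: density_1)
qed

lemma AE_flip_signs:
  assumes "AE x in lborel. P x" shows "AE x in lborel. P (flip_signs S x)"
proof (rule AE_distrD[where M' = borel and f = "flip_signs S"])
  show "AE x in distr lborel borel (flip_signs S). P x" unfolding distr_flip_signs by (rule assms)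
qed measurable

lemma set_integral_flip_signs:
  fixes g :: "'a::euclidean_space \<Rightarrow> real"
  assumes [measurable]: "g \<in> borel_measurable borel" "A \<in> sets borel"
  shows "(LINT y:A|lborel. g (flip_signs S y)) = (LINT y:{y. flip_signs S y \<in> A}|lborel. g y)"
proof -
  have "(LINT y:{y. flip_signs S y \<in> A}|lborel. g y) = (LINT y:{y. flip_signs S y \<in> A}|distr lborel borel (flip_signs S). g y)"
    by (simp add: distr_flip_signs)
  also have "\<dots> = (LINT y:A|lborel. g (flip_signs S y))"
    unfolding set_lebesgue_integral_def by (subst integral_distr) (auto simp: indicator_def)
  finally show ?thesis ..
qed

lemma set_integrable_flip_signs:
  fixes g :: "'a::euclidean_space \<Rightarrow> real"
  assumes [measurable]: "g \<in> borel_measurable borel" "A \<in> sets borel"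
  shows "set_integrable lborel A (\<lambda>y. g (flip_signs S y)) \<longleftrightarrow> set_integrable lborel {y. flip_signs S y \<in> A} g"
proof -
  have "set_integrable lborel {y. flip_signs S y \<in> A} g \<longleftrightarrow> set_integrable (distr lborel borel (flip_signs S)) {y. flip_signs S y \<in> A} g"
    by (simp add: distr_flip_signs)
  also have "\<dots> \<longleftrightarrow> set_integrable lborel A (\<lambda>y. g (flip_signs S y))"
    unfolding set_integrable_def by (subst integrable_distr_eq) (auto simp: indicator_def)
  finally show ?thesis ..
qed

text \<open>\<open>integrable_ccontinuous_explicit\<close> speaks of the gauge integral and
  negligible sets. Integrability on every box makes the integrals agree, and the completion carries
  the null set over to \<open>lborel\<close>.\<close>

lemma AE_corner_average:
  fixes g :: "'a::euclidean_space \<Rightarrow> real"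
  assumes int: "\<And>a b. set_integrable lborel (cbox a b) g"
  shows "AE x in lborel. ((\<lambda>h. (LINT y:cbox x (x + h *\<^sub>R One)|lborel. g y) / h ^ DIM('a)) \<longlongrightarrow> g x) (at_right 0)"
proof -
  have io: "\<And>a b::'a. g integrable_on cbox a b"
    by (rule set_borel_integral_eq_integral(1)[OF int])
  obtain N where N: "negligible N"
    and lim: "\<And>x e. \<lbrakk>x \<notin> N; 0 < e\<rbrakk> \<Longrightarrow> \<exists>d>0. \<forall>h. 0 < h \<and> h < d \<longrightarrow>
         norm (integral (cbox x (x + h *\<^sub>R One)) g /\<^sub>R h ^ DIM('a) - g x) < e"
    using integrable_ccontinuous_explicit[OF io] by metis
  have "AE x in lebesgue. x \<notin> N"
    using N by (simp add: negligible_iff_null_sets AE_not_in)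
  then have "AE x in lborel. x \<notin> N" by (simp add: AE_completion_iff)
  then show ?thesis
  proof eventually_elim
    case (elim x)
    show ?case
    proof (rule tendstoI)
      fix e :: real assume "0 < e"
      from lim[OF elim this] obtain d where d: "d > 0"
        "\<And>h. 0 < h \<Longrightarrow> h < d \<Longrightarrow> norm (integral (cbox x (x + h *\<^sub>R One)) g /\<^sub>R h ^ DIM('a) - g x) < e"
        by auto
      show "eventually (\<lambda>h. dist ((LINT y:cbox x (x + h *\<^sub>R One)|lborel. g y) / h ^ DIM('a)) (g x) < e) (at_right 0)"
        unfolding eventually_at_right_field using d
        by (intro exI[of _ d]) (auto simp: set_borel_integral_eq_integral(2)[OF int] dist_norm divide_inverse mult.commute)
    qed
  qed
qed

lemma cball_subset_corners:
  fixes x :: "'a::euclidean_space"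
  shows "cball x h \<subseteq> (\<Union>S\<in>Pow Basis. {y. flip_signs S y \<in> cbox (flip_signs S x) (flip_signs S x + h *\<^sub>R One)})"
proof
  fix y assume y: "y \<in> cball x h"
  have le: "abs ((y - x) \<bullet> b) \<le> h" if "b \<in> Basis" for b
    using Basis_le_norm[OF that, of "y - x"] y by (simp add: dist_norm norm_minus_commute)
  \<comment> \<open>The coordinates in which \<open>y\<close> lies below \<open>x\<close>; after
    reversing them every coordinate of the difference is in \<open>{0..h}\<close>.\<close>
  let ?S = "{b \<in> Basis. (y - x) \<bullet> b < 0}"
  have "flip_signs ?S y \<in> cbox (flip_signs ?S x) (flip_signs ?S x + h *\<^sub>R One)"
    unfolding mem_box
  proof (intro ballI)
    fix b :: 'a assume "b \<in> Basis"
    with le[OF this] show "flip_signs ?S x \<bullet> b \<le> flip_signs ?S y \<bullet> b \<and> flip_signs ?S y \<bullet> b \<le> (flip_signs ?S x + h *\<^sub>R One) \<bullet> b"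
      by (auto simp: inner_flip_signs inner_add_left inner_diff_left)
  qed
  then show "y \<in> (\<Union>S\<in>Pow Basis. {y. flip_signs S y \<in> cbox (flip_signs S x) (flip_signs S x + h *\<^sub>R One)})"
    by (intro UN_I[of ?S]) auto
qed

text \<open>The cubes cover the ball and \<open>g\<close> is nonnegative, so counting shared faces
  and the parts outside the ball can only increase the sum.\<close>

lemma set_integral_cball_le_corners:
  fixes g :: "'a::euclidean_space \<Rightarrow> real"
  assumes g [measurable]: "g \<in> borel_measurable borel" and pos: "\<And>x. 0 \<le> g x"
    and int: "\<And>S a b. set_integrable lborel (cbox a b) (\<lambda>y. g (flip_signs S y))"
  shows "(LINT y:cball x h|lborel. g y) \<le>
    (\<Sum>S\<in>Pow Basis. LINT y:cbox (flip_signs S x) (flip_signs S x + h *\<^sub>R One)|lborel. g (flip_signs S y))"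
proof -
  let ?D = "\<lambda>S. {y. flip_signs S y \<in> cbox (flip_signs S x) (flip_signs S x + h *\<^sub>R One)}"
  have intD: "set_integrable lborel (?D S) g" for S
    using int by (subst set_integrable_flip_signs[symmetric]) auto
  have fin: "finite (Pow Basis :: 'a set set)" by simp
  have "(LINT y:cball x h|lborel. g y) \<le> (LINT y|lborel. (\<Sum>S\<in>Pow Basis. indicator (?D S) y *\<^sub>R g y))"
    unfolding set_lebesgue_integral_def
  proof (rule integral_mono')
    show "integrable lborel (\<lambda>y. \<Sum>S\<in>Pow Basis. indicator (?D S) y *\<^sub>R g y)"
      using intD by (intro Bochner_Integration.integrable_sum) (simp add: set_integrable_def)
    fix y
    show "0 \<le> (\<Sum>S\<in>Pow Basis. indicator (?D S) y *\<^sub>R g y)" using pos by (intro sum_nonneg) simp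
    show "indicator (cball x h) y *\<^sub>R g y \<le> (\<Sum>S\<in>Pow Basis. indicator (?D S) y *\<^sub>R g y)"
    proof (cases "y \<in> cball x h")
      case True
      then obtain S where S: "S \<in> Pow Basis" "y \<in> ?D S"
        using subsetD[OF cball_subset_corners True] by (elim UN_E) (rule that)
      have "indicator (?D S) y *\<^sub>R g y \<le> (\<Sum>S\<in>Pow Basis. indicator (?D S) y *\<^sub>R g y)"
        by (rule member_le_sum[OF S(1)]) (auto simp: pos)
      with S True show ?thesis by simp
    qed (auto intro!: sum_nonneg simp: pos)
  qed
  also have "\<dots> = (\<Sum>S\<in>Pow Basis. LINT y:?D S|lborel. g y)"
    unfolding set_lebesgue_integral_def
    by (rule Bochner_Integration.integral_sum) (use intD in \<open>simp add: set_integrable_def\<close>)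
  finally show ?thesis by (simp add: set_integral_flip_signs)
qed

lemma set_integrable_const_cball:
  "set_integrable lborel (cball (x::'a::euclidean_space) r) (\<lambda>_. c :: real)"
  unfolding set_integrable_def
  by (intro integrable_scaleR_left integrable_real_indicator) (simp_all add: emeasure_bounded_finite[unfolded infinity_ennreal_def])

text \<open>The library theorem concerns cubes with a corner at \<open>x\<close>. Sign changes of the coordinates
  produce cubes at \<open>x\<close> in all orthants, which together cover a ball around \<open>x\<close>. Applying it to
  \<open>\<bar>f - c\<bar>\<close> for all rational \<open>c\<close> makes almost every \<open>x\<close> a Lebesgue point.\<close>

lemma lebesgue_differentiation_cball:
  fixes f :: "'a::euclidean_space \<Rightarrow> real"
  assumes f: "integrable lborel f"
  shows "AE x in lborel. ((\<lambda>r. (LINT y:cball x r|lborel. f y) / r ^ DIM('a)) \<longlongrightarrow> unit_ball_vol DIM('a) * f x) (at_right 0)"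
proof -
  have [measurable]: "f \<in> borel_measurable borel" using f by (simp add: borel_measurable_integrable)
  define m where "m = DIM('a)"
  define V where "V = unit_ball_vol (real m)"
  have V: "0 \<le> V" by (simp add: V_def)
  have sint: "set_integrable lborel A f" if "A \<in> sets borel" for A
    using f that unfolding set_integrable_def by (intro integrable_mult_indicator) auto
  have int: "set_integrable lborel (cbox a b) (\<lambda>y. abs (f (flip_signs S y) - c))" for S :: "'a set" and a b c
  proof -
    have "set_integrable lborel (cbox a b) (\<lambda>y. f (flip_signs S y))"
      by (subst set_integrable_flip_signs) (auto intro!: sint)
    moreover have "set_integrable lborel (cbox a b) (\<lambda>_. c)"
      unfolding set_integrable_def by (intro integrable_scaleR_left integrable_real_indicator) (simp_all add: emeasure_bounded_finite[unfolded infinity_ennreal_def])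
    ultimately show ?thesis by (intro set_integrable_abs set_integral_diff)
  qed
  have "AE x in lborel. \<forall>c\<in>\<rat>. \<forall>S\<in>Pow Basis.
      ((\<lambda>h. (LINT y:cbox (flip_signs S x) (flip_signs S x + h *\<^sub>R One)|lborel. abs (f (flip_signs S y) - c)) / h ^ m) \<longlongrightarrow> abs (f x - c)) (at_right 0)"
  proof -
    have fin: "countable (Pow (Basis :: 'a set))" by (intro countable_finite) simp
    show ?thesis
      unfolding AE_ball_countable[OF countable_rat] AE_ball_countable[OF fin]
    proof (intro ballI)
      fix c and S :: "'a set"
      show "AE x in lborel. ((\<lambda>h. (LINT y:cbox (flip_signs S x) (flip_signs S x + h *\<^sub>R One)|lborel. abs (f (flip_signs S y) - c)) / h ^ m)
          \<longlongrightarrow> abs (f x - c)) (at_right 0)"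
        using AE_flip_signs[OF AE_corner_average[OF int[where S = S and c = c]], of S] by (simp add: m_def)
    qed
  qed
  then show ?thesis
  proof eventually_elim
    case (elim x)
    let ?K = "real (card (Pow (Basis :: 'a set)))"
    have K: "0 \<le> ?K" by simp
    show ?case
    proof (rule tendstoI)
      fix e :: real assume e: "0 < e"
      \<comment> \<open>Each of the \<open>?K\<close> cubes costs an error \<open>d\<close>, and
        replacing \<open>f x\<close> by \<open>c\<close> costs \<open>V * d\<close>; the factor 2
        and the summand 1 make the total strictly less than \<open>e\<close>.\<close>
      define d where "d = e / (2 * (?K + V + 1))"
      have d: "0 < d" using e K V by (auto simp: d_def intro!: divide_pos_pos)
      obtain c where c: "c \<in> \<rat>" "f x - d < c" "c < f x + d"
        using Rats_dense_in_real[of "f x - d" "f x + d"] d by auto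
      let ?I = "\<lambda>S h. (LINT y:cbox (flip_signs S x) (flip_signs S x + h *\<^sub>R One)|lborel. abs (f (flip_signs S y) - c)) / h ^ m"
      have "((\<lambda>h. \<Sum>S\<in>Pow Basis. ?I S h) \<longlongrightarrow> (\<Sum>S\<in>Pow (Basis::'a set). abs (f x - c))) (at_right 0)"
        using elim c(1) by (intro tendsto_sum) auto
      moreover have "(\<Sum>S\<in>Pow (Basis::'a set). abs (f x - c)) < e - V * d"
      proof -
        have "(\<Sum>S\<in>Pow (Basis::'a set). abs (f x - c)) + V * d \<le> ?K * d + V * d"
          using c d by (auto intro!: mult_left_mono)
        also have "\<dots> < 2 * (?K + V + 1) * d" using d mult_nonneg_nonneg[OF V less_imp_le[OF d]] mult_nonneg_nonneg[OF K less_imp_le[OF d]]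
          unfolding ring_distribs by linarith
        also have "\<dots> = e" using K V by (simp add: d_def add_nonneg_eq_0_iff)
        finally show ?thesis by simp
      qed
      ultimately have "eventually (\<lambda>h. (\<Sum>S\<in>Pow Basis. ?I S h) < e - V * d) (at_right 0)"
        by (rule order_tendstoD(2))
      then show "eventually (\<lambda>r. dist ((LINT y:cball x r|lborel. f y) / r ^ DIM('a)) (unit_ball_vol DIM('a) * f x) < e) (at_right 0)"
        using eventually_at_right_less[of 0]
      proof eventually_elim
        case (elim h)
        have vol: "(LINT y:cball x h|lborel. c) = c * (V * h ^ m)" for c :: real
          using elim unfolding set_lebesgue_integral_def by (simp add: content_cball V_def m_def mult.commute)
        \<comment> \<open>The rational \<open>c\<close> mediates: \<open>f y - c\<close> is handled
          by the cubes, while \<open>c - f x\<close> is a constant of modulus less than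
          \<open>d\<close>.\<close>
        have "(LINT y:cball x h|lborel. f y) - f x * (V * h ^ m) =
            (LINT y:cball x h|lborel. f y - c) + (c - f x) * (V * h ^ m)"
          by (subst set_integral_diff) (auto simp: vol algebra_simps intro!: sint set_integrable_const_cball)
        also have "abs (\<dots>) \<le> abs (LINT y:cball x h|lborel. f y - c) + abs (c - f x) * (V * h ^ m)"
          using elim V by (intro order_trans[OF abs_triangle_ineq]) (simp add: abs_mult)
        also have "abs (LINT y:cball x h|lborel. f y - c) \<le> (LINT y:cball x h|lborel. abs (f y - c))"
          unfolding set_lebesgue_integral_def
          by (rule order_trans[OF integral_abs_bound]) (simp add: abs_mult)
        also have "\<dots> \<le> (\<Sum>S\<in>Pow Basis. LINT y:cbox (flip_signs S x) (flip_signs S x + h *\<^sub>R One)|lborel. abs (f (flip_signs S y) - c))"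
          by (rule set_integral_cball_le_corners) (auto intro!: int)
        also have "\<dots> = (\<Sum>S\<in>Pow Basis. ?I S h) * h ^ m"
          using elim by (simp add: sum_distrib_right)
        also have "abs (c - f x) * (V * h ^ m) \<le> d * (V * h ^ m)"
          using elim V c by (intro mult_right_mono) auto
        finally have "abs ((LINT y:cball x h|lborel. f y) - f x * (V * h ^ m)) \<le> ((\<Sum>S\<in>Pow Basis. ?I S h) + V * d) * h ^ m"
          by (simp add: algebra_simps)
        also have "\<dots> < e * h ^ m" using elim by (intro mult_strict_right_mono) auto
        finally have "abs ((LINT y:cball x h|lborel. f y) - f x * (V * h ^ m)) / h ^ m < e"
          using elim by (simp add: divide_simps)
        moreover have "(LINT y:cball x h|lborel. f y) / h ^ m - V * f x = ((LINT y:cball x h|lborel. f y) - f x * (V * h ^ m)) / h ^ m"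
          using elim by (simp add: field_simps)
        ultimately show ?case using elim by (simp add: dist_real_def m_def[symmetric] V_def[symmetric] abs_divide)
      qed
    qed
  qed
qed

subsection \<open>Averaged counting probabilities\<close>

text \<open>The triples with \<open>dist y w \<le> r\<close> form a closed set, whose sections in
  \<open>w\<close> are the balls. Joint measurability in centre and radius is what the integrals
  over \<open>y\<close> and \<open>u\<close> require.\<close>

lemma measurable_measure_cball:
  fixes P :: "'a::euclidean_space measure"
  assumes "finite_measure P" and sets [measurable_cong]: "sets P = sets borel"
  shows "(\<lambda>(y, r). measure P (cball y r)) \<in> borel_measurable (borel \<Otimes>\<^sub>M borel)"
proof -
  interpret finite_measure P by fact
  let ?Q = "{x. dist (fst (fst x)) (snd x) \<le> snd (fst x)} :: (('a \<times> real) \<times> 'a) set"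
  have "closed ?Q" by (intro closed_Collect_le continuous_intros)
  then have "?Q \<in> sets borel" by (rule borel_closed)
  then have "?Q \<in> sets ((borel \<Otimes>\<^sub>M borel) \<Otimes>\<^sub>M P)"
    unfolding sets_pair_measure_cong[OF refl sets] borel_prod .
  then have "(\<lambda>x. emeasure P (Pair x -` ?Q)) \<in> borel_measurable (borel \<Otimes>\<^sub>M borel)"
    by (rule measurable_emeasure_Pair)
  moreover have "Pair x -` ?Q = (case x of (y, r) \<Rightarrow> cball y r)" for x by (auto simp: cball_def)
  ultimately have "(\<lambda>x. enn2real (emeasure P (case x of (y, r) \<Rightarrow> cball y r))) \<in> borel_measurable (borel \<Otimes>\<^sub>M borel)"
    by (intro borel_measurable_enn2real) simp
  then show ?thesis by (simp add: measure_def split_beta)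
qed

lemma binomial_tail_measurable [measurable (raw)]:
  assumes [measurable]: "g \<in> borel_measurable M"
  shows "(\<lambda>x. binomial_tail n k (g x)) \<in> borel_measurable M"
  unfolding binomial_tail_def by measurable

lemma poisson_tail_measurable [measurable (raw)]:
  assumes [measurable]: "g \<in> borel_measurable M"
  shows "(\<lambda>x. poisson_tail k (g x)) \<in> borel_measurable M"
  unfolding poisson_tail_def by measurable

section \<open>Scaled radii and ball probabilities of a density\<close>

locale density_sample =
  fixes f :: "'a::euclidean_space \<Rightarrow> real"
  assumes f_nonneg [simp]: "\<And>x. 0 \<le> f x"
    and f_measurable [measurable]: "f \<in> borel_measurable borel"
    and f_integral: "(\<integral>\<^sup>+ x. ennreal (f x) \<partial>lborel) = 1"
begin

definition P :: "'a measure" where "P = density lborel f"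

definition vol1 :: real where "vol1 = unit_ball_vol (real DIM('a))"

lemma vol1_pos [simp]: "0 < vol1" by (simp add: vol1_def)

lemma vol1_neq_0 [simp]: "vol1 \<noteq> 0" and vol1_nonneg [simp]: "0 \<le> vol1"
  using vol1_pos by linarith+

text \<open>The solution \<open>r\<close> of \<open>n * vol1 * r ^ m = u\<close>, for positive
  \<open>n\<close> and \<open>u\<close>. Other values of \<open>u\<close> carry no weight in the
  layer cake integrals.\<close>

definition rad :: "nat \<Rightarrow> real \<Rightarrow> real" where
  "rad n u = (u / (real n * vol1)) powr (1 / real DIM('a))"

lemma sets_P [simp, measurable_cong]: "sets P = sets borel" by (simp add: P_def)

lemma space_P [simp]: "space P = UNIV" by (simp add: P_def)

lemma prob_space_P: "prob_space P"
  by (rule prob_spaceI) (simp add: P_def emeasure_density f_integral)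

sublocale P: prob_space P by (rule prob_space_P)

lemma nn_integral_P: "g \<in> borel_measurable borel \<Longrightarrow> (\<integral>\<^sup>+ x. g x \<partial>P) = (\<integral>\<^sup>+ x. ennreal (f x) * g x \<partial>lborel)"
  unfolding P_def by (subst nn_integral_density) auto

lemma AE_P: "AE x in lborel. Q x \<Longrightarrow> AE x in P. Q x"
  unfolding P_def by (subst AE_density) auto

lemma integrable_f: "integrable lborel f"
  by (rule integrableI_nonneg) (auto simp: f_integral)

lemma measure_P_eq: "A \<in> sets borel \<Longrightarrow> measure P A = (LINT z:A|lborel. f z)"
proof -
  assume [measurable]: "A \<in> sets borel"
  have "measure P A = (LINT z|P. indicator A z)" by simp
  also have "\<dots> = (LINT z:A|lborel. f z)"
    unfolding P_def set_lebesgue_integral_def by (subst integral_density) (auto simp: mult.commute)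
  finally show ?thesis .
qed

lemma measure_cball_measurable [measurable (raw)]:
  assumes [measurable]: "g \<in> borel_measurable M" "h \<in> borel_measurable M"
  shows "(\<lambda>x. measure P (cball (g x) (h x))) \<in> borel_measurable M"
  using measurable_compose[OF _ measurable_measure_cball[OF P.finite_measure_axioms sets_P], of "\<lambda>x. (g x, h x)" M]
  by simp

lemma rad_measurable [measurable]: "rad n \<in> borel_measurable borel"
  unfolding rad_def by measurable

lemma rad_pos [simp]: "0 < u \<Longrightarrow> 0 < n \<Longrightarrow> 0 < rad n u"
  using vol1_pos by (simp add: rad_def)

lemma rad_power: "0 < u \<Longrightarrow> 0 < n \<Longrightarrow> rad n u ^ DIM('a) = u / (real n * vol1)"
  unfolding rad_def by (subst powr_realpow[symmetric]) (auto simp: powr_powr)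

lemma less_rad_iff:
  assumes "0 < u" "0 < n" "0 \<le> d"
  shows "rad n u < d \<longleftrightarrow> u < real n * vol1 * d ^ DIM('a)"
proof -
  have "rad n u < d \<longleftrightarrow> rad n u ^ DIM('a) < d ^ DIM('a)"
  proof -
    have "d ^ DIM('a) \<le> rad n u ^ DIM('a) \<longleftrightarrow> d \<le> rad n u"
      using assms less_imp_le[OF rad_pos[of u n]] by (intro power_mono_iff) auto
    then show ?thesis by (simp only: not_le[symmetric])
  qed
  also have "\<dots> \<longleftrightarrow> u < real n * vol1 * d ^ DIM('a)"
    using assms by (simp add: rad_power field_simps)
  finally show ?thesis .
qed

lemma rad_tendsto_0: assumes "0 < u" shows "filterlim (\<lambda>n. rad n u) (at_right 0) sequentially"
proof -
  have "(\<lambda>n. (u / vol1) * inverse (real n)) \<longlonglongrightarrow> (u / vol1) * 0"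
    by (intro tendsto_intros lim_inverse_n)
  then have "(\<lambda>n. ((u / vol1) * inverse (real n)) powr (1 / real DIM('a))) \<longlonglongrightarrow> 0 powr (1 / real DIM('a))"
    using assms by (intro tendsto_powr') auto
  then have "(\<lambda>n. rad n u) \<longlonglongrightarrow> 0" by (simp add: rad_def divide_inverse mult_ac)
  moreover have "eventually (\<lambda>n. 0 < rad n u) sequentially"
    using eventually_gt_at_top[of 0] by eventually_elim (use assms in auto)
  ultimately show ?thesis by (auto simp: filterlim_at elim: eventually_mono)
qed

text \<open>\<open>n P (cball y r)\<close> equals \<open>u / vol1\<close> times the ratio of
  \<open>P (cball y r)\<close> to \<open>r ^ m\<close>. Being a differentiation point depends on
  \<open>y\<close> alone, so one null set serves all \<open>u\<close>.\<close>

lemma ball_probability_limit: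
  "AE y in P. \<forall>u>0. (\<lambda>n. real n * measure P (cball y (rad n u))) \<longlonglongrightarrow> u * f y"
proof (rule AE_P, use lebesgue_differentiation_cball[OF integrable_f] in eventually_elim, intro allI impI)
  fix y and u :: real assume u: "0 < u"
    and lim: "((\<lambda>r. (LINT z:cball y r|lborel. f z) / r ^ DIM('a)) \<longlongrightarrow> unit_ball_vol (real DIM('a)) * f y) (at_right 0)"
  from filterlim_compose[OF lim rad_tendsto_0[OF u]]
  have "(\<lambda>n. (u / vol1) * (measure P (cball y (rad n u)) / rad n u ^ DIM('a))) \<longlonglongrightarrow> (u / vol1) * (vol1 * f y)"
    by (intro tendsto_intros) (simp add: measure_P_eq vol1_def)
  moreover have "eventually (\<lambda>n. (u / vol1) * (measure P (cball y (rad n u)) / rad n u ^ DIM('a)) =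
      real n * measure P (cball y (rad n u))) sequentially"
    using eventually_gt_at_top[of 0] by eventually_elim (use u in \<open>auto simp: rad_power field_simps\<close>)
  ultimately show "(\<lambda>n. real n * measure P (cball y (rad n u))) \<longlonglongrightarrow> u * f y"
    by (simp add: tendsto_cong)
qed

section \<open>Averages over the centre and their decay\<close>

definition Phi :: "nat \<Rightarrow> nat \<Rightarrow> real \<Rightarrow> real" where
  "Phi k n u = (LINT y|P. binomial_tail n k (measure P (cball y (rad n u))))"

definition Phi_lim :: "nat \<Rightarrow> real \<Rightarrow> real" where
  "Phi_lim k u = (LINT y|P. poisson_tail k (u * f y))"

lemma Phi_tendsto:
  assumes u: "0 < u" shows "(\<lambda>n. Phi k n u) \<longlonglongrightarrow> Phi_lim k u"
  unfolding Phi_def Phi_lim_def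
proof (rule integral_dominated_convergence[where w = "\<lambda>_. 1"])
  show "AE y in P. (\<lambda>n. binomial_tail n k (measure P (cball y (rad n u)))) \<longlonglongrightarrow> poisson_tail k (u * f y)"
    using ball_probability_limit
  proof eventually_elim
    case (elim y)
    then show ?case using u by (intro poisson_limit) auto
  qed
  show "AE y in P. norm (binomial_tail n k (measure P (cball y (rad n u)))) \<le> 1" for n
    by (intro AE_I2) (simp add: binomial_tail_nonneg binomial_tail_le_1)
qed auto

lemma ennreal_Phi: "ennreal (Phi k n u) = (\<integral>\<^sup>+ y. ennreal (binomial_tail n k (measure P (cball y (rad n u)))) \<partial>P)"
  unfolding Phi_def
  by (rule nn_integral_eq_integral[symmetric])
    (auto simp: binomial_tail_nonneg intro!: P.integrable_const_bound[where B = 1] binomial_tail_le_1 AE_I2)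

lemma Phi_nonneg: "0 \<le> Phi k n u"
  unfolding Phi_def by (intro integral_nonneg_AE) (auto simp: binomial_tail_nonneg)

lemma Phi_le_1: "Phi k n u \<le> 1"
proof -
  have "ennreal (Phi k n u) \<le> (\<integral>\<^sup>+ y. 1 \<partial>P)"
    unfolding ennreal_Phi by (intro nn_integral_mono) (simp add: binomial_tail_le_1)
  also have "\<dots> = ennreal 1" using P.emeasure_space_1 by simp
  finally show ?thesis by (simp del: ennreal_1)
qed

lemma Phi_lim_nonneg: "0 \<le> u \<Longrightarrow> 0 \<le> Phi_lim k u"
  unfolding Phi_lim_def by (intro integral_nonneg_AE) (auto simp: poisson_tail_nonneg)

lemma Phi_measurable [measurable]: "Phi k n \<in> borel_measurable borel"
  unfolding Phi_def by measurable

lemma Phi_lim_measurable [measurable]: "Phi_lim k \<in> borel_measurable borel"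
  unfolding Phi_lim_def by measurable

text \<open>Insert the average over the balls \<open>cball z (r/2)\<close> containing \<open>y\<close>: each of them is contained in
  \<open>cball y r\<close>, so its probability cancels against \<open>h\<close>, and only the volume of the possible
  centres \<open>z\<close> remains.\<close>

lemma integral_inverse_ball_probability:
  assumes [measurable]: "h \<in> borel_measurable borel" and h: "\<And>y. 0 \<le> h y" "\<And>y. measure P (cball y r) * h y \<le> c"
    and c: "0 \<le> c" and r: "0 < r" and T: "0 \<le> T"
  shows "(\<integral>\<^sup>+ y. ennreal (h y) * indicator (cball 0 T) y \<partial>P) \<le> ennreal (c * ((2 * T + r) / r) ^ DIM('a))"
proof -
  let ?m = "DIM('a)"
  \<comment> \<open>The volume of a ball of radius \<open>r / 2\<close>. Integrating the kernel
    \<open>?g\<close> over \<open>z\<close> first reproduces the integral to be estimated,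
    multiplied by \<open>B\<close>.\<close>
  define B where "B = vol1 * (r / 2) ^ ?m"
  have B: "0 < B" using r by (simp add: B_def)
  interpret PL: pair_sigma_finite P "lborel :: 'a measure" ..
  let ?g = "\<lambda>y z. ennreal (h y) * indicator (cball 0 T) y * indicator {x. dist (fst x) (snd x) \<le> r / 2} (y, z)"
  have cl: "{x :: 'a \<times> 'a. dist (fst x) (snd x) \<le> r / 2} \<in> sets (borel \<Otimes>\<^sub>M borel)"
    unfolding borel_prod by (intro borel_closed closed_Collect_le continuous_intros)
  have [measurable]: "(\<lambda>x. ?g (fst x) (snd x)) \<in> borel_measurable (borel \<Otimes>\<^sub>M borel)"
  proof -
    have [measurable]: "(\<lambda>x. indicator (cball 0 T) (fst x) :: ennreal) \<in> borel_measurable (borel \<Otimes>\<^sub>M borel)"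
      by (rule measurable_compose[OF measurable_fst borel_measurable_indicator]) simp
    have [measurable]: "(\<lambda>x. indicator {x :: 'a \<times> 'a. dist (fst x) (snd x) \<le> r / 2} x :: ennreal) \<in> borel_measurable (borel \<Otimes>\<^sub>M borel)"
      by (rule borel_measurable_indicator) (rule cl)
    have "(\<lambda>x. ?g (fst x) (snd x)) = (\<lambda>x. ennreal (h (fst x)) * indicator (cball 0 T) (fst x) *
        indicator {x :: 'a \<times> 'a. dist (fst x) (snd x) \<le> r / 2} x)" by simp
    also have "\<dots> \<in> borel_measurable (borel \<Otimes>\<^sub>M borel)" by measurable
    finally show ?thesis .
  qed
  have inner: "(\<integral>\<^sup>+ y. ?g y z \<partial>P) \<le> ennreal c * indicator (cball 0 (T + r / 2)) z" for z
  proof (cases "z \<in> cball 0 (T + r / 2)")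
    case True
    let ?p = "measure P (cball z (r / 2))"
    have "(\<integral>\<^sup>+ y. ?g y z \<partial>P) \<le> (\<integral>\<^sup>+ y. ennreal (h y) * indicator (cball z (r / 2)) y \<partial>P)"
      by (intro nn_integral_mono) (auto simp: indicator_def dist_commute)
    also have "\<dots> \<le> ennreal c"
    \<comment> \<open>The bound \<open>h y \<le> c / ?p\<close> needs a ball with positive mass; a
      ball without mass contributes nothing to an integral with respect to \<open>P\<close>.\<close>
    proof (cases "?p = 0")
      case True
      then have "emeasure P (cball z (r / 2)) = 0" by (simp add: P.emeasure_eq_measure)
      then have "cball z (r / 2) \<in> null_sets P" by auto
      then have "(\<integral>\<^sup>+ y. ennreal (h y) * indicator (cball z (r / 2)) y \<partial>P) = 0"
        by (intro nn_integral_null_set)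
      then show ?thesis by simp
    next
      case False
      then have p: "0 < ?p" by (simp add: zero_less_measure_iff)
      have "(\<integral>\<^sup>+ y. ennreal (h y) * indicator (cball z (r / 2)) y \<partial>P) \<le> (\<integral>\<^sup>+ y. ennreal (c / ?p) * indicator (cball z (r / 2)) y \<partial>P)"
      proof (intro nn_integral_mono)
        fix y
        show "ennreal (h y) * indicator (cball z (r / 2)) y \<le> ennreal (c / ?p) * indicator (cball z (r / 2)) y"
        proof (cases "y \<in> cball z (r / 2)")
          case True
          have "cball z (r / 2) \<subseteq> cball y r"
          proof
            fix w assume w: "w \<in> cball z (r / 2)"
            have "dist y w \<le> dist y z + dist z w" by (rule dist_triangle)
            with True w show "w \<in> cball y r" by (simp add: dist_commute)
          qed
          then have "?p \<le> measure P (cball y r)" by (intro P.finite_measure_mono) auto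
          then have "?p * h y \<le> measure P (cball y r) * h y" using h(1) by (rule mult_right_mono)
          with h(2)[of y] have "h y \<le> c / ?p" using p by (simp add: field_simps)
          then show ?thesis by (intro mult_right_mono ennreal_leI) auto
        qed simp
      qed
      also have "\<dots> = ennreal c"
        using p c by (simp add: nn_integral_cmult_indicator P.emeasure_eq_measure ennreal_mult[symmetric])
      finally show ?thesis .
    qed
    finally show ?thesis using True by simp
  next
    case False
    have "?g y z = 0" for y
    proof (rule ccontr)
      assume "?g y z \<noteq> 0"
      then have "norm y \<le> T" "dist y z \<le> r / 2" by (auto simp: indicator_def split: if_splits)
      then have "norm z \<le> T + r / 2"
        using norm_triangle_ineq2[of z y] by (simp add: dist_norm norm_minus_commute)
      with False show False by simp
    qed
    then have "(\<integral>\<^sup>+ y. ?g y z \<partial>P) = 0" by (simp only: nn_integral_const) simp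
    then show ?thesis by simp
  qed
  have "ennreal B * (\<integral>\<^sup>+ y. ennreal (h y) * indicator (cball 0 T) y \<partial>P) = (\<integral>\<^sup>+ y. (\<integral>\<^sup>+ z. ?g y z \<partial>lborel) \<partial>P)"
  proof -
    have [measurable]: "cball (0::'a) T \<in> sets borel" by simp
    have eq: "(\<integral>\<^sup>+ z. ?g y z \<partial>lborel) = ennreal B * (ennreal (h y) * indicator (cball 0 T) y)" for y
    proof -
      have "(\<integral>\<^sup>+ z. ?g y z \<partial>lborel) = (\<integral>\<^sup>+ z. (ennreal (h y) * indicator (cball 0 T) y) * indicator (cball y (r / 2)) z \<partial>lborel)"
        by (intro nn_integral_cong) (simp add: indicator_def)
      also have "\<dots> = (ennreal (h y) * indicator (cball 0 T) y) * emeasure lborel (cball y (r / 2))"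
        by (rule nn_integral_cmult_indicator) simp
      finally show ?thesis using r by (simp add: emeasure_cball B_def vol1_def mult.commute)
    qed
    show ?thesis unfolding eq by (rule nn_integral_cmult[symmetric]) measurable
  qed
  also have "\<dots> = (\<integral>\<^sup>+ z. (\<integral>\<^sup>+ y. ?g y z \<partial>P) \<partial>lborel)"
  proof (rule PL.Fubini'[symmetric])
    have "(\<lambda>x. ?g (fst x) (snd x)) \<in> borel_measurable (P \<Otimes>\<^sub>M lborel)"
      unfolding measurable_cong_sets[OF sets_pair_measure_cong[OF sets_P sets_lborel] refl] by fact
    then show "(\<lambda>(y, z). ?g y z) \<in> borel_measurable (P \<Otimes>\<^sub>M lborel)"
      by (simp only: case_prod_beta')
  qed
  also have "\<dots> \<le> (\<integral>\<^sup>+ z. ennreal c * indicator (cball (0::'a) (T + r / 2)) z \<partial>lborel)"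
    by (rule nn_integral_mono) (rule inner)
  also have "\<dots> = ennreal (c * (vol1 * (T + r / 2) ^ ?m))"
    using T r c by (simp add: nn_integral_cmult_indicator emeasure_cball vol1_def ennreal_mult)
  \<comment> \<open>The remaining factor is the ratio of the volumes of balls with radii
    \<open>T + r / 2\<close> and \<open>r / 2\<close>.\<close>
  also have "c * (vol1 * (T + r / 2) ^ ?m) = B * (c * ((2 * T + r) / r) ^ ?m)"
  proof -
    have "(T + r / 2) ^ ?m = (r / 2) ^ ?m * ((2 * T + r) / r) ^ ?m"
    proof -
      have "T + r / 2 = (r / 2) * ((2 * T + r) / r)" using r by (simp add: field_simps)
      then show ?thesis by (simp only: power_mult_distrib)
    qed
    then show ?thesis by (simp add: B_def)
  qed
  also have "ennreal (B * (c * ((2 * T + r) / r) ^ ?m)) = ennreal B * ennreal (c * ((2 * T + r) / r) ^ ?m)"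
    using B c T r by (intro ennreal_mult) auto
  finally show ?thesis
    using B by (simp add: ennreal_mult_le_mult_iff)
qed

text \<open>Markov's inequality for \<open>norm x powr s\<close>; the constant is the moment
  itself.\<close>

lemma tail_probability_bound:
  assumes fin: "(\<integral>\<^sup>+ x. ennreal (norm x powr s * f x) \<partial>lborel) < \<infinity>" and s: "0 < s"
  obtains M where "0 \<le> M" "\<And>T. 0 < T \<Longrightarrow> measure P (- cball 0 T) \<le> M * T powr - s"
proof -
  let ?I = "\<integral>\<^sup>+ x. ennreal (norm x powr s * f x) \<partial>lborel"
  have "measure P (- cball 0 T) \<le> enn2real ?I * T powr - s" if T: "0 < T" for T
  proof -
    have "emeasure P (- cball 0 T) = (\<integral>\<^sup>+ x. ennreal (f x) * indicator (- cball 0 T) x \<partial>lborel)"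
      unfolding P_def by (rule emeasure_density) auto
    also have "\<dots> \<le> (\<integral>\<^sup>+ x. ennreal (T powr - s) * ennreal (norm x powr s * f x) \<partial>lborel)"
    proof (intro nn_integral_mono)
      fix x
      show "ennreal (f x) * indicator (- cball 0 T) x \<le> ennreal (T powr - s) * ennreal (norm x powr s * f x)"
      proof (cases "norm x \<le> T")
        case False
        have "1 \<le> T powr - s * norm x powr s"
          using False T s by (simp add: powr_minus field_simps powr_mono2)
        from mult_right_mono[OF this f_nonneg[of x]] False show ?thesis
          by (simp add: ennreal_mult[symmetric] ennreal_leI mult.assoc)
      qed simp
    qed
    also have "\<dots> = ennreal (T powr - s) * ?I" by (rule nn_integral_cmult) auto
    also have "?I = ennreal (enn2real ?I)" using fin by simp
    finally show ?thesis
      by (simp add: P.emeasure_eq_measure ennreal_mult[symmetric] mult.commute)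
  qed
  then show thesis by (intro that[of "enn2real ?I"]) auto
qed

text \<open>With \<open>T = u powr (1 / (m + s))\<close> the tail bound \<open>T powr - s\<close> and the averaging
  bound \<open>T ^ m / u\<close> coincide. If the radius exceeds \<open>2 * T\<close>, all balls centred in
  \<open>cball 0 T\<close> contain most of the mass, and a high power of the tail probability remains.\<close>

lemma Phi_decay:
  assumes fin: "(\<integral>\<^sup>+ x. ennreal (norm x powr s * f x) \<partial>lborel) < \<infinity>" and s: "0 < s"
  obtains C n0 where "0 \<le> C"
    "\<And>n u. n0 \<le> n \<Longrightarrow> 0 < u \<Longrightarrow> Phi k n u \<le> C * u powr - (s / (real DIM('a) + s))"
proof -
  obtain M where M: "0 \<le> M" and tail: "\<And>T. 0 < T \<Longrightarrow> measure P (- cball 0 T) \<le> M * T powr - s"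
    using tail_probability_bound[OF fin s] by blast
  define m where "m = DIM('a)"
  have m: "0 < m" by (simp add: m_def)
  \<comment> \<open>Chosen so that the mass outside a ball of radius \<open>T0\<close> about the
    origin is at most one half.\<close>
  define T0 where "T0 = max 1 ((2 * M) powr (1 / s))"
  have T0: "1 \<le> T0" by (simp add: T0_def)
  have MT0: "M * T0 powr - s \<le> 1 / 2"
  proof -
    have "2 * M = ((2 * M) powr (1 / s)) powr s" using M s by (simp add: powr_powr)
    also have "\<dots> \<le> T0 powr s" using s by (intro powr_mono2) (auto simp: T0_def)
    finally show ?thesis using T0 by (simp add: powr_minus field_simps)
  qed
  \<comment> \<open>The least number of tail factors of order \<open>r powr - s\<close> whose
    product decays at least like \<open>r powr - m\<close>.\<close>
  define L where "L = nat \<lceil>real m / s\<rceil>"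
  have L: "real m \<le> s * real L"
  proof -
    have "real m / s \<le> real L" unfolding L_def by linarith
    then show ?thesis using s by (simp add: field_simps)
  qed
  \<comment> \<open>\<open>K1\<close> collects \<open>k / n * (4 * T / r) ^ m\<close>, rewritten by
    \<open>n * vol1 * r ^ m = u\<close>. In \<open>K2\<close> the factor \<open>2 ^ k\<close> comes
    from \<open>binomial_tail_le_power\<close>, the power of \<open>L\<close> from the tail
    probability at radius \<open>r / 2\<close>, and \<open>4 * k\<close> from
    \<open>binomial_tail_bound\<close> with success probability at least one half.\<close>
  define K1 where "K1 = real k * 4 ^ m * vol1"
  define K2 where "K2 = 2 ^ k * (M * 2 powr s) ^ L * (4 * real k) * vol1"
  have K: "0 \<le> K1" "0 \<le> K2" using M by (auto simp: K1_def K2_def)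
  define C where "C = T0 powr s + M + K1 + K2"
  have C: "0 \<le> C" using M K by (simp add: C_def)
  \<comment> \<open>The threshold meets the hypothesis of \<open>binomial_tail_le_power\<close> and
    makes \<open>n\<close> positive.\<close>
  have "Phi k n u \<le> C * u powr - (s / (real m + s))" if n: "2 * L + k + 1 \<le> n" and u: "0 < u" for n u
  proof -
    define T where "T = u powr (1 / (real m + s))"
    have T: "0 < T" using u by (simp add: T_def)
    have Tu: "T powr (real m + s) = u" using u s by (simp add: T_def powr_powr)
    have Ts: "T powr - s = u powr - (s / (real m + s))" by (simp add: T_def powr_powr)
    have "Phi k n u \<le> C * T powr - s"
    \<comment> \<open>For bounded \<open>T\<close>, that is for bounded \<open>u\<close>, the
      trivial bound \<open>Phi \<le> 1\<close> is absorbed into the constant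
      \<open>T0 powr s\<close>.\<close>
    proof (cases "T < T0")
      case True
      have "1 \<le> T0 powr s * T powr - s"
        using True T s by (simp add: powr_minus field_simps powr_mono2)
      also have "\<dots> \<le> C * T powr - s" using M K by (intro mult_right_mono) (auto simp: C_def)
      finally show ?thesis using Phi_le_1[of k n u] by simp
    next
      case False
      then have T1: "1 \<le> T" using T0 by simp
      define r where "r = rad n u"
      have r: "0 < r" using u n by (simp add: r_def)
      have rm: "real n * vol1 * r ^ m = u"
        using u n by (simp add: r_def rad_power m_def)
      define h where "h y = binomial_tail n k (measure P (cball y r))" for y
      have h: "0 \<le> h y" "h y \<le> 1" for y
        by (auto simp: h_def binomial_tail_nonneg binomial_tail_le_1)
      have [measurable]: "h \<in> borel_measurable borel" unfolding h_def by measurable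
      have [measurable]: "cball (0 :: 'a) T \<in> sets borel" by simp
      have I1: "(\<integral>\<^sup>+ y. ennreal (h y) * indicator (cball 0 T) y \<partial>P) \<le> ennreal ((K1 + K2) * T powr - s)"
      proof (cases "r \<le> 2 * T")
        case True
        have "(\<integral>\<^sup>+ y. ennreal (h y) * indicator (cball 0 T) y \<partial>P) \<le> ennreal (real k / real (Suc n) * ((2 * T + r) / r) ^ DIM('a))"
        proof (rule integral_inverse_ball_probability)
          fix y
          have "real (Suc n) * measure P (cball y r) * h y \<le> real k"
            unfolding h_def by (rule binomial_tail_bound) auto
          then show "measure P (cball y r) * h y \<le> real k / real (Suc n)"
            by (simp add: field_simps)
        qed (use h r T in auto)
        also have "\<dots> \<le> ennreal ((K1 + K2) * T powr - s)"
        proof (rule ennreal_leI)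
          have "real k / real (Suc n) * ((2 * T + r) / r) ^ m \<le> real k / real n * (4 * T / r) ^ m"
            using True T r n by (intro mult_mono power_mono divide_right_mono frac_le) auto
          also have "\<dots> = K1 * (T ^ m / u)"
            using r n by (simp add: rm[symmetric] K1_def power_divide power_mult_distrib field_simps)
          also have "T ^ m / u = T powr - s"
            using T by (simp add: Tu[symmetric] powr_add powr_realpow powr_minus field_simps)
          also have "K1 * T powr - s \<le> (K1 + K2) * T powr - s" using K by (intro mult_right_mono) auto
          finally show "real k / real (Suc n) * ((2 * T + r) / r) ^ DIM('a) \<le> (K1 + K2) * T powr - s"
            by (simp add: m_def)
        qed
        finally show ?thesis .
      next
        \<comment> \<open>For such large radii the averaging bound is only of order
          \<open>1 / n\<close>, while order \<open>1 / u\<close>, that is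
          \<open>1 / (n * r ^ m)\<close>, is wanted. The missing factor \<open>r powr - m\<close>
          comes from the tail probability raised to the power \<open>L\<close>, uniformly in
          \<open>y\<close>.\<close>
        case False
        have hb: "h y \<le> (K1 + K2) * T powr - s" if y: "norm y \<le> T" for y
        proof -
          define p where "p = measure P (cball y r)"
          have p: "0 \<le> p" "p \<le> 1" by (auto simp: p_def)
          have "cball 0 (r / 2) \<subseteq> cball y r"
          proof
            fix w :: 'a assume "w \<in> cball 0 (r / 2)"
            then show "w \<in> cball y r"
              using norm_triangle_ineq4[of y w] y False by (simp add: dist_norm)
          qed
          then have "measure P (cball 0 (r / 2)) \<le> p"
            unfolding p_def by (intro P.finite_measure_mono) auto
          moreover have "measure P (- cball 0 (r / 2)) = 1 - measure P (cball 0 (r / 2))"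
            using P.prob_compl[of "cball 0 (r / 2)"] by (simp add: Compl_eq_Diff_UNIV)
          ultimately have q: "1 - p \<le> M * (r / 2) powr - s"
            using tail[of "r / 2"] r by simp
          also have "\<dots> \<le> M * T0 powr - s"
            using False \<open>\<not> T < T0\<close> T0 s M by (intro mult_left_mono powr_mono2') auto
          finally have p2: "1 / 2 \<le> p" using MT0 by simp
          define b where "b = binomial_tail (n - L) k p"
          have b: "0 \<le> b" using p by (simp add: b_def binomial_tail_nonneg)
          \<comment> \<open>At least half of the trials remain because \<open>2 * L \<le> n\<close>,
            and \<open>p\<close> is at least one half.\<close>
          have "(real n / 2) * (1 / 2) * b \<le> real (Suc (n - L)) * p * b"
            using n p2 b by (intro mult_right_mono mult_mono) auto
          also have "\<dots> \<le> real k" unfolding b_def by (rule binomial_tail_bound) (use p in auto)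
          finally have bk: "b \<le> 4 * real k / real n" using n by (simp add: field_simps)
          have "(1 - p) ^ L \<le> (M * (r / 2) powr - s) ^ L" using q p by (intro power_mono) auto
          also have "\<dots> = (M * 2 powr s) ^ L * r powr (- (s * real L))"
            using r by (simp add: powr_divide power_mult_distrib powr_minus powr_power field_simps)
          also have "\<dots> \<le> (M * 2 powr s) ^ L * r powr (- real m)"
            using False T1 L M by (intro mult_left_mono powr_mono) auto
          also have "r powr (- real m) = 1 / r ^ m"
            using r by (simp add: powr_minus powr_realpow divide_inverse)
          finally have pl: "(1 - p) ^ L \<le> (M * 2 powr s) ^ L * (1 / r ^ m)" .
          have "h y \<le> 2 ^ k * (1 - p) ^ L * b"
            unfolding h_def b_def p_def[symmetric] using p n by (intro binomial_tail_le_power) auto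
          also have "\<dots> \<le> 2 ^ k * ((M * 2 powr s) ^ L * (1 / r ^ m)) * (4 * real k / real n)"
            using pl bk b M r p by (intro mult_mono mult_left_mono) auto
          also have "\<dots> = K2 * (1 / u)"
            using r n by (simp add: rm[symmetric] K2_def field_simps)
          also have "1 / u \<le> T powr - s"
          proof -
            have "T powr s \<le> T powr (real m + s)" using T1 by (intro powr_mono) auto
            then show ?thesis using T u unfolding Tu by (simp add: powr_minus field_simps)
          qed
          finally have "h y \<le> K2 * T powr - s" using K by (simp add: mult_left_mono)
          also have "\<dots> \<le> (K1 + K2) * T powr - s" using K by (intro mult_right_mono) auto
          finally show ?thesis .
        qed
        have "(\<integral>\<^sup>+ y. ennreal (h y) * indicator (cball 0 T) y \<partial>P) \<le> (\<integral>\<^sup>+ y. ennreal ((K1 + K2) * T powr - s) \<partial>P)"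
          by (intro nn_integral_mono) (auto simp: indicator_def intro!: ennreal_leI hb)
        also have "\<dots> = ennreal ((K1 + K2) * T powr - s)" using P.emeasure_space_1 by simp
        finally show ?thesis .
      qed
      have "ennreal (Phi k n u) = (\<integral>\<^sup>+ y. ennreal (h y) \<partial>P)"
        by (simp add: ennreal_Phi h_def r_def)
      also have "\<dots> \<le> (\<integral>\<^sup>+ y. ennreal (h y) * indicator (cball 0 T) y + indicator (- cball 0 T) y \<partial>P)"
        using h by (intro nn_integral_mono) (auto simp: indicator_def)
      also have "\<dots> = (\<integral>\<^sup>+ y. ennreal (h y) * indicator (cball 0 T) y \<partial>P) + ennreal (measure P (- cball 0 T))"
        by (subst nn_integral_add) (auto simp: P.emeasure_eq_measure)
      also have "\<dots> \<le> ennreal ((K1 + K2) * T powr - s) + ennreal (M * T powr - s)"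
        by (intro add_mono I1 ennreal_leI tail T)
      also have "\<dots> = ennreal ((K1 + K2) * T powr - s + M * T powr - s)"
        using K M by (intro ennreal_plus[symmetric]) auto
      finally have "Phi k n u \<le> (K1 + K2) * T powr - s + M * T powr - s"
        using K M by (simp add: ennreal_le_iff del: ennreal_plus)
      also have "\<dots> = (K1 + K2 + M) * T powr - s" by (simp add: algebra_simps)
      also have "\<dots> \<le> C * T powr - s" by (intro mult_right_mono) (auto simp: C_def)
      finally show ?thesis .
    qed
    then show ?thesis by (simp add: Ts)
  qed
  then show thesis using that[of C "2 * L + k + 1"] C by (simp add: m_def)
qed

end

subsection \<open>Limits of moments\<close>

text \<open>The density of \<open>d(u^b)\<close> on the positive half line. Its vanishing elsewhere
  lets all later integrals run over the whole real line.\<close>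

definition layer_weight :: "real \<Rightarrow> real \<Rightarrow> ennreal" where
  "layer_weight b u = ennreal (b * u powr (b - 1)) * indicator {0<..} u"

lemma layer_weight_measurable [measurable]: "layer_weight b \<in> borel_measurable borel"
  unfolding layer_weight_def by measurable

text \<open>The fundamental theorem of calculus for \<open>u powr b\<close>. The strict inequality
  \<open>u < a\<close> fits the events of \<open>knn_dist_gt_iff\<close>; the endpoint is a null
  set.\<close>

lemma powr_layer_cake:
  assumes b: "0 < b" and a: "0 \<le> a"
  shows "ennreal (a powr b) = (\<integral>\<^sup>+ u. layer_weight b u * indicator {u. u < a} u \<partial>lborel)"
proof -
  have "((\<lambda>u. u powr (b - 1)) has_integral (a powr ((b - 1) + 1) / ((b - 1) + 1))) {0..a}"
    using a b by (intro has_integral_powr_from_0) auto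
  from has_integral_mult_right[OF this, of b]
  have "((\<lambda>u. b * u powr (b - 1)) has_integral (a powr b)) {0..a}" using b by simp
  from nn_integral_has_integral_lebesgue[OF _ this]
  have "ennreal (a powr b) = (\<integral>\<^sup>+ u. ennreal (indicator {0..a} u * (b * u powr (b - 1))) \<partial>lborel)"
    using b by simp
  also have "\<dots> = (\<integral>\<^sup>+ u. layer_weight b u * indicator {u. u < a} u \<partial>lborel)"
  proof (rule nn_integral_cong_AE, use AE_lborel_singleton[of a] in eventually_elim)
    fix u :: real assume "u \<noteq> a"
    then show "ennreal (indicator {0..a} u * (b * u powr (b - 1))) = layer_weight b u * indicator {u. u < a} u"
      by (auto simp: layer_weight_def indicator_def)
  qed
  finally show ?thesis .
qed

text \<open>Below 1 the weight itself is integrable because \<open>b > 0\<close>; above 1 the decay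
  leaves the exponent \<open>b - 1 - g\<close>, which is less than -1.\<close>

lemma layer_weight_decay_finite:
  assumes b: "0 < b" "b < g" and C: "0 \<le> C"
  shows "(\<integral>\<^sup>+ u. layer_weight b u * ennreal (min 1 (C * u powr - g)) \<partial>lborel) < \<infinity>"
proof -
  have "((\<lambda>u. u powr (b - 1 - g)) has_integral - (1 powr (b - 1 - g + 1)) / (b - 1 - g + 1)) {1..}"
    using b by (intro has_integral_powr_to_inf) auto
  from nn_integral_has_integral_lebesgue[OF _ this]
  have tail: "(\<integral>\<^sup>+ u. ennreal (indicator {1..} u * u powr (b - 1 - g)) \<partial>lborel) < \<infinity>"
    by simp
  have "(\<integral>\<^sup>+ u. layer_weight b u * ennreal (min 1 (C * u powr - g)) \<partial>lborel) \<le>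
     (\<integral>\<^sup>+ u. layer_weight b u * indicator {u. u < 1} u + ennreal (b * C) * ennreal (indicator {1..} u * u powr (b - 1 - g)) \<partial>lborel)"
  proof (intro nn_integral_mono)
    fix u :: real
    show "layer_weight b u * ennreal (min 1 (C * u powr - g)) \<le>
      layer_weight b u * indicator {u. u < 1} u + ennreal (b * C) * ennreal (indicator {1..} u * u powr (b - 1 - g))"
    proof (cases "u < 1")
      case True
      have "layer_weight b u * ennreal (min 1 (C * u powr - g)) \<le> layer_weight b u * 1"
        by (intro mult_left_mono) (auto simp: ennreal_le_1)
      with True show ?thesis by simp
    next
      case False
      have "layer_weight b u * ennreal (min 1 (C * u powr - g)) \<le> ennreal (b * u powr (b - 1)) * ennreal (C * u powr - g)"
        unfolding layer_weight_def by (intro mult_mono ennreal_leI) (auto simp: indicator_def)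
      also have "\<dots> = ennreal (b * C * (u powr (b - 1) * u powr - g))"
        using b C by (simp add: ennreal_mult[symmetric] mult_ac)
      also have "u powr (b - 1) * u powr - g = u powr (b - 1 - g)"
        by (simp add: powr_add[symmetric])
      also have "ennreal (b * C * u powr (b - 1 - g)) = ennreal (b * C) * ennreal (u powr (b - 1 - g))"
        using b C by (intro ennreal_mult) auto
      finally show ?thesis using False by simp
    qed
  qed
  also have "\<dots> = ennreal 1 + ennreal (b * C) * (\<integral>\<^sup>+ u. ennreal (indicator {1..} u * u powr (b - 1 - g)) \<partial>lborel)"
    using powr_layer_cake[OF b(1), of 1] by (subst nn_integral_add) (auto simp: nn_integral_cmult)
  also have "\<dots> < \<infinity>" using tail by (simp add: ennreal_mult_less_top)
  finally show ?thesis .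
qed

lemma layer_weight_gamma:
  assumes b: "0 < b" and l: "0 < l"
  shows "(\<integral>\<^sup>+ u. layer_weight b u * ennreal ((u * l) ^ j / fact j * exp (- (u * l))) \<partial>lborel) =
    ennreal (l powr - b * (b * Gamma (b + real j) / fact j))"
proof -
  let ?c = "b * l powr (1 - b) / fact j"
  \<comment> \<open>The shape \<open>0 + l * u\<close> is the one of
    \<open>nn_integral_real_affine\<close>, which substitutes \<open>t = l * u\<close> in the Gamma
    integral below.\<close>
  have pt: "layer_weight b u * ennreal ((u * l) ^ j / fact j * exp (- (u * l))) =
      ennreal ?c * ennreal (indicator {0..} (0 + l * u) * (0 + l * u) powr (b + real j - 1) / exp (0 + l * u))" for u
  proof (cases "0 < u")
    case True
    have "u powr (b - 1) * (u * l) ^ j = l powr (1 - b) * (l * u) powr (b + real j - 1)"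
    proof -
      have "(l * u) powr (b + real j - 1) = (l * u) powr real j * (l * u) powr (b - 1)"
        by (simp add: powr_add[symmetric] algebra_simps)
      also have "(l * u) powr real j = (u * l) ^ j" using True l by (simp add: powr_realpow mult.commute)
      also have "(l * u) powr (b - 1) = l powr (b - 1) * u powr (b - 1)" using True l by (simp add: powr_mult)
      finally have "l powr (1 - b) * (l * u) powr (b + real j - 1) = (l powr (1 - b) * l powr (b - 1)) * (u powr (b - 1) * (u * l) ^ j)"
        by simp
      also have "l powr (1 - b) * l powr (b - 1) = 1" using l by (simp add: powr_add[symmetric])
      finally show ?thesis by simp
    qed
    then have "b * u powr (b - 1) * ((u * l) ^ j / fact j * exp (- (u * l))) =
      ?c * ((l * u) powr (b + real j - 1) / exp (l * u))"
      by (simp add: exp_minus field_simps)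
    then show ?thesis using True l b
      by (simp add: layer_weight_def ennreal_mult[symmetric])
  next
    case False
    then show ?thesis using l
      by (cases "u = 0") (auto simp: layer_weight_def indicator_def mult_le_0_iff zero_le_mult_iff)
  qed
  have "(\<integral>\<^sup>+ u. layer_weight b u * ennreal ((u * l) ^ j / fact j * exp (- (u * l))) \<partial>lborel) =
      ennreal ?c * (\<integral>\<^sup>+ u. ennreal (indicator {0..} (0 + l * u) * (0 + l * u) powr (b + real j - 1) / exp (0 + l * u)) \<partial>lborel)"
    unfolding pt by (rule nn_integral_cmult) measurable
  also have "(\<integral>\<^sup>+ u. ennreal (indicator {0..} (0 + l * u) * (0 + l * u) powr (b + real j - 1) / exp (0 + l * u)) \<partial>lborel) =
      ennreal (1 / l) * ennreal (Gamma (b + real j))"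
  proof -
    have "ennreal (Gamma (b + real j)) = (\<integral>\<^sup>+ t. ennreal (indicator {0..} t * t powr (b + real j - 1) / exp t) \<partial>lborel)"
      by (rule Gamma_conv_nn_integral_real) (use b in auto)
    also have "\<dots> = ennreal l * (\<integral>\<^sup>+ u. ennreal (indicator {0..} (0 + l * u) * (0 + l * u) powr (b + real j - 1) / exp (0 + l * u)) \<partial>lborel)"
      using l by (subst nn_integral_real_affine[of _ l 0]) auto
    finally show ?thesis using l
      by (simp add: mult.assoc[symmetric] ennreal_mult[symmetric])
  qed
  also have "ennreal ?c * (ennreal (1 / l) * ennreal (Gamma (b + real j))) = ennreal (?c * (1 / l * Gamma (b + real j)))"
    using b l Gamma_real_pos[of "b + real j"] by (simp add: ennreal_mult[symmetric] less_imp_le)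
  also have "?c * (1 / l * Gamma (b + real j)) = l powr - b * (b * Gamma (b + real j) / fact j)"
  proof -
    have "l powr (1 - b) = l powr - b * l" using l by (simp add: powr_diff powr_minus divide_inverse)
    then show ?thesis using l by simp
  qed
  finally show ?thesis .
qed

text \<open>In a Poisson process of rate \<open>l\<close> the \<open>k\<close>-th arrival is later
  than \<open>u\<close> iff there are fewer than \<open>k\<close> arrivals up to \<open>u\<close>.
  The integral is therefore the moment of order \<open>b\<close> of a Gamma variable with shape
  \<open>k\<close> and rate \<open>l\<close>.\<close>

lemma layer_weight_poisson_tail:
  assumes b: "0 < b" and l: "0 < l" and k: "1 \<le> k"
  shows "(\<integral>\<^sup>+ u. layer_weight b u * ennreal (poisson_tail k (u * l)) \<partial>lborel) =
    ennreal (l powr - b * (Gamma (real k + b) / Gamma (real k)))"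
proof -
  obtain k' where k': "k = Suc k'" using k by (cases k) auto
  have G: "0 \<le> l powr - b * (b * Gamma (b + real j) / fact j)" for j
    using b Gamma_real_pos[of "b + real j"] by simp
  have "(\<integral>\<^sup>+ u. layer_weight b u * ennreal (poisson_tail k (u * l)) \<partial>lborel) =
     (\<integral>\<^sup>+ u. (\<Sum>j<k. layer_weight b u * ennreal ((u * l) ^ j / fact j * exp (- (u * l)))) \<partial>lborel)"
  proof (intro nn_integral_cong)
    fix u :: real
    show "layer_weight b u * ennreal (poisson_tail k (u * l)) =
       (\<Sum>j<k. layer_weight b u * ennreal ((u * l) ^ j / fact j * exp (- (u * l))))"
    proof (cases "0 < u")
      case True
      then show ?thesis using l
        by (simp add: poisson_tail_def sum_distrib_left[symmetric] sum_ennreal)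
    qed (simp add: layer_weight_def)
  qed
  also have "\<dots> = (\<Sum>j<k. ennreal (l powr - b * (b * Gamma (b + real j) / fact j)))"
    unfolding layer_weight_gamma[OF b l, symmetric] by (rule nn_integral_sum) measurable
  also have "\<dots> = ennreal (\<Sum>j<k. l powr - b * (b * Gamma (b + real j) / fact j))"
    using G by (intro sum_ennreal) auto
  also have "(\<Sum>j<k. l powr - b * (b * Gamma (b + real j) / fact j)) = l powr - b * (Gamma (real k + b) / Gamma (real k))"
    using sum_Gamma_div_fact[OF b, of k'] by (simp only: sum_distrib_left[symmetric] k')
  finally show ?thesis .
qed

section \<open>Moments of the limiting law\<close>

context density_sample
begin

lemma integrable_poisson_tail: "0 \<le> u \<Longrightarrow> integrable P (\<lambda>y. poisson_tail k (u * f y))"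
  by (auto intro!: P.integrable_const_bound[where B = 1] AE_I2 simp: poisson_tail_nonneg poisson_tail_le_1)

lemma Phi_lim_le_1:
  assumes "0 \<le> u" shows "Phi_lim k u \<le> 1"
  unfolding Phi_lim_def using assms
  by (intro P.integral_le_const integrable_poisson_tail AE_I2 poisson_tail_le_1) auto

lemma ennreal_Phi_lim:
  assumes "0 \<le> u"
  shows "ennreal (Phi_lim k u) = (\<integral>\<^sup>+ y. ennreal (f y) * ennreal (poisson_tail k (u * f y)) \<partial>lborel)"
proof -
  have "ennreal (Phi_lim k u) = (\<integral>\<^sup>+ y. ennreal (poisson_tail k (u * f y)) \<partial>P)"
    unfolding Phi_lim_def using assms
    by (intro nn_integral_eq_integral[symmetric] integrable_poisson_tail AE_I2 poisson_tail_nonneg) auto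
  then show ?thesis by (simp add: nn_integral_P)
qed

text \<open>After exchanging the integrals, \<open>y\<close> contributes
  \<open>f y * f y powr - b\<close>; for \<open>b = 1 - q\<close> this is \<open>f y powr q\<close>,
  the integrand of \<open>G_functional\<close>.\<close>

lemma Phi_lim_moment:
  assumes b: "0 < b" and k: "1 \<le> k"
  shows "(\<integral>\<^sup>+ u. layer_weight b u * ennreal (Phi_lim k u) \<partial>lborel) =
    ennreal (Gamma (real k + b) / Gamma (real k)) * (\<integral>\<^sup>+ y. ennreal (f y powr (1 - b)) \<partial>lborel)"
proof -
  let ?c = "Gamma (real k + b) / Gamma (real k)"
  have c: "0 \<le> ?c" using b k by (auto intro!: divide_nonneg_nonneg less_imp_le[OF Gamma_real_pos])
  have "(\<integral>\<^sup>+ u. layer_weight b u * ennreal (Phi_lim k u) \<partial>lborel) =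
    (\<integral>\<^sup>+ u. (\<integral>\<^sup>+ y. ennreal (f y) * (layer_weight b u * ennreal (poisson_tail k (u * f y))) \<partial>lborel) \<partial>lborel)"
  proof (intro nn_integral_cong)
    fix u :: real
    show "layer_weight b u * ennreal (Phi_lim k u) = (\<integral>\<^sup>+ y. ennreal (f y) * (layer_weight b u * ennreal (poisson_tail k (u * f y))) \<partial>lborel)"
    proof (cases "0 < u")
      case True
      then show ?thesis
        by (subst ennreal_Phi_lim) (auto simp: nn_integral_cmult[symmetric] mult_ac)
    qed (simp add: layer_weight_def)
  qed
  also have "\<dots> = (\<integral>\<^sup>+ y. (\<integral>\<^sup>+ u. ennreal (f y) * (layer_weight b u * ennreal (poisson_tail k (u * f y))) \<partial>lborel) \<partial>lborel)"
    by (rule lborel_pair.Fubini'[symmetric]) (unfold case_prod_beta', measurable)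
  also have "\<dots> = (\<integral>\<^sup>+ y. ennreal ?c * ennreal (f y powr (1 - b)) \<partial>lborel)"
  proof (intro nn_integral_cong)
    fix y
    show "(\<integral>\<^sup>+ u. ennreal (f y) * (layer_weight b u * ennreal (poisson_tail k (u * f y))) \<partial>lborel) = ennreal ?c * ennreal (f y powr (1 - b))"
    \<comment> \<open>Where \<open>f\<close> vanishes the layer integral of the Poisson tail is
      infinite, but the factor \<open>f y\<close> inside makes the left side 0, and
      \<open>0 powr (1 - b)\<close> is 0 as well.\<close>
    proof (cases "f y = 0")
      case False
      then have fy: "0 < f y" by (simp add: less_le)
      have "(\<integral>\<^sup>+ u. ennreal (f y) * (layer_weight b u * ennreal (poisson_tail k (u * f y))) \<partial>lborel) =
        ennreal (f y) * ennreal (f y powr - b * ?c)"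
        unfolding layer_weight_poisson_tail[OF b fy k, symmetric] by (rule nn_integral_cmult) measurable
      also have "\<dots> = ennreal (f y * (f y powr - b * ?c))"
        using c by (intro ennreal_mult[symmetric] mult_nonneg_nonneg) auto
      also have "f y * (f y powr - b * ?c) = ?c * f y powr (1 - b)"
        using fy by (simp add: powr_diff powr_minus divide_inverse)
      also have "ennreal (?c * f y powr (1 - b)) = ennreal ?c * ennreal (f y powr (1 - b))"
        using c by (intro ennreal_mult) auto
      finally show ?thesis .
    qed simp
  qed
  also have "\<dots> = ennreal ?c * (\<integral>\<^sup>+ y. ennreal (f y powr (1 - b)) \<partial>lborel)"
    by (rule nn_integral_cmult) measurable
  finally show ?thesis .
qed

lemma Phi_moment_tendsto:
  assumes b: "0 < b" "b < g" and C: "0 \<le> C"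
    and decay: "\<And>n u. n0 \<le> n \<Longrightarrow> 0 < u \<Longrightarrow> Phi k n u \<le> C * u powr - g"
  shows "(\<lambda>n. \<integral>\<^sup>+ u. layer_weight b u * ennreal (Phi k n u) \<partial>lborel) \<longlonglongrightarrow>
      (\<integral>\<^sup>+ u. layer_weight b u * ennreal (Phi_lim k u) \<partial>lborel)"
proof (rule LIMSEQ_offset[where k = n0], rule nn_integral_dominated_convergence)
  let ?w = "\<lambda>u. layer_weight b u * ennreal (min 1 (C * u powr - g))"
  show "(\<integral>\<^sup>+ u. ?w u \<partial>lborel) < \<infinity>" using b C by (rule layer_weight_decay_finite)
  show "AE u in lborel. layer_weight b u * ennreal (Phi k (n + n0) u) \<le> ?w u" for n
  proof (intro AE_I2)
    fix u :: real
    show "layer_weight b u * ennreal (Phi k (n + n0) u) \<le> ?w u"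
    proof (cases "0 < u")
      case True
      then show ?thesis using Phi_le_1 decay[of "n + n0" u] by (intro mult_left_mono ennreal_leI) auto
    qed (simp add: layer_weight_def)
  qed
  show "AE u in lborel. (\<lambda>n. layer_weight b u * ennreal (Phi k (n + n0) u)) \<longlonglongrightarrow> layer_weight b u * ennreal (Phi_lim k u)"
  proof (intro AE_I2)
    fix u :: real
    show "(\<lambda>n. layer_weight b u * ennreal (Phi k (n + n0) u)) \<longlonglongrightarrow> layer_weight b u * ennreal (Phi_lim k u)"
    proof (cases "0 < u")
      case True
      have "(\<lambda>n. ennreal (Phi k (n + n0) u)) \<longlonglongrightarrow> ennreal (Phi_lim k u)"
        using LIMSEQ_ignore_initial_segment[OF Phi_tendsto[OF True]] by (rule tendsto_ennrealI)
      then show ?thesis by (rule ennreal_tendsto_cmult[rotated]) (simp add: layer_weight_def ennreal_mult_less_top True)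
    qed (simp add: layer_weight_def)
  qed
qed (auto)

end

lemma nn_integral_prod_lborel:
  fixes g h :: "real \<Rightarrow> ennreal"
  assumes [measurable]: "g \<in> borel_measurable borel" "h \<in> borel_measurable borel"
  shows "(\<integral>\<^sup>+ x. g (fst x) * h (snd x) \<partial>(lborel \<Otimes>\<^sub>M lborel)) = (\<integral>\<^sup>+ u. g u \<partial>lborel) * (\<integral>\<^sup>+ v. h v \<partial>lborel)"
proof -
  have "(\<integral>\<^sup>+ x. g (fst x) * h (snd x) \<partial>(lborel \<Otimes>\<^sub>M lborel)) = (\<integral>\<^sup>+ u. (\<integral>\<^sup>+ v. g u * h v \<partial>lborel) \<partial>lborel)"
    by (subst lborel.nn_integral_fst[symmetric]) auto
  also have "\<dots> = (\<integral>\<^sup>+ u. g u * (\<integral>\<^sup>+ v. h v \<partial>lborel) \<partial>lborel)"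
    by (intro nn_integral_cong nn_integral_cmult) measurable
  also have "\<dots> = (\<integral>\<^sup>+ u. g u \<partial>lborel) * (\<integral>\<^sup>+ v. h v \<partial>lborel)"
    by (rule nn_integral_multc) measurable
  finally show ?thesis .
qed

section \<open>Two centres at once\<close>

context density_sample
begin

lemma AE_cball_measure_tendsto_0: "AE x in P. ((\<lambda>r. measure P (cball x r)) \<longlongrightarrow> 0) (at_right 0)"
proof (rule AE_P, use lebesgue_differentiation_cball[OF integrable_f] in eventually_elim)
  fix x assume lim: "((\<lambda>r. (LINT z:cball x r|lborel. f z) / r ^ DIM('a)) \<longlongrightarrow> unit_ball_vol (real DIM('a)) * f x) (at_right 0)"
  have "((\<lambda>r::real. r ^ DIM('a)) \<longlongrightarrow> 0) (at_right 0)"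
  proof -
    have "((\<lambda>r::real. r ^ DIM('a)) \<longlongrightarrow> 0 ^ DIM('a)) (at_right 0)" by (intro tendsto_intros)
    then show ?thesis by (simp only: zero_power[OF DIM_positive])
  qed
  from tendsto_mult[OF lim this]
  have "((\<lambda>r. (LINT z:cball x r|lborel. f z) / r ^ DIM('a) * r ^ DIM('a)) \<longlongrightarrow> 0) (at_right 0)"
    by (simp only: mult_zero_right)
  moreover have "eventually (\<lambda>r. (LINT z:cball x r|lborel. f z) / r ^ DIM('a) * r ^ DIM('a) = measure P (cball x r)) (at_right 0)"
    using eventually_at_right_less[of 0] by eventually_elim (simp add: measure_P_eq)
  ultimately show "((\<lambda>r. measure P (cball x r)) \<longlongrightarrow> 0) (at_right 0)"
    by (simp add: tendsto_cong)
qed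

text \<open>The probability that two independent points are close enough for their balls, of radii
  \<open>rad n u\<close> and \<open>rad n v\<close>, to meet.\<close>

definition overlap :: "nat \<Rightarrow> real \<Rightarrow> real \<Rightarrow> real" where
  "overlap n u v = (LINT x|P. measure P (cball x (rad n u + rad n v)))"

lemma overlap_nonneg: "0 \<le> overlap n u v"
  unfolding overlap_def by (intro integral_nonneg_AE) auto

lemma overlap_tendsto_0:
  assumes "0 < u" "0 < v" shows "(\<lambda>n. overlap n u v) \<longlonglongrightarrow> 0"
proof -
  have r: "filterlim (\<lambda>n. rad n u + rad n v) (at_right 0) sequentially"
  proof -
    have "(\<lambda>n. rad n u + rad n v) \<longlonglongrightarrow> 0 + 0"
      using rad_tendsto_0[OF assms(1)] rad_tendsto_0[OF assms(2)]
      by (intro tendsto_add) (auto simp: filterlim_at)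
    moreover have "eventually (\<lambda>n. 0 < rad n u + rad n v) sequentially"
      using eventually_gt_at_top[of 0] by eventually_elim (use assms in \<open>auto intro: add_pos_pos\<close>)
    ultimately show ?thesis by (auto simp: filterlim_at elim: eventually_mono)
  qed
  have "(\<lambda>n. overlap n u v) \<longlonglongrightarrow> (LINT x|P. 0)"
    unfolding overlap_def
  proof (rule integral_dominated_convergence[where w = "\<lambda>_. 1"])
    show "AE x in P. (\<lambda>n. measure P (cball x (rad n u + rad n v))) \<longlonglongrightarrow> 0"
      using AE_cball_measure_tendsto_0
    proof eventually_elim
      case (elim x)
      show ?case by (rule filterlim_compose[OF elim r])
    qed
  qed auto
  then show ?thesis by simp
qed

text \<open>The last entry has the right limit, but \<open>overlap\<close> does not decay in
  \<open>u\<close> and \<open>v\<close>. The first two entries, coming from one centre alone, supply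
  the decay for dominated convergence.\<close>

definition pair_bound :: "nat \<Rightarrow> nat \<Rightarrow> real \<Rightarrow> real \<Rightarrow> real" where
  "pair_bound k n u v = min (min (Phi k n u) (Phi k n v)) (Phi k n u * Phi k n v + overlap n u v)"

lemma pair_bound_nonneg: "0 \<le> pair_bound k n u v"
  by (simp add: pair_bound_def Phi_nonneg overlap_nonneg)

lemma pair_bound_measurable [measurable (raw)]:
  assumes [measurable]: "g \<in> borel_measurable M" "h \<in> borel_measurable M"
  shows "(\<lambda>x. pair_bound k n (g x) (h x)) \<in> borel_measurable M"
proof -
  have [measurable]: "(\<lambda>p. overlap n (fst p) (snd p)) \<in> borel_measurable (borel \<Otimes>\<^sub>M borel)"
    unfolding overlap_def by measurable
  have "(\<lambda>x. (\<lambda>p. overlap n (fst p) (snd p)) (g x, h x)) \<in> borel_measurable M" by measurable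
  then have [measurable]: "(\<lambda>x. overlap n (g x) (h x)) \<in> borel_measurable M" by simp
  show ?thesis unfolding pair_bound_def by measurable
qed

lemma pair_bound_tendsto:
  assumes "0 < u" "0 < v" shows "(\<lambda>n. pair_bound k n u v) \<longlonglongrightarrow> Phi_lim k u * Phi_lim k v"
proof -
  have "(\<lambda>n. pair_bound k n u v) \<longlonglongrightarrow> min (min (Phi_lim k u) (Phi_lim k v)) (Phi_lim k u * Phi_lim k v + 0)"
    unfolding pair_bound_def by (intro tendsto_intros Phi_tendsto overlap_tendsto_0 assms)
  \<comment> \<open>Both limits are at most 1, so the product is the smallest of the three entries
    and the minimum does not disturb the limit.\<close>
  moreover have "Phi_lim k u * Phi_lim k v \<le> Phi_lim k u * 1" "Phi_lim k u * Phi_lim k v \<le> 1 * Phi_lim k v"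
    using assms mult_left_mono[OF Phi_lim_le_1[of v k] Phi_lim_nonneg[of u k]]
      mult_right_mono[OF Phi_lim_le_1[of u k] Phi_lim_nonneg[of v k]] by auto
  ultimately show ?thesis by (simp add: min_absorb2)
qed

text \<open>The minimum of two numbers is at most their geometric mean, which halves the decay
  exponent but separates the variables.\<close>

lemma pair_bound_decay:
  assumes C: "0 \<le> C" and decay: "\<And>n u. n0 \<le> n \<Longrightarrow> 0 < u \<Longrightarrow> Phi k n u \<le> C * u powr - g"
    and n: "n0 \<le> n" and u: "0 < u" and v: "0 < v"
  shows "pair_bound k n u v \<le> min 1 (sqrt C * u powr - (g / 2)) * min 1 (sqrt C * v powr - (g / 2))"
proof (rule power2_le_imp_le)
  have sq: "(min 1 (sqrt C * w powr - (g / 2)))\<^sup>2 = min 1 (C * w powr - g)" if "0 < w" for w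
  proof -
    have e: "(sqrt C * w powr - (g / 2))\<^sup>2 = C * w powr - g"
      using C that by (simp add: power_mult_distrib powr_power)
    have "sqrt C * w powr - (g / 2) \<le> 1 \<longleftrightarrow> C * w powr - g \<le> 1"
      unfolding e[symmetric] using C by (simp add: power_le_one_iff)
    then show ?thesis using e by (auto simp: min_def)
  qed
  have "(pair_bound k n u v)\<^sup>2 \<le> Phi k n u * Phi k n v"
    unfolding power2_eq_square
    by (intro mult_mono pair_bound_nonneg Phi_nonneg) (auto simp: pair_bound_def)
  also have "\<dots> \<le> min 1 (C * u powr - g) * min 1 (C * v powr - g)"
    using decay[OF n u] decay[OF n v] C by (intro mult_mono Phi_nonneg) (auto simp: Phi_le_1)
  also have "\<dots> = (min 1 (sqrt C * u powr - (g / 2)) * min 1 (sqrt C * v powr - (g / 2)))\<^sup>2"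
    by (simp add: power_mult_distrib sq u v)
  finally show "(pair_bound k n u v)\<^sup>2 \<le> (min 1 (sqrt C * u powr - (g / 2)) * min 1 (sqrt C * v powr - (g / 2)))\<^sup>2" .
qed (use C in auto)

text \<open>The dominating function is a product of one function of \<open>u\<close> and the same
  function of \<open>v\<close>, so its double integral factorises; each factor is finite because
  \<open>b < g / 2\<close>.\<close>

lemma pair_moment_tendsto:
  assumes b: "0 < b" "2 * b < g" and C: "0 \<le> C"
    and decay: "\<And>n u. n0 \<le> n \<Longrightarrow> 0 < u \<Longrightarrow> Phi k n u \<le> C * u powr - g"
  shows "(\<lambda>n. \<integral>\<^sup>+ x. layer_weight b (fst x) * layer_weight b (snd x) * ennreal (pair_bound k n (fst x) (snd x)) \<partial>(lborel \<Otimes>\<^sub>M lborel))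
     \<longlonglongrightarrow> (\<integral>\<^sup>+ u. layer_weight b u * ennreal (Phi_lim k u) \<partial>lborel)\<^sup>2"
proof (rule LIMSEQ_offset[where k = n0])
  let ?h = "\<lambda>u. layer_weight b u * ennreal (min 1 (sqrt C * u powr - (g / 2)))"
  have "(\<lambda>n. \<integral>\<^sup>+ x. layer_weight b (fst x) * layer_weight b (snd x) * ennreal (pair_bound k (n + n0) (fst x) (snd x)) \<partial>(lborel \<Otimes>\<^sub>M lborel))
     \<longlonglongrightarrow> (\<integral>\<^sup>+ x. (layer_weight b (fst x) * ennreal (Phi_lim k (fst x))) * (layer_weight b (snd x) * ennreal (Phi_lim k (snd x))) \<partial>(lborel \<Otimes>\<^sub>M lborel))"
  proof (rule nn_integral_dominated_convergence[where w = "\<lambda>x. ?h (fst x) * ?h (snd x)"])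
    have "(\<integral>\<^sup>+ u. ?h u \<partial>lborel) < \<infinity>" using b C by (intro layer_weight_decay_finite) auto
    then show "(\<integral>\<^sup>+ x. ?h (fst x) * ?h (snd x) \<partial>(lborel \<Otimes>\<^sub>M lborel)) < \<infinity>"
      by (subst nn_integral_prod_lborel) (auto simp: ennreal_mult_less_top)
    show "AE x in lborel \<Otimes>\<^sub>M lborel. layer_weight b (fst x) * layer_weight b (snd x) * ennreal (pair_bound k (n + n0) (fst x) (snd x)) \<le> ?h (fst x) * ?h (snd x)" for n
    proof (intro AE_I2)
      fix x :: "real \<times> real"
      show "layer_weight b (fst x) * layer_weight b (snd x) * ennreal (pair_bound k (n + n0) (fst x) (snd x)) \<le> ?h (fst x) * ?h (snd x)"
      proof (cases "0 < fst x \<and> 0 < snd x")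
        case True
        have "layer_weight b (fst x) * layer_weight b (snd x) * ennreal (pair_bound k (n + n0) (fst x) (snd x)) \<le>
          layer_weight b (fst x) * layer_weight b (snd x) * ennreal (min 1 (sqrt C * fst x powr - (g / 2)) * min 1 (sqrt C * snd x powr - (g / 2)))"
          using True by (intro mult_left_mono ennreal_leI pair_bound_decay[OF C decay]) auto
        also have "\<dots> = ?h (fst x) * ?h (snd x)"
          using C by (subst ennreal_mult) (auto simp: mult_ac)
        finally show ?thesis .
      qed (auto simp: layer_weight_def)
    qed
    show "AE x in lborel \<Otimes>\<^sub>M lborel. (\<lambda>n. layer_weight b (fst x) * layer_weight b (snd x) * ennreal (pair_bound k (n + n0) (fst x) (snd x)))
       \<longlonglongrightarrow> (layer_weight b (fst x) * ennreal (Phi_lim k (fst x))) * (layer_weight b (snd x) * ennreal (Phi_lim k (snd x)))"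
    proof (intro AE_I2)
      fix x :: "real \<times> real"
      show "(\<lambda>n. layer_weight b (fst x) * layer_weight b (snd x) * ennreal (pair_bound k (n + n0) (fst x) (snd x)))
       \<longlonglongrightarrow> (layer_weight b (fst x) * ennreal (Phi_lim k (fst x))) * (layer_weight b (snd x) * ennreal (Phi_lim k (snd x)))"
      proof (cases "0 < fst x \<and> 0 < snd x")
        case True
        then have "(\<lambda>n. ennreal (pair_bound k (n + n0) (fst x) (snd x))) \<longlonglongrightarrow> ennreal (Phi_lim k (fst x) * Phi_lim k (snd x))"
          by (intro tendsto_ennrealI LIMSEQ_ignore_initial_segment pair_bound_tendsto) auto
        then have "(\<lambda>n. layer_weight b (fst x) * layer_weight b (snd x) * ennreal (pair_bound k (n + n0) (fst x) (snd x))) \<longlonglongrightarrow>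
          layer_weight b (fst x) * layer_weight b (snd x) * ennreal (Phi_lim k (fst x) * Phi_lim k (snd x))"
          by (rule ennreal_tendsto_cmult[rotated]) (simp add: layer_weight_def ennreal_mult_less_top True)
        also have "layer_weight b (fst x) * layer_weight b (snd x) * ennreal (Phi_lim k (fst x) * Phi_lim k (snd x)) =
          (layer_weight b (fst x) * ennreal (Phi_lim k (fst x))) * (layer_weight b (snd x) * ennreal (Phi_lim k (snd x)))"
          using True by (subst ennreal_mult) (auto simp: Phi_lim_nonneg mult_ac)
        finally show ?thesis .
      qed (auto simp: layer_weight_def)
    qed
  qed measurable
  also have "(\<integral>\<^sup>+ x. (layer_weight b (fst x) * ennreal (Phi_lim k (fst x))) * (layer_weight b (snd x) * ennreal (Phi_lim k (snd x))) \<partial>(lborel \<Otimes>\<^sub>M lborel)) =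
     (\<integral>\<^sup>+ u. layer_weight b u * ennreal (Phi_lim k u) \<partial>lborel)\<^sup>2"
    unfolding power2_eq_square by (rule nn_integral_prod_lborel) measurable
  finally show "(\<lambda>n. \<integral>\<^sup>+ x. layer_weight b (fst x) * layer_weight b (snd x) * ennreal (pair_bound k (n + n0) (fst x) (snd x)) \<partial>(lborel \<Otimes>\<^sub>M lborel))
     \<longlonglongrightarrow> (\<integral>\<^sup>+ u. layer_weight b u * ennreal (Phi_lim k u) \<partial>lborel)\<^sup>2" .
qed

end

section \<open>Counting events of the sample as integrals over product measures\<close>

locale iid_sample = density_sample f + M: prob_space M
  for f :: "'a::euclidean_space \<Rightarrow> real" and M :: "'w measure" +
  fixes X :: "nat \<Rightarrow> 'w \<Rightarrow> 'a"
  assumes X_indep: "M.indep_vars (\<lambda>_. borel) X {1..}"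
    and X_density: "\<And>i. 1 \<le> i \<Longrightarrow> distributed M lborel (X i) (\<lambda>x. ennreal (f x))"
begin

lemma X_measurable [measurable]: "1 \<le> i \<Longrightarrow> X i \<in> borel_measurable M"
  using distributed_measurable[OF X_density, of i] by simp

text \<open>By independence the joint law of the \<open>X i\<close> with \<open>i \<in> I\<close> is
  the product of their laws, all equal to \<open>P\<close>.\<close>

lemma nn_integral_sample:
  assumes I: "finite I" "I \<noteq> {}" "I \<subseteq> {1..}" and g: "g \<in> borel_measurable (PiM I (\<lambda>_. P))"
  shows "(\<integral>\<^sup>+ \<omega>. g (\<lambda>i\<in>I. X i \<omega>) \<partial>M) = (\<integral>\<^sup>+ x. g x \<partial>PiM I (\<lambda>_. P))"
proof -
  have "M.indep_vars (\<lambda>_. borel) X I" by (rule M.indep_vars_subset[OF X_indep I(3)])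
  then have "distr M (\<Pi>\<^sub>M i\<in>I. borel) (\<lambda>\<omega>. \<lambda>i\<in>I. X i \<omega>) = (\<Pi>\<^sub>M i\<in>I. distr M borel (X i))"
    using I by (subst (asm) M.indep_vars_iff_distr_eq_PiM') auto
  also have "\<dots> = PiM I (\<lambda>_. P)"
  proof (rule PiM_cong[OF refl])
    fix i assume "i \<in> I"
    then have "distr M lborel (X i) = P"
      using I X_density[of i] by (auto simp: P_def distributed_distr_eq_density)
    moreover have "distr M borel (X i) = distr M lborel (X i)" by (rule distr_cong) auto
    ultimately show "distr M borel (X i) = P" by simp
  qed
  finally have D: "distr M (\<Pi>\<^sub>M i\<in>I. borel) (\<lambda>\<omega>. \<lambda>i\<in>I. X i \<omega>) = PiM I (\<lambda>_. P)" .
  have meas: "(\<lambda>\<omega>. \<lambda>i\<in>I. X i \<omega>) \<in> measurable M (\<Pi>\<^sub>M i\<in>I. borel)"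
    using I by (intro measurable_restrict X_measurable) auto
  have "(\<integral>\<^sup>+ x. g x \<partial>PiM I (\<lambda>_. P)) = (\<integral>\<^sup>+ x. g x \<partial>distr M (\<Pi>\<^sub>M i\<in>I. borel) (\<lambda>\<omega>. \<lambda>i\<in>I. X i \<omega>))"
    by (simp add: D)
  also have "\<dots> = (\<integral>\<^sup>+ \<omega>. g (\<lambda>i\<in>I. X i \<omega>) \<partial>M)"
  proof (rule nn_integral_distr[OF meas])
    show "g \<in> borel_measurable (distr M (\<Pi>\<^sub>M i\<in>I. borel) (\<lambda>\<omega>. \<lambda>i\<in>I. X i \<omega>))"
      unfolding D by (rule g)
  qed
  finally show ?thesis ..
qed

lemma measurable_hits_PiM:
  assumes "finite J" "J \<subseteq> I" "i \<in> I"
  shows "Measurable.pred (PiM I (\<lambda>_ :: nat. P)) (\<lambda>x. card {j \<in> J. x j \<in> cball (x i) r} < k)"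
proof -
  have c: "(\<lambda>x. x j) \<in> borel_measurable (PiM I (\<lambda>_ :: nat. P))" if "j \<in> I" for j
    using measurable_component_singleton[OF that, of "\<lambda>_. P"] by (simp cong: measurable_cong_sets)
  have [measurable]: "Measurable.pred (PiM I (\<lambda>_ :: nat. P)) (\<lambda>x. x j \<in> cball (x i) r)" if "j \<in> J" for j
    unfolding mem_cball pred_def
    by (intro borel_measurable_le borel_measurable_dist c) (use that assms in auto)
  show ?thesis using assms(1) by measurable
qed

lemma measurable_hits_fixed:
  assumes "finite J" and [measurable]: "A \<in> sets borel"
  shows "Measurable.pred (PiM J (\<lambda>_ :: nat. P)) (\<lambda>x. card {j \<in> J. x j \<in> A} < k)"
proof -
  have [measurable]: "Measurable.pred (PiM J (\<lambda>_ :: nat. P)) (\<lambda>x. x j \<in> A)" if "j \<in> J" for j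
  proof -
    have "(\<lambda>x. x j) \<in> borel_measurable (PiM J (\<lambda>_ :: nat. P))"
      using measurable_component_singleton[OF that, of "\<lambda>_. P"] by (simp cong: measurable_cong_sets)
    moreover have "Measurable.pred borel (\<lambda>y. y \<in> A)" by measurable
    ultimately show ?thesis by (rule measurable_compose)
  qed
  show ?thesis using assms(1) by measurable
qed

lemma measurable_hits:
  assumes "finite J" "J \<subseteq> {1..}" "1 \<le> i"
  shows "Measurable.pred M (\<lambda>\<omega>. card {j \<in> J. X j \<omega> \<in> cball (X i \<omega>) r} < k)"
proof -
  have [measurable]: "Measurable.pred M (\<lambda>\<omega>. X j \<omega> \<in> cball (X i \<omega>) r)" if "j \<in> J" for j
    unfolding mem_cball pred_def
    by (intro borel_measurable_le borel_measurable_dist X_measurable) (use that assms in auto)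
  show ?thesis using assms(1) by measurable
qed

sublocale PP: product_prob_space "\<lambda>_ :: nat. P" ..

text \<open>Coordinate \<open>i\<close> is integrated last. Given \<open>X i = y\<close>, the ball
  is a fixed set and the other points hit it independently, so the count is binomial.\<close>

lemma emeasure_hits:
  assumes i: "1 \<le> i" "i \<notin> J" and J: "finite J" "J \<subseteq> {1..}"
  shows "emeasure M {\<omega> \<in> space M. card {j \<in> J. X j \<omega> \<in> cball (X i \<omega>) r} < k} =
    (\<integral>\<^sup>+ y. ennreal (binomial_tail (card J) k (measure P (cball y r))) \<partial>P)"
proof -
  let ?I = "insert i J"
  let ?E = "{x. card {j \<in> J. x j \<in> cball (x i) r} < k} :: (nat \<Rightarrow> 'a) set"
  have fin: "finite ?I" using J by simp
  have pred: "Measurable.pred (PiM ?I (\<lambda>_. P)) (\<lambda>x. card {j \<in> J. x j \<in> cball (x i) r} < k)"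
    using J(1) by (intro pred_intros_logic measurable_hits_PiM) auto
  have E: "(\<lambda>x. indicator ?E x :: ennreal) \<in> borel_measurable (PiM ?I (\<lambda>_. P))"
    using pred by measurable
  have predM: "Measurable.pred M (\<lambda>\<omega>. card {j \<in> J. X j \<omega> \<in> cball (X i \<omega>) r} < k)"
    using J i by (intro measurable_hits) auto
  have "emeasure M {\<omega> \<in> space M. card {j \<in> J. X j \<omega> \<in> cball (X i \<omega>) r} < k} =
     (\<integral>\<^sup>+ \<omega>. indicator {\<omega> \<in> space M. card {j \<in> J. X j \<omega> \<in> cball (X i \<omega>) r} < k} \<omega> \<partial>M)"
    using predM by (intro nn_integral_indicator[symmetric]) (simp add: pred_def)
  also have "\<dots> = (\<integral>\<^sup>+ \<omega>. indicator ?E (\<lambda>j\<in>?I. X j \<omega>) \<partial>M)"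
  proof (intro nn_integral_cong)
    fix \<omega> assume "\<omega> \<in> space M"
    have "{j \<in> J. (\<lambda>j\<in>?I. X j \<omega>) j \<in> cball ((\<lambda>j\<in>?I. X j \<omega>) i) r} = {j \<in> J. X j \<omega> \<in> cball (X i \<omega>) r}" by auto
    then show "indicator {\<omega> \<in> space M. card {j \<in> J. X j \<omega> \<in> cball (X i \<omega>) r} < k} \<omega> = (indicator ?E (\<lambda>j\<in>?I. X j \<omega>) :: ennreal)"
      using \<open>\<omega> \<in> space M\<close> by (simp only: indicator_def mem_Collect_eq simp_thms)
  qed
  also have "\<dots> = (\<integral>\<^sup>+ x. indicator ?E x \<partial>PiM ?I (\<lambda>_. P))"
    by (rule nn_integral_sample[OF fin _ _ E]) (use i J in auto)
  also have "\<dots> = (\<integral>\<^sup>+ y. (\<integral>\<^sup>+ x. indicator ?E (x(i := y)) \<partial>PiM J (\<lambda>_. P)) \<partial>P)"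
    by (rule PP.product_nn_integral_insert_rev[OF J(1) i(2) E])
  also have "\<dots> = (\<integral>\<^sup>+ y. ennreal (binomial_tail (card J) k (measure P (cball y r))) \<partial>P)"
  proof (intro nn_integral_cong)
    fix y
    let ?F = "{x \<in> space (PiM J (\<lambda>_. P)). card {j \<in> J. x j \<in> cball y r} < k}"
    have "?F \<in> sets (PiM J (\<lambda>_. P))"
      unfolding pred_def[symmetric] using J(1) by (intro pred_intros_logic measurable_hits_fixed) auto
    have "(\<integral>\<^sup>+ x. indicator ?E (x(i := y)) \<partial>PiM J (\<lambda>_. P)) = (\<integral>\<^sup>+ x. indicator ?F x \<partial>PiM J (\<lambda>_. P))"
    proof (intro nn_integral_cong)
      fix x assume x: "x \<in> space (PiM J (\<lambda>_. P))"
      have "{j \<in> J. (x(i := y)) j \<in> cball ((x(i := y)) i) r} = {j \<in> J. x j \<in> cball y r}" using i(2) by auto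
      with x show "indicator ?E (x(i := y)) = (indicator ?F x :: ennreal)"
        by (simp only: indicator_def mem_Collect_eq simp_thms)
    qed
    also have "\<dots> = emeasure (PiM J (\<lambda>_. P)) ?F" by (rule nn_integral_indicator) fact
    also have "\<dots> = ennreal (binomial_tail (card J) k (measure P (cball y r)))"
      by (rule emeasure_hits_less[OF prob_space_P _ J(1)]) simp
    finally show "(\<integral>\<^sup>+ x. indicator ?E (x(i := y)) \<partial>PiM J (\<lambda>_. P)) = ennreal (binomial_tail (card J) k (measure P (cball y r)))" .
  qed
  finally show ?thesis .
qed

text \<open>Given the centres \<open>y\<close> and \<open>z\<close>, the balls are disjoint unless
  \<open>dist y z \<le> r + s\<close>. Disjoint balls fall under
  \<open>emeasure_hits_less_disjoint\<close>; otherwise the indicator pays for the trivial bound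
  1.\<close>

lemma emeasure_hits_pair:
  assumes i: "1 \<le> i" "i \<notin> J" and i': "1 \<le> i'" "i' \<notin> J" "i \<noteq> i'" and J: "finite J" "J \<subseteq> {1..}"
  shows "emeasure M {\<omega> \<in> space M. card {j \<in> J. X j \<omega> \<in> cball (X i \<omega>) r} < k \<and> card {j \<in> J. X j \<omega> \<in> cball (X i' \<omega>) s} < k} \<le>
    (\<integral>\<^sup>+ y. (\<integral>\<^sup>+ z. ennreal (binomial_tail (card J) k (measure P (cball y r)) * binomial_tail (card J) k (measure P (cball z s)))
       + indicator (cball y (r + s)) z \<partial>P) \<partial>P)"
proof -
  let ?I' = "insert i' J" and ?I = "insert i (insert i' J)"
  let ?E = "{x. card {j \<in> J. x j \<in> cball (x i) r} < k \<and> card {j \<in> J. x j \<in> cball (x i') s} < k} :: (nat \<Rightarrow> 'a) set"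
  let ?EM = "{\<omega> \<in> space M. card {j \<in> J. X j \<omega> \<in> cball (X i \<omega>) r} < k \<and> card {j \<in> J. X j \<omega> \<in> cball (X i' \<omega>) s} < k}"
  have fin: "finite ?I" "finite ?I'" using J by auto
  have pred: "Measurable.pred (PiM ?I (\<lambda>_. P)) (\<lambda>x. card {j \<in> J. x j \<in> cball (x i) r} < k \<and> card {j \<in> J. x j \<in> cball (x i') s} < k)"
    using J(1) by (intro pred_intros_logic measurable_hits_PiM) auto
  have E: "(\<lambda>x. indicator ?E x :: ennreal) \<in> borel_measurable (PiM ?I (\<lambda>_. P))"
    using pred by measurable
  have predM: "Measurable.pred M (\<lambda>\<omega>. card {j \<in> J. X j \<omega> \<in> cball (X i \<omega>) r} < k \<and> card {j \<in> J. X j \<omega> \<in> cball (X i' \<omega>) s} < k)"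
    using J i i' by (intro pred_intros_logic measurable_hits) auto
  have "emeasure M ?EM = (\<integral>\<^sup>+ \<omega>. indicator ?EM \<omega> \<partial>M)"
    using predM by (intro nn_integral_indicator[symmetric]) (simp add: pred_def)
  also have "\<dots> = (\<integral>\<^sup>+ \<omega>. indicator ?E (\<lambda>j\<in>?I. X j \<omega>) \<partial>M)"
  proof (intro nn_integral_cong)
    fix \<omega> assume "\<omega> \<in> space M"
    have "{j \<in> J. (\<lambda>j\<in>?I. X j \<omega>) j \<in> cball ((\<lambda>j\<in>?I. X j \<omega>) i) r} = {j \<in> J. X j \<omega> \<in> cball (X i \<omega>) r}"
      "{j \<in> J. (\<lambda>j\<in>?I. X j \<omega>) j \<in> cball ((\<lambda>j\<in>?I. X j \<omega>) i') s} = {j \<in> J. X j \<omega> \<in> cball (X i' \<omega>) s}" by auto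
    then show "indicator ?EM \<omega> = (indicator ?E (\<lambda>j\<in>?I. X j \<omega>) :: ennreal)"
      using \<open>\<omega> \<in> space M\<close> by (simp only: indicator_def mem_Collect_eq simp_thms)
  qed
  also have "\<dots> = (\<integral>\<^sup>+ x. indicator ?E x \<partial>PiM ?I (\<lambda>_. P))"
    by (rule nn_integral_sample[OF fin(1) _ _ E]) (use i i' J in auto)
  also have "\<dots> = (\<integral>\<^sup>+ y. (\<integral>\<^sup>+ x. indicator ?E (x(i := y)) \<partial>PiM ?I' (\<lambda>_. P)) \<partial>P)"
    by (rule PP.product_nn_integral_insert_rev[OF fin(2) _ E]) (use i i' in auto)
  also have "\<dots> = (\<integral>\<^sup>+ y. (\<integral>\<^sup>+ z. (\<integral>\<^sup>+ x. indicator ?E (x(i' := z, i := y)) \<partial>PiM J (\<lambda>_. P)) \<partial>P) \<partial>P)"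
  proof (rule nn_integral_cong, rule PP.product_nn_integral_insert_rev[OF J(1) i'(2)])
    fix y
    have "(\<lambda>x. x(i := y)) \<in> measurable (PiM ?I' (\<lambda>_. P)) (PiM ?I (\<lambda>_. P))"
      by (rule measurable_fun_upd[where J = ?I']) auto
    from measurable_compose[OF this E]
    show "(\<lambda>x. indicator ?E (x(i := y)) :: ennreal) \<in> borel_measurable (PiM ?I' (\<lambda>_. P))" .
  qed
  also have "\<dots> \<le> (\<integral>\<^sup>+ y. (\<integral>\<^sup>+ z. ennreal (binomial_tail (card J) k (measure P (cball y r)) * binomial_tail (card J) k (measure P (cball z s)))
       + indicator (cball y (r + s)) z \<partial>P) \<partial>P)"
  proof (intro nn_integral_mono)
    fix y z
    let ?F = "{x \<in> space (PiM J (\<lambda>_. P)). card {j \<in> J. x j \<in> cball y r} < k \<and> card {j \<in> J. x j \<in> cball z s} < k}"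
    have "?F \<in> sets (PiM J (\<lambda>_. P))"
      unfolding pred_def[symmetric] using J(1) by (intro pred_intros_logic measurable_hits_fixed) auto
    have "(\<integral>\<^sup>+ x. indicator ?E (x(i' := z, i := y)) \<partial>PiM J (\<lambda>_. P)) = (\<integral>\<^sup>+ x. indicator ?F x \<partial>PiM J (\<lambda>_. P))"
    proof (intro nn_integral_cong)
      fix x assume x: "x \<in> space (PiM J (\<lambda>_. P))"
      have "{j \<in> J. (x(i' := z, i := y)) j \<in> cball ((x(i' := z, i := y)) i) r} = {j \<in> J. x j \<in> cball y r}"
        "{j \<in> J. (x(i' := z, i := y)) j \<in> cball ((x(i' := z, i := y)) i') s} = {j \<in> J. x j \<in> cball z s}"
        using i(2) i' by auto
      with x show "indicator ?E (x(i' := z, i := y)) = (indicator ?F x :: ennreal)"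
        by (simp only: indicator_def mem_Collect_eq simp_thms)
    qed
    also have "\<dots> = emeasure (PiM J (\<lambda>_. P)) ?F" by (rule nn_integral_indicator) fact
    also have "\<dots> \<le> ennreal (binomial_tail (card J) k (measure P (cball y r)) * binomial_tail (card J) k (measure P (cball z s)))
       + indicator (cball y (r + s)) z"
    proof (cases "z \<in> cball y (r + s)")
      case True
      interpret J: prob_space "PiM J (\<lambda>_. P)" by (rule prob_space_PiM) (rule prob_space_P)
      have "emeasure (PiM J (\<lambda>_. P)) ?F \<le> 0 + 1" using J.emeasure_le_1 by simp
      also have "\<dots> \<le> ennreal (binomial_tail (card J) k (measure P (cball y r)) * binomial_tail (card J) k (measure P (cball z s)))
       + indicator (cball y (r + s)) z" using True by (intro add_mono) auto
      finally show ?thesis .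
    next
      case False
      have "cball y r \<inter> cball z s = {}"
      proof (rule ccontr)
        assume "cball y r \<inter> cball z s \<noteq> {}"
        then obtain w where "dist y w \<le> r" "dist z w \<le> s" by auto
        then have "dist y z \<le> r + s" using dist_triangle[of y z w] by (simp add: dist_commute)
        with False show False by simp
      qed
      then show ?thesis
        using False emeasure_hits_less_disjoint[OF prob_space_P _ _ _ J(1), of "cball y r" "cball z s" k k] by simp
    qed
    finally show "(\<integral>\<^sup>+ x. indicator ?E (x(i' := z, i := y)) \<partial>PiM J (\<lambda>_. P)) \<le>
      ennreal (binomial_tail (card J) k (measure P (cball y r)) * binomial_tail (card J) k (measure P (cball z s)))
       + indicator (cball y (r + s)) z" .
  qed
  finally show ?thesis .
qed

lemma emeasure_hits_pair_le:
  assumes i: "1 \<le> i" "i \<notin> J" and i': "1 \<le> i'" "i' \<notin> J" "i \<noteq> i'" and J: "finite J" "J \<subseteq> {1..}"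
  shows "emeasure M {\<omega> \<in> space M. card {j \<in> J. X j \<omega> \<in> cball (X i \<omega>) (rad (card J) u)} < k \<and>
      card {j \<in> J. X j \<omega> \<in> cball (X i' \<omega>) (rad (card J) v)} < k} \<le> ennreal (pair_bound k (card J) u v)"
proof -
  let ?n = "card J"
  let ?A = "\<lambda>i u. {\<omega> \<in> space M. card {j \<in> J. X j \<omega> \<in> cball (X i \<omega>) (rad ?n u)} < k}"
  let ?E = "{\<omega> \<in> space M. card {j \<in> J. X j \<omega> \<in> cball (X i \<omega>) (rad ?n u)} < k \<and>
      card {j \<in> J. X j \<omega> \<in> cball (X i' \<omega>) (rad ?n v)} < k}"
  let ?g = "\<lambda>y u. binomial_tail ?n k (measure P (cball y (rad ?n u)))"
  have A: "?A i u \<in> sets M" if "1 \<le> i" for i u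
    using measurable_hits[OF J that] by (simp add: pred_def)
  have eA: "emeasure M (?A i u) = ennreal (Phi k ?n u)" if "1 \<le> i" "i \<notin> J" for i u
    unfolding emeasure_hits[OF that J] by (rule ennreal_Phi[symmetric])
  have "emeasure M ?E \<le> emeasure M (?A i u)" by (rule emeasure_mono[OF _ A[OF i(1)]]) blast
  then have 1: "emeasure M ?E \<le> ennreal (Phi k ?n u)" by (simp only: eA[OF i])
  have "emeasure M ?E \<le> emeasure M (?A i' v)" by (rule emeasure_mono[OF _ A[OF i'(1)]]) blast
  then have 2: "emeasure M ?E \<le> ennreal (Phi k ?n v)" by (simp only: eA[OF i'(1,2)])
  have "emeasure M ?E \<le> (\<integral>\<^sup>+ y. (\<integral>\<^sup>+ z. ennreal (?g y u * ?g z v) + indicator (cball y (rad ?n u + rad ?n v)) z \<partial>P) \<partial>P)"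
    by (rule emeasure_hits_pair[OF i i' J])
  also have "\<dots> = (\<integral>\<^sup>+ y. ennreal (?g y u) * ennreal (Phi k ?n v) + ennreal (measure P (cball y (rad ?n u + rad ?n v))) \<partial>P)"
  proof (intro nn_integral_cong)
    fix y
    have "(\<integral>\<^sup>+ z. ennreal (?g y u * ?g z v) + indicator (cball y (rad ?n u + rad ?n v)) z \<partial>P) =
      (\<integral>\<^sup>+ z. ennreal (?g y u) * ennreal (?g z v) \<partial>P) + ennreal (measure P (cball y (rad ?n u + rad ?n v)))"
      by (subst nn_integral_add) (auto simp: ennreal_mult binomial_tail_nonneg P.emeasure_eq_measure intro!: borel_measurable_indicator)
    also have "(\<integral>\<^sup>+ z. ennreal (?g y u) * ennreal (?g z v) \<partial>P) = ennreal (?g y u) * ennreal (Phi k ?n v)"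
      unfolding ennreal_Phi by (rule nn_integral_cmult) measurable
    finally show "(\<integral>\<^sup>+ z. ennreal (?g y u * ?g z v) + indicator (cball y (rad ?n u + rad ?n v)) z \<partial>P) =
      ennreal (?g y u) * ennreal (Phi k ?n v) + ennreal (measure P (cball y (rad ?n u + rad ?n v)))" .
  qed
  also have "\<dots> = ennreal (Phi k ?n u) * ennreal (Phi k ?n v) + ennreal (overlap ?n u v)"
  proof (subst nn_integral_add)
    have "(\<integral>\<^sup>+ y. ennreal (?g y u) * ennreal (Phi k ?n v) \<partial>P) = ennreal (Phi k ?n u) * ennreal (Phi k ?n v)"
      unfolding ennreal_Phi[of k ?n u] by (rule nn_integral_multc) measurable
    moreover have "(\<integral>\<^sup>+ y. ennreal (measure P (cball y (rad ?n u + rad ?n v))) \<partial>P) = ennreal (overlap ?n u v)"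
      unfolding overlap_def by (rule nn_integral_eq_integral) (auto intro!: P.integrable_const_bound[where B = 1])
    ultimately show "(\<integral>\<^sup>+ y. ennreal (?g y u) * ennreal (Phi k ?n v) \<partial>P) + (\<integral>\<^sup>+ y. ennreal (measure P (cball y (rad ?n u + rad ?n v))) \<partial>P) =
      ennreal (Phi k ?n u) * ennreal (Phi k ?n v) + ennreal (overlap ?n u v)" by simp
  qed measurable
  also have "\<dots> = ennreal (Phi k ?n u * Phi k ?n v + overlap ?n u v)"
    by (simp add: Phi_nonneg overlap_nonneg ennreal_mult)
  finally have 3: "emeasure M ?E \<le> ennreal (Phi k ?n u * Phi k ?n v + overlap ?n u v)" .
  show ?thesis unfolding pair_bound_def using 1 2 3 by (auto simp: min_def)
qed

end

subsection \<open>The estimator\<close>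

locale knn_sample = iid_sample f M X
  for f :: "real ^ 'm \<Rightarrow> real" and M :: "'w measure" and X
begin

abbreviation rho :: "nat \<Rightarrow> nat \<Rightarrow> nat \<Rightarrow> 'w \<Rightarrow> real" where
  "rho k N i \<omega> \<equiv> knn_dist (\<lambda>j. X j \<omega>) i k N"

text \<open>The scale \<open>n\<close> is kept apart from \<open>N\<close>: single points are
  compared with the \<open>N - 1\<close> others, pairs with the \<open>N - 2\<close> points outside
  the pair.\<close>

definition scaled_ball :: "nat \<Rightarrow> nat \<Rightarrow> nat \<Rightarrow> nat \<Rightarrow> 'w \<Rightarrow> real" where
  "scaled_ball n k N i \<omega> = real n * vol1 * rho k N i \<omega> ^ CARD('m)"

lemma rho_measurable:
  assumes "1 \<le> k" "k < N" "1 \<le> i" "i \<le> N"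
  shows "rho k N i \<in> borel_measurable M"
  unfolding borel_measurable_iff_greater
proof
  fix r
  have "Measurable.pred M (\<lambda>\<omega>. card {j \<in> {1..N} - {i}. X j \<omega> \<in> cball (X i \<omega>) r} < k)"
    using assms by (intro measurable_hits) auto
  then show "{\<omega> \<in> space M. r < rho k N i \<omega>} \<in> sets M"
    by (simp only: knn_dist_gt_iff[OF assms] pred_def)
qed

lemma scaled_ball_measurable:
  assumes "1 \<le> k" "k < N" "1 \<le> i" "i \<le> N"
  shows "scaled_ball n k N i \<in> borel_measurable M"
proof -
  note [measurable] = rho_measurable[OF assms]
  show ?thesis unfolding scaled_ball_def by measurable
qed

lemma scaled_ball_nonneg:
  assumes "1 \<le> k" "k < N" "1 \<le> i" "i \<le> N"
  shows "0 \<le> scaled_ball n k N i \<omega>"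
  unfolding scaled_ball_def using knn_dist_nonneg[OF assms, of "\<lambda>j. X j \<omega>"] by simp

lemma less_scaled_ball_iff:
  assumes k: "1 \<le> k" "k < N" "1 \<le> i" "i \<le> N" and u: "0 < u" "0 < n"
  shows "u < scaled_ball n k N i \<omega> \<longleftrightarrow> card {j \<in> {1..N} - {i}. X j \<omega> \<in> cball (X i \<omega>) (rad n u)} < k"
  using less_rad_iff[OF u knn_dist_nonneg[OF k, of "\<lambda>j. X j \<omega>"]]
  by (simp add: scaled_ball_def knn_dist_gt_iff[OF k])

lemma scaled_ball_moment:
  assumes k: "1 \<le> k" "k < N" "1 \<le> i" "i \<le> N" and b: "0 < b"
  shows "(\<integral>\<^sup>+ \<omega>. ennreal (scaled_ball (N - 1) k N i \<omega> powr b) \<partial>M) =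
    (\<integral>\<^sup>+ u. layer_weight b u * ennreal (Phi k (N - 1) u) \<partial>lborel)"
proof -
  let ?Z = "scaled_ball (N - 1) k N i" and ?J = "{1..N} - {i}"
  note [measurable] = scaled_ball_measurable[OF k, of "N - 1"]
  interpret WL: pair_sigma_finite M "lborel :: real measure" ..
  have J: "card ?J = N - 1" "finite ?J" "i \<notin> ?J" "?J \<subseteq> {1..}" using k by auto
  have "(\<integral>\<^sup>+ \<omega>. ennreal (?Z \<omega> powr b) \<partial>M) = (\<integral>\<^sup>+ \<omega>. (\<integral>\<^sup>+ u. layer_weight b u * (if u < ?Z \<omega> then 1 else 0) \<partial>lborel) \<partial>M)"
    by (simp add: powr_layer_cake[OF b scaled_ball_nonneg[OF k]] indicator_def of_bool_def)
  also have "\<dots> = (\<integral>\<^sup>+ u. (\<integral>\<^sup>+ \<omega>. layer_weight b u * (if u < ?Z \<omega> then 1 else 0) \<partial>M) \<partial>lborel)"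
    by (rule WL.Fubini'[symmetric]) (unfold case_prod_beta', measurable)
  also have "\<dots> = (\<integral>\<^sup>+ u. layer_weight b u * ennreal (Phi k (N - 1) u) \<partial>lborel)"
  proof (intro nn_integral_cong)
    fix u :: real
    show "(\<integral>\<^sup>+ \<omega>. layer_weight b u * (if u < ?Z \<omega> then 1 else 0) \<partial>M) = layer_weight b u * ennreal (Phi k (N - 1) u)"
    proof (cases "0 < u")
      case True
      have "(\<integral>\<^sup>+ \<omega>. layer_weight b u * (if u < ?Z \<omega> then 1 else 0) \<partial>M) = layer_weight b u * (\<integral>\<^sup>+ \<omega>. (if u < ?Z \<omega> then 1 else 0) \<partial>M)"
        by (rule nn_integral_cmult) measurable
      also have "(\<integral>\<^sup>+ \<omega>. (if u < ?Z \<omega> then 1 else 0) \<partial>M) = (\<integral>\<^sup>+ \<omega>. indicator {\<omega> \<in> space M. u < ?Z \<omega>} \<omega> \<partial>M)"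
        by (intro nn_integral_cong) (simp add: indicator_def)
      also have "\<dots> = emeasure M {\<omega> \<in> space M. u < ?Z \<omega>}"
        by (rule nn_integral_indicator) measurable
      also have "{\<omega> \<in> space M. u < ?Z \<omega>} = {\<omega> \<in> space M. card {j \<in> ?J. X j \<omega> \<in> cball (X i \<omega>) (rad (N - 1) u)} < k}"
        using k True by (simp only: less_scaled_ball_iff[OF k True])
      also have "emeasure M \<dots> = ennreal (Phi k (N - 1) u)"
        unfolding emeasure_hits[OF k(3) J(3,2,4)] J(1) by (rule ennreal_Phi[symmetric])
      finally show ?thesis .
    qed (simp add: layer_weight_def)
  qed
  finally show ?thesis .
qed

text \<open>The layer cake formula is applied in both variables. Only the points outside the pair
  are counted, so that the counts are independent of the two centres; the scale \<open>N - 2\<close>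
  is their number.\<close>

lemma scaled_ball_pair_moment:
  assumes k: "1 \<le> k" "k + 1 < N" and i: "1 \<le> i" "i \<le> N" and i': "1 \<le> i'" "i' \<le> N" "i \<noteq> i'" and b: "0 < b"
  shows "(\<integral>\<^sup>+ \<omega>. ennreal (scaled_ball (N - 2) k N i \<omega> powr b * scaled_ball (N - 2) k N i' \<omega> powr b) \<partial>M) \<le>
    (\<integral>\<^sup>+ x. layer_weight b (fst x) * layer_weight b (snd x) * ennreal (pair_bound k (N - 2) (fst x) (snd x)) \<partial>(lborel \<Otimes>\<^sub>M lborel))"
proof -
  let ?n = "N - 2"
  let ?Z = "scaled_ball ?n k N i" and ?Z' = "scaled_ball ?n k N i'" and ?J = "{1..N} - {i, i'}"
  have kN: "k < N" using k by simp
  note ki = k(1) kN i and ki' = k(1) kN i'(1,2)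
  note [measurable] = scaled_ball_measurable[OF ki, of ?n] scaled_ball_measurable[OF ki', of ?n]
  interpret L2: sigma_finite_measure "lborel \<Otimes>\<^sub>M lborel :: (real \<times> real) measure"
    unfolding lborel_prod by (rule lborel.sigma_finite_measure_axioms)
  interpret WL: pair_sigma_finite M "lborel \<Otimes>\<^sub>M lborel :: (real \<times> real) measure" ..
  have J: "card ?J = ?n" "finite ?J" "i \<notin> ?J" "i' \<notin> ?J" "?J \<subseteq> {1..}"
    using i i' by (auto simp: card_Diff_subset)
  let ?w = "\<lambda>x. layer_weight b (fst x) * layer_weight b (snd x)"
  let ?F = "\<lambda>\<omega> x. ?w x * (if fst x < ?Z \<omega> \<and> snd x < ?Z' \<omega> then 1 else 0)"
  have "(\<integral>\<^sup>+ \<omega>. ennreal (?Z \<omega> powr b * ?Z' \<omega> powr b) \<partial>M) = (\<integral>\<^sup>+ \<omega>. (\<integral>\<^sup>+ x. ?F \<omega> x \<partial>(lborel \<Otimes>\<^sub>M lborel)) \<partial>M)"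
  proof (intro nn_integral_cong)
    fix \<omega>
    have "ennreal (?Z \<omega> powr b * ?Z' \<omega> powr b) = ennreal (?Z \<omega> powr b) * ennreal (?Z' \<omega> powr b)"
      by (rule ennreal_mult) auto
    also have "\<dots> = (\<integral>\<^sup>+ x. (layer_weight b (fst x) * indicator {u. u < ?Z \<omega>} (fst x)) * (layer_weight b (snd x) * indicator {u. u < ?Z' \<omega>} (snd x)) \<partial>(lborel \<Otimes>\<^sub>M lborel))"
      unfolding powr_layer_cake[OF b scaled_ball_nonneg[OF ki]] powr_layer_cake[OF b scaled_ball_nonneg[OF ki']]
      by (rule nn_integral_prod_lborel[symmetric]) measurable
    also have "\<dots> = (\<integral>\<^sup>+ x. ?F \<omega> x \<partial>(lborel \<Otimes>\<^sub>M lborel))"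
      by (intro nn_integral_cong) (simp add: indicator_def)
    finally show "ennreal (?Z \<omega> powr b * ?Z' \<omega> powr b) = (\<integral>\<^sup>+ x. ?F \<omega> x \<partial>(lborel \<Otimes>\<^sub>M lborel))" .
  qed
  also have "\<dots> = (\<integral>\<^sup>+ x. (\<integral>\<^sup>+ \<omega>. ?F \<omega> x \<partial>M) \<partial>(lborel \<Otimes>\<^sub>M lborel))"
    by (rule WL.Fubini'[symmetric]) (unfold case_prod_beta', measurable)
  also have "\<dots> \<le> (\<integral>\<^sup>+ x. ?w x * ennreal (pair_bound k ?n (fst x) (snd x)) \<partial>(lborel \<Otimes>\<^sub>M lborel))"
  proof (intro nn_integral_mono)
    fix x :: "real \<times> real"
    show "(\<integral>\<^sup>+ \<omega>. ?F \<omega> x \<partial>M) \<le> ?w x * ennreal (pair_bound k ?n (fst x) (snd x))"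
    proof (cases "0 < fst x \<and> 0 < snd x")
      case True
      then have u: "0 < fst x" and v: "0 < snd x" by auto
      have n: "0 < ?n" using k by simp
      let ?A = "\<lambda>J i r \<omega>. card {j \<in> J. X j \<omega> \<in> cball (X i \<omega>) r} < k"
      have "(\<integral>\<^sup>+ \<omega>. (if fst x < ?Z \<omega> \<and> snd x < ?Z' \<omega> then 1 else 0) \<partial>M) =
          (\<integral>\<^sup>+ \<omega>. indicator {\<omega> \<in> space M. fst x < ?Z \<omega> \<and> snd x < ?Z' \<omega>} \<omega> \<partial>M)"
        by (intro nn_integral_cong) (simp add: indicator_def)
      also have "\<dots> = emeasure M {\<omega> \<in> space M. fst x < ?Z \<omega> \<and> snd x < ?Z' \<omega>}"
        by (rule nn_integral_indicator) measurable
      also have "\<dots> \<le> emeasure M {\<omega> \<in> space M. ?A ?J i (rad (card ?J) (fst x)) \<omega> \<and> ?A ?J i' (rad (card ?J) (snd x)) \<omega>}"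
      proof (rule emeasure_mono)
        \<comment> \<open>Leaving the other centre out of the count can only lower it, so the event
          grows. This is why only an inequality results.\<close>
        have le: "?A ?J l r \<omega>" if "?A ({1..N} - {l}) l r \<omega>" "l \<in> {i, i'}" for l r \<omega>
        proof -
          have "card {j \<in> ?J. X j \<omega> \<in> cball (X l \<omega>) r} \<le> card {j \<in> {1..N} - {l}. X j \<omega> \<in> cball (X l \<omega>) r}"
            using that(2) by (intro card_mono) auto
          with that(1) show ?thesis by linarith
        qed
        show "{\<omega> \<in> space M. fst x < ?Z \<omega> \<and> snd x < ?Z' \<omega>} \<subseteq>
          {\<omega> \<in> space M. ?A ?J i (rad (card ?J) (fst x)) \<omega> \<and> ?A ?J i' (rad (card ?J) (snd x)) \<omega>}"
        proof
          fix \<omega>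
          assume "\<omega> \<in> {\<omega> \<in> space M. fst x < ?Z \<omega> \<and> snd x < ?Z' \<omega>}"
          then have w: "\<omega> \<in> space M"
            and a: "?A ({1..N} - {i}) i (rad ?n (fst x)) \<omega>" and a': "?A ({1..N} - {i'}) i' (rad ?n (snd x)) \<omega>"
            by (simp_all only: mem_Collect_eq less_scaled_ball_iff[OF ki u n] less_scaled_ball_iff[OF ki' v n])
          have "?A ?J i (rad ?n (fst x)) \<omega>" by (rule le[OF a]) simp
          moreover have "?A ?J i' (rad ?n (snd x)) \<omega>" by (rule le[OF a']) simp
          ultimately show "\<omega> \<in> {\<omega> \<in> space M. ?A ?J i (rad (card ?J) (fst x)) \<omega> \<and> ?A ?J i' (rad (card ?J) (snd x)) \<omega>}"
            unfolding J(1) mem_Collect_eq using w by (intro conjI)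
        qed
        have "Measurable.pred M (\<lambda>\<omega>. ?A ?J i (rad (card ?J) (fst x)) \<omega> \<and> ?A ?J i' (rad (card ?J) (snd x)) \<omega>)"
          by (intro pred_intros_logic measurable_hits J(2,5) i(1) i'(1))
        then show "{\<omega> \<in> space M. ?A ?J i (rad (card ?J) (fst x)) \<omega> \<and> ?A ?J i' (rad (card ?J) (snd x)) \<omega>} \<in> sets M"
          by (simp only: pred_def)
      qed
      also have "\<dots> \<le> ennreal (pair_bound k (card ?J) (fst x) (snd x))"
        by (rule emeasure_hits_pair_le[OF i(1) J(3) i'(1) J(4) i'(3) J(2,5)])
      finally have "(\<integral>\<^sup>+ \<omega>. (if fst x < ?Z \<omega> \<and> snd x < ?Z' \<omega> then 1 else 0) \<partial>M) \<le>
          ennreal (pair_bound k ?n (fst x) (snd x))" unfolding J(1) .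
      then have "?w x * (\<integral>\<^sup>+ \<omega>. (if fst x < ?Z \<omega> \<and> snd x < ?Z' \<omega> then 1 else 0) \<partial>M) \<le>
          ?w x * ennreal (pair_bound k ?n (fst x) (snd x))" by (rule mult_left_mono) simp
      moreover have "(\<integral>\<^sup>+ \<omega>. ?F \<omega> x \<partial>M) = ?w x * (\<integral>\<^sup>+ \<omega>. (if fst x < ?Z \<omega> \<and> snd x < ?Z' \<omega> then 1 else 0) \<partial>M)"
        by (rule nn_integral_cmult) measurable
      ultimately show ?thesis by (simp only:)
    qed (auto simp: layer_weight_def)
  qed
  finally show ?thesis .
qed

lemma knn_zeta_powr:
  assumes k: "1 \<le> k" "k < N" "1 \<le> i" "i \<le> N" and q: "q < 1"
  shows "knn_zeta k q (\<lambda>j. X j \<omega>) i N powr (1 - q) =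
    Gamma (real k) / Gamma (real k + 1 - q) * scaled_ball (N - 1) k N i \<omega> powr (1 - q)"
proof -
  have c: "0 < Gamma (real k) / Gamma (real k + 1 - q)"
    using k q by (intro divide_pos_pos Gamma_real_pos) auto
  have "knn_zeta k q (\<lambda>j. X j \<omega>) i N = knn_const k q * scaled_ball (N - 1) k N i \<omega>"
    using k by (simp add: knn_zeta_def scaled_ball_def vol1_def of_nat_diff)
  then have "knn_zeta k q (\<lambda>j. X j \<omega>) i N powr (1 - q) = knn_const k q powr (1 - q) * scaled_ball (N - 1) k N i \<omega> powr (1 - q)"
    using scaled_ball_nonneg[OF k] by (simp add: powr_mult knn_const_def)
  also have "knn_const k q powr (1 - q) = Gamma (real k) / Gamma (real k + 1 - q)"
  proof -
    have "(c powr (1 / (1 - q))) powr (1 - q) = c" if "0 < c" for c :: real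
      using q that by (simp add: powr_powr)
    from this[OF c] show ?thesis by (simp only: knn_const_def)
  qed
  finally show ?thesis .
qed

text \<open>All \<open>N\<close> summands have the same expectation, given by
  \<open>scaled_ball_moment\<close>, so the average reproduces it exactly for every
  \<open>N > k\<close>.\<close>

lemma estimator_mean:
  assumes k: "1 \<le> k" "k < N" and q: "q < 1"
  shows "(\<integral>\<^sup>+ \<omega>. ennreal (knn_estimator k N q (\<lambda>i. X i \<omega>)) \<partial>M) =
    ennreal (Gamma (real k) / Gamma (real k + 1 - q)) * (\<integral>\<^sup>+ u. layer_weight (1 - q) u * ennreal (Phi k (N - 1) u) \<partial>lborel)"
proof -
  define c where "c = Gamma (real k) / Gamma (real k + 1 - q)"
  let ?I = "\<integral>\<^sup>+ u. layer_weight (1 - q) u * ennreal (Phi k (N - 1) u) \<partial>lborel"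
  have c: "0 < c" unfolding c_def using k q by (intro divide_pos_pos Gamma_real_pos) auto
  have N: "0 < N" using k by simp
  have "(\<integral>\<^sup>+ \<omega>. ennreal (knn_estimator k N q (\<lambda>i. X i \<omega>)) \<partial>M) =
     (\<integral>\<^sup>+ \<omega>. (\<Sum>i=1..N. ennreal (c / real N) * ennreal (scaled_ball (N - 1) k N i \<omega> powr (1 - q))) \<partial>M)"
  proof (intro nn_integral_cong)
    fix \<omega>
    have "knn_estimator k N q (\<lambda>i. X i \<omega>) = (\<Sum>i=1..N. c / real N * scaled_ball (N - 1) k N i \<omega> powr (1 - q))"
      unfolding knn_estimator_def sum_distrib_left using k q
      by (intro sum.cong) (auto simp: knn_zeta_powr c_def)
    also have "ennreal \<dots> = (\<Sum>i=1..N. ennreal (c / real N * scaled_ball (N - 1) k N i \<omega> powr (1 - q)))"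
      using c by (intro sum_ennreal[symmetric]) auto
    also have "\<dots> = (\<Sum>i=1..N. ennreal (c / real N) * ennreal (scaled_ball (N - 1) k N i \<omega> powr (1 - q)))"
      using c by (intro sum.cong refl ennreal_mult) auto
    finally show "ennreal (knn_estimator k N q (\<lambda>i. X i \<omega>)) = (\<Sum>i=1..N. ennreal (c / real N) * ennreal (scaled_ball (N - 1) k N i \<omega> powr (1 - q)))" .
  qed
  also have "\<dots> = (\<Sum>i=1..N. \<integral>\<^sup>+ \<omega>. ennreal (c / real N) * ennreal (scaled_ball (N - 1) k N i \<omega> powr (1 - q)) \<partial>M)"
  proof (rule nn_integral_sum)
    fix i assume i: "i \<in> {1..N}"
    then have [measurable]: "scaled_ball (N - 1) k N i \<in> borel_measurable M"
      using k by (intro scaled_ball_measurable) auto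
    show "(\<lambda>\<omega>. ennreal (c / real N) * ennreal (scaled_ball (N - 1) k N i \<omega> powr (1 - q))) \<in> borel_measurable M"
      by measurable
  qed
  also have "\<dots> = (\<Sum>i=1..N. ennreal (c / real N) * ?I)"
  proof (rule sum.cong[OF refl])
    fix i assume i: "i \<in> {1..N}"
    then have i1: "1 \<le> i" "i \<le> N" by auto
    note [measurable] = scaled_ball_measurable[OF k i1, of "N - 1"]
    have "(\<integral>\<^sup>+ \<omega>. ennreal (c / real N) * ennreal (scaled_ball (N - 1) k N i \<omega> powr (1 - q)) \<partial>M) =
        ennreal (c / real N) * (\<integral>\<^sup>+ \<omega>. ennreal (scaled_ball (N - 1) k N i \<omega> powr (1 - q)) \<partial>M)"
      by (rule nn_integral_cmult) measurable
    also have "\<dots> = ennreal (c / real N) * ?I" using q by (subst scaled_ball_moment[OF k i1]) auto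
    finally show "(\<integral>\<^sup>+ \<omega>. ennreal (c / real N) * ennreal (scaled_ball (N - 1) k N i \<omega> powr (1 - q)) \<partial>M) = ennreal (c / real N) * ?I" .
  qed
  also have "\<dots> = of_nat N * (ennreal (c / real N) * ?I)" by simp
  also have "\<dots> = ennreal (real N * (c / real N)) * ?I"
    using c N by (simp only: ennreal_of_nat_eq_real_of_nat mult.assoc[symmetric]) (simp add: ennreal_mult[symmetric] less_imp_le)
  also have "real N * (c / real N) = c" using N by simp
  finally show ?thesis unfolding c_def .
qed

text \<open>The origin of \<open>knn_const\<close>: its power \<open>1 - q\<close> is the reciprocal
  of the Gamma moment in \<open>Phi_lim_moment\<close>.\<close>

lemma Gamma_quotient_Phi_lim_moment:
  assumes k: "1 \<le> k" and q: "q < 1"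
  shows "ennreal (Gamma (real k) / Gamma (real k + 1 - q)) * (\<integral>\<^sup>+ u. layer_weight (1 - q) u * ennreal (Phi_lim k u) \<partial>lborel)
    = G_functional q f"
proof -
  have g: "0 < Gamma (real k)" "0 < Gamma (real k + 1 - q)" using k q by (auto intro!: Gamma_real_pos)
  have "ennreal (Gamma (real k) / Gamma (real k + 1 - q)) * ennreal (Gamma (real k + 1 - q) / Gamma (real k)) = 1"
    using g by (simp add: ennreal_mult[symmetric])
  moreover have "(\<integral>\<^sup>+ u. layer_weight (1 - q) u * ennreal (Phi_lim k u) \<partial>lborel) =
      ennreal (Gamma (real k + 1 - q) / Gamma (real k)) * G_functional q f"
    using Phi_lim_moment[of "1 - q" k] q k by (simp add: G_functional_def add_diff_eq)
  ultimately show ?thesis by (simp add: mult.assoc[symmetric])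
qed

lemma estimator_mean_tendsto:
  assumes k: "1 \<le> k" and q: "0 < q" "q < 1"
    and s: "0 < s" "density_moment s f < \<infinity>" "1 - q < s / (real CARD('m) + s)"
  shows "(\<lambda>N. \<integral>\<^sup>+ \<omega>. ennreal (knn_estimator k N q (\<lambda>i. X i \<omega>)) \<partial>M) \<longlonglongrightarrow> G_functional q f"
proof -
  let ?c = "ennreal (Gamma (real k) / Gamma (real k + 1 - q))"
  let ?I = "\<lambda>n. \<integral>\<^sup>+ u. layer_weight (1 - q) u * ennreal (Phi k n u) \<partial>lborel"
  obtain C n0 where C: "0 \<le> C" and decay: "\<And>n u. n0 \<le> n \<Longrightarrow> 0 < u \<Longrightarrow> Phi k n u \<le> C * u powr - (s / (real DIM(real^'m) + s))"
    using Phi_decay[OF _ s(1), of k] s(2) unfolding density_moment_def by metis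
  have "?I \<longlonglongrightarrow> (\<integral>\<^sup>+ u. layer_weight (1 - q) u * ennreal (Phi_lim k u) \<partial>lborel)"
    using q s by (intro Phi_moment_tendsto[OF _ _ C decay]) auto
  then have "(\<lambda>n. ?c * ?I n) \<longlonglongrightarrow> ?c * (\<integral>\<^sup>+ u. layer_weight (1 - q) u * ennreal (Phi_lim k u) \<partial>lborel)"
    by (intro ennreal_tendsto_cmult) auto
  then have "(\<lambda>n. ?c * ?I n) \<longlonglongrightarrow> G_functional q f"
    unfolding Gamma_quotient_Phi_lim_moment[OF k q(2)] .
  then have "(\<lambda>N. ?c * ?I (N - 1)) \<longlonglongrightarrow> G_functional q f"
    by (rule filterlim_compose) (rule filterlim_minus_const_nat_at_top)
  moreover have "eventually (\<lambda>N. ?c * ?I (N - 1) = (\<integral>\<^sup>+ \<omega>. ennreal (knn_estimator k N q (\<lambda>i. X i \<omega>)) \<partial>M)) sequentially"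
    using eventually_gt_at_top[of k] by eventually_elim (simp only: estimator_mean[OF k _ q(2)])
  ultimately show ?thesis by (rule Lim_transform_eventually)
qed

section \<open>Mean square convergence\<close>

lemma estimator_measurable:
  assumes k: "1 \<le> k" "k < N" and q: "q < 1"
  shows "(\<lambda>\<omega>. knn_estimator k N q (\<lambda>i. X i \<omega>)) \<in> borel_measurable M"
proof -
  have "(\<lambda>\<omega>. knn_zeta k q (\<lambda>j. X j \<omega>) i N powr (1 - q)) \<in> borel_measurable M" if "i \<in> {1..N}" for i
  proof -
    have i: "1 \<le> i" "i \<le> N" using that by auto
    note [measurable] = scaled_ball_measurable[OF k i, of "N - 1"]
    show ?thesis unfolding knn_zeta_powr[OF k i q] by measurable
  qed
  then show ?thesis unfolding knn_estimator_def
    by (intro borel_measurable_times borel_measurable_const borel_measurable_sum)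
qed

text \<open>The square is a double sum over sample points. Its \<open>N\<close> diagonal terms keep
  the weight \<open>1 / N\<close> after division by \<open>N^2\<close>; the others are bounded by
  the pair moment, rescaled from \<open>N - 2\<close> to \<open>N - 1\<close>.\<close>

lemma estimator_square_bound:
  assumes k: "1 \<le> k" "k + 1 < N" and q: "q < 1"
  defines "c \<equiv> Gamma (real k) / Gamma (real k + 1 - q)"
  shows "(\<integral>\<^sup>+ \<omega>. ennreal ((knn_estimator k N q (\<lambda>i. X i \<omega>))\<^sup>2) \<partial>M) \<le>
    ennreal (c\<^sup>2 / real N) * (\<integral>\<^sup>+ u. layer_weight (2 * (1 - q)) u * ennreal (Phi k (N - 1) u) \<partial>lborel) +
    ennreal (c\<^sup>2 * (real (N - 1) / real (N - 2)) powr (2 * (1 - q))) *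
      (\<integral>\<^sup>+ x. layer_weight (1 - q) (fst x) * layer_weight (1 - q) (snd x) * ennreal (pair_bound k (N - 2) (fst x) (snd x)) \<partial>(lborel \<Otimes>\<^sub>M lborel))"
proof -
  let ?a = "1 - q"
  let ?Z = "scaled_ball (N - 1) k N"
  let ?D = "\<integral>\<^sup>+ u. layer_weight (2 * ?a) u * ennreal (Phi k (N - 1) u) \<partial>lborel"
  let ?B = "\<integral>\<^sup>+ x. layer_weight ?a (fst x) * layer_weight ?a (snd x) * ennreal (pair_bound k (N - 2) (fst x) (snd x)) \<partial>(lborel \<Otimes>\<^sub>M lborel)"
  let ?r = "(real (N - 1) / real (N - 2)) powr (2 * ?a)"
  let ?S = "{1..N}"
  have c: "0 < c" unfolding c_def using k q by (intro divide_pos_pos Gamma_real_pos) auto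
  have N: "0 < N" "0 < N - 2" and kN: "k < N" using k by auto
  have Zm: "scaled_ball n k N i \<in> borel_measurable M" if "i \<in> ?S" for n i
    using that kN k by (intro scaled_ball_measurable) auto
  have pm: "(\<lambda>\<omega>. ennreal (?Z i \<omega> powr ?a * ?Z j \<omega> powr ?a)) \<in> borel_measurable M" if "i \<in> ?S" "j \<in> ?S" for i j
  proof -
    note [measurable] = Zm[OF that(1)] Zm[OF that(2)]
    show ?thesis by measurable
  qed
  \<comment> \<open>The pair bound is granted to the diagonal terms as well; the surplus is
    nonnegative, and the double sum then has a constant summand.\<close>
  have moment: "(\<integral>\<^sup>+ \<omega>. ennreal (?Z i \<omega> powr ?a * ?Z j \<omega> powr ?a) \<partial>M) \<le> (if i = j then ?D else 0) + ennreal ?r * ?B"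
    if "i \<in> ?S" "j \<in> ?S" for i j
  proof (cases "i = j")
    case True
    have "(\<integral>\<^sup>+ \<omega>. ennreal (?Z i \<omega> powr ?a * ?Z j \<omega> powr ?a) \<partial>M) = (\<integral>\<^sup>+ \<omega>. ennreal (?Z i \<omega> powr (2 * ?a)) \<partial>M)"
      by (simp add: True powr_add[symmetric])
    also have "\<dots> = ?D" using that q by (intro scaled_ball_moment k(1) kN) auto
    finally show ?thesis using True by simp
  next
    case False
    have eq: "?Z l \<omega> powr ?a = (real (N - 1) / real (N - 2)) powr ?a * scaled_ball (N - 2) k N l \<omega> powr ?a" if "l \<in> ?S" for l \<omega>
    proof -
      have "?Z l \<omega> = (real (N - 1) / real (N - 2)) * scaled_ball (N - 2) k N l \<omega>"
        using N by (simp add: scaled_ball_def)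
      then show ?thesis
        using that k kN scaled_ball_nonneg[of k N l "N - 2" \<omega>] by (simp only: powr_mult)
    qed
    note [measurable] = Zm[OF that(1)] Zm[OF that(2)]
    have "(\<integral>\<^sup>+ \<omega>. ennreal (?Z i \<omega> powr ?a * ?Z j \<omega> powr ?a) \<partial>M) =
      (\<integral>\<^sup>+ \<omega>. ennreal ?r * ennreal (scaled_ball (N - 2) k N i \<omega> powr ?a * scaled_ball (N - 2) k N j \<omega> powr ?a) \<partial>M)"
    proof (intro nn_integral_cong)
      fix \<omega>
      have "?r = (real (N - 1) / real (N - 2)) powr ?a * (real (N - 1) / real (N - 2)) powr ?a"
        by (simp add: powr_add[symmetric])
      then have "?Z i \<omega> powr ?a * ?Z j \<omega> powr ?a = ?r * (scaled_ball (N - 2) k N i \<omega> powr ?a * scaled_ball (N - 2) k N j \<omega> powr ?a)"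
        unfolding eq[OF that(1)] eq[OF that(2)] by (simp only: mult_ac)
      then show "ennreal (?Z i \<omega> powr ?a * ?Z j \<omega> powr ?a) = ennreal ?r * ennreal (scaled_ball (N - 2) k N i \<omega> powr ?a * scaled_ball (N - 2) k N j \<omega> powr ?a)"
        by (simp only: ennreal_mult powr_ge_zero mult_nonneg_nonneg)
    qed
    also have "\<dots> = ennreal ?r * (\<integral>\<^sup>+ \<omega>. ennreal (scaled_ball (N - 2) k N i \<omega> powr ?a * scaled_ball (N - 2) k N j \<omega> powr ?a) \<partial>M)"
      by (rule nn_integral_cmult) measurable
    also have "\<dots> \<le> ennreal ?r * ?B"
      using that False q by (intro mult_left_mono scaled_ball_pair_moment k) auto
    finally show ?thesis using False by simp
  qed
  have "(\<integral>\<^sup>+ \<omega>. (\<Sum>i\<in>?S. \<Sum>j\<in>?S. ennreal (?Z i \<omega> powr ?a * ?Z j \<omega> powr ?a)) \<partial>M) =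
     (\<Sum>i\<in>?S. \<integral>\<^sup>+ \<omega>. (\<Sum>j\<in>?S. ennreal (?Z i \<omega> powr ?a * ?Z j \<omega> powr ?a)) \<partial>M)"
    by (intro nn_integral_sum borel_measurable_sum pm)
  also have "\<dots> = (\<Sum>i\<in>?S. \<Sum>j\<in>?S. \<integral>\<^sup>+ \<omega>. ennreal (?Z i \<omega> powr ?a * ?Z j \<omega> powr ?a) \<partial>M)"
    by (intro sum.cong refl nn_integral_sum pm)
  also have "\<dots> \<le> (\<Sum>i\<in>?S. \<Sum>j\<in>?S. (if i = j then ?D else 0) + ennreal ?r * ?B)"
    by (intro sum_mono moment)
  also have "\<dots> = ennreal (real N) * ?D + ennreal (real N) * (ennreal (real N) * (ennreal ?r * ?B))"
  proof -
    have "(\<Sum>i\<in>?S. \<Sum>j\<in>?S. (if i = j then d else 0) + e) =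
        ennreal (real N) * d + ennreal (real N) * (ennreal (real N) * e)" for d e :: ennreal
      by (simp add: sum.distrib ennreal_of_nat_eq_real_of_nat distrib_left)
    then show ?thesis .
  qed
  finally have double_sum: "(\<integral>\<^sup>+ \<omega>. (\<Sum>i\<in>?S. \<Sum>j\<in>?S. ennreal (?Z i \<omega> powr ?a * ?Z j \<omega> powr ?a)) \<partial>M) \<le>
     ennreal (real N) * ?D + ennreal (real N) * (ennreal (real N) * (ennreal ?r * ?B))" .
  have "(\<integral>\<^sup>+ \<omega>. ennreal ((knn_estimator k N q (\<lambda>i. X i \<omega>))\<^sup>2) \<partial>M) =
     (\<integral>\<^sup>+ \<omega>. ennreal (c\<^sup>2 / (real N)\<^sup>2) * (\<Sum>i\<in>?S. \<Sum>j\<in>?S. ennreal (?Z i \<omega> powr ?a * ?Z j \<omega> powr ?a)) \<partial>M)"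
  proof (intro nn_integral_cong)
    fix \<omega>
    have "knn_estimator k N q (\<lambda>i. X i \<omega>) = c / real N * (\<Sum>i\<in>?S. ?Z i \<omega> powr ?a)"
      unfolding knn_estimator_def sum_distrib_left using k kN q
      by (intro sum.cong) (auto simp: knn_zeta_powr c_def)
    then have "(knn_estimator k N q (\<lambda>i. X i \<omega>))\<^sup>2 = c\<^sup>2 / (real N)\<^sup>2 * (\<Sum>i\<in>?S. \<Sum>j\<in>?S. ?Z i \<omega> powr ?a * ?Z j \<omega> powr ?a)"
      by (simp only: power_mult_distrib power_divide power2_eq_square[of "sum _ _"] sum_product)
    then have "ennreal ((knn_estimator k N q (\<lambda>i. X i \<omega>))\<^sup>2) = ennreal (c\<^sup>2 / (real N)\<^sup>2 * (\<Sum>i\<in>?S. \<Sum>j\<in>?S. ?Z i \<omega> powr ?a * ?Z j \<omega> powr ?a))"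
      by (rule arg_cong)
    also have "\<dots> = ennreal (c\<^sup>2 / (real N)\<^sup>2) * ennreal (\<Sum>i\<in>?S. \<Sum>j\<in>?S. ?Z i \<omega> powr ?a * ?Z j \<omega> powr ?a)"
      by (intro ennreal_mult sum_nonneg mult_nonneg_nonneg powr_ge_zero) simp
    also have "ennreal (\<Sum>i\<in>?S. \<Sum>j\<in>?S. ?Z i \<omega> powr ?a * ?Z j \<omega> powr ?a) = (\<Sum>i\<in>?S. \<Sum>j\<in>?S. ennreal (?Z i \<omega> powr ?a * ?Z j \<omega> powr ?a))"
    proof -
      have "ennreal (\<Sum>i\<in>?S. \<Sum>j\<in>?S. ?Z i \<omega> powr ?a * ?Z j \<omega> powr ?a) = (\<Sum>i\<in>?S. ennreal (\<Sum>j\<in>?S. ?Z i \<omega> powr ?a * ?Z j \<omega> powr ?a))"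
        by (intro sum_ennreal[symmetric] sum_nonneg mult_nonneg_nonneg powr_ge_zero)
      also have "\<dots> = (\<Sum>i\<in>?S. \<Sum>j\<in>?S. ennreal (?Z i \<omega> powr ?a * ?Z j \<omega> powr ?a))"
        by (intro sum.cong refl sum_ennreal[symmetric] mult_nonneg_nonneg powr_ge_zero)
      finally show ?thesis .
    qed
    finally show "ennreal ((knn_estimator k N q (\<lambda>i. X i \<omega>))\<^sup>2) = ennreal (c\<^sup>2 / (real N)\<^sup>2) * (\<Sum>i\<in>?S. \<Sum>j\<in>?S. ennreal (?Z i \<omega> powr ?a * ?Z j \<omega> powr ?a))" .
  qed
  also have "\<dots> = ennreal (c\<^sup>2 / (real N)\<^sup>2) * (\<integral>\<^sup>+ \<omega>. (\<Sum>i\<in>?S. \<Sum>j\<in>?S. ennreal (?Z i \<omega> powr ?a * ?Z j \<omega> powr ?a)) \<partial>M)"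
    by (intro nn_integral_cmult borel_measurable_sum pm)
  also have "\<dots> \<le> ennreal (c\<^sup>2 / (real N)\<^sup>2) * (ennreal (real N) * ?D + ennreal (real N) * (ennreal (real N) * (ennreal ?r * ?B)))"
    by (rule mult_left_mono[OF double_sum]) simp
  also have "\<dots> = (ennreal (c\<^sup>2 / (real N)\<^sup>2) * ennreal (real N)) * ?D +
     (ennreal (c\<^sup>2 / (real N)\<^sup>2) * ennreal (real N) * ennreal (real N) * ennreal ?r) * ?B"
    by (simp only: distrib_left mult.assoc)
  also have "\<dots> = ennreal (c\<^sup>2 / real N) * ?D + ennreal (c\<^sup>2 * ?r) * ?B"
  proof -
    have "ennreal (c\<^sup>2 / (real N)\<^sup>2) * ennreal (real N) = ennreal (c\<^sup>2 / real N)"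
      using N by (simp add: ennreal_mult[symmetric] power2_eq_square)
    moreover have "ennreal (c\<^sup>2 / real N) * ennreal (real N) = ennreal (c\<^sup>2)"
      using N by (simp add: ennreal_mult[symmetric])
    moreover have "ennreal (c\<^sup>2) * ennreal ?r = ennreal (c\<^sup>2 * ?r)"
      by (rule ennreal_mult[symmetric]) auto
    ultimately show ?thesis by (simp only:)
  qed
  finally show ?thesis .
qed

text \<open>A majorant \<open>U\<close> is produced rather than the limit of the second moment,
  since pairs are only estimated from above.\<close>

lemma estimator_square_upper_limit:
  assumes k: "1 \<le> k" and q: "0 < q" "q < 1"
    and s: "0 < s" "density_moment s f < \<infinity>" "2 * (1 - q) < s / (real CARD('m) + s)"
  obtains U where "U \<longlonglongrightarrow> (G_functional q f)\<^sup>2"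
    "eventually (\<lambda>N. (\<integral>\<^sup>+ \<omega>. ennreal ((knn_estimator k N q (\<lambda>i. X i \<omega>))\<^sup>2) \<partial>M) \<le> U N) sequentially"
proof -
  let ?a = "1 - q"
  let ?g = "s / (real DIM(real^'m) + s)"
  define c where "c = Gamma (real k) / Gamma (real k + 1 - q)"
  let ?I = "\<integral>\<^sup>+ u. layer_weight ?a u * ennreal (Phi_lim k u) \<partial>lborel"
  define D where "D n = (\<integral>\<^sup>+ u. layer_weight (2 * ?a) u * ennreal (Phi k n u) \<partial>lborel)" for n
  define B where "B n = (\<integral>\<^sup>+ x. layer_weight ?a (fst x) * layer_weight ?a (snd x) * ennreal (pair_bound k n (fst x) (snd x)) \<partial>(lborel \<Otimes>\<^sub>M lborel))" for n
  define r where "r N = (real (N - 1) / real (N - 2)) powr (2 * ?a)" for N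
  obtain C n0 where C: "0 \<le> C" and decay: "\<And>n u. n0 \<le> n \<Longrightarrow> 0 < u \<Longrightarrow> Phi k n u \<le> C * u powr - ?g"
    using Phi_decay[OF _ s(1), of k] s(2) unfolding density_moment_def by metis
  \<comment> \<open>A bound for the diagonal moments that does not depend on \<open>N\<close>; their
    weight \<open>1 / N\<close> then removes them.\<close>
  define K where "K = (\<integral>\<^sup>+ u. layer_weight (2 * ?a) u * ennreal (min 1 (C * u powr - ?g)) \<partial>lborel)"
  have K: "K < \<infinity>" unfolding K_def using q s C by (intro layer_weight_decay_finite) auto
  have DK: "D n \<le> K" if "n0 \<le> n" for n
    unfolding D_def K_def
  proof (intro nn_integral_mono)
    fix u :: real
    show "layer_weight (2 * ?a) u * ennreal (Phi k n u) \<le> layer_weight (2 * ?a) u * ennreal (min 1 (C * u powr - ?g))"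
    proof (cases "0 < u")
      case True
      then show ?thesis using Phi_le_1 decay[OF that True] by (intro mult_left_mono ennreal_leI) auto
    qed (simp add: layer_weight_def)
  qed
  have K0: "(\<lambda>N. ennreal (c\<^sup>2 / real N) * K) \<longlonglongrightarrow> 0"
  proof -
    have "(\<lambda>N. ennreal (c\<^sup>2 / real N * enn2real K)) \<longlonglongrightarrow> ennreal 0"
    proof (intro tendsto_ennrealI)
      have "(\<lambda>N. c\<^sup>2 * enn2real K * inverse (real N)) \<longlonglongrightarrow> c\<^sup>2 * enn2real K * 0"
        by (intro tendsto_intros lim_inverse_n)
      then show "(\<lambda>N. c\<^sup>2 / real N * enn2real K) \<longlonglongrightarrow> 0" by (simp add: divide_inverse mult_ac)
    qed
    moreover have "ennreal (c\<^sup>2 / real N * enn2real K) = ennreal (c\<^sup>2 / real N) * K" for N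
      using K by (subst ennreal_mult) auto
    ultimately show ?thesis by simp
  qed
  have sub2: "filterlim (\<lambda>N. N - 2 :: nat) at_top sequentially" by (rule filterlim_minus_const_nat_at_top)
  have rlim: "r \<longlonglongrightarrow> 1"
  proof -
    have "(\<lambda>N. (1 + inverse (real (N - 2))) powr (2 * ?a)) \<longlonglongrightarrow> (1 + 0) powr (2 * ?a)"
      by (intro tendsto_intros filterlim_compose[OF lim_inverse_n sub2]) auto
    moreover have "eventually (\<lambda>N. (1 + inverse (real (N - 2))) powr (2 * ?a) = r N) sequentially"
      using eventually_gt_at_top[of 2]
    proof eventually_elim
      case (elim N)
      then have "1 + inverse (real (N - 2)) = real (N - 1) / real (N - 2)"
        by (simp add: field_simps of_nat_diff)
      then show ?case by (simp only: r_def)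
    qed
    ultimately show ?thesis by (simp add: tendsto_cong)
  qed
  have "B \<longlonglongrightarrow> ?I\<^sup>2"
    unfolding B_def using q s by (intro pair_moment_tendsto[OF _ _ C decay]) auto
  then have Blim: "(\<lambda>N. B (N - 2)) \<longlonglongrightarrow> ?I\<^sup>2" by (rule filterlim_compose[OF _ sub2])
  \<comment> \<open>Finiteness excludes the product of 0 and infinity in the limit of products in
    \<open>ennreal\<close>. The limit \<open>Phi_lim\<close> inherits the decay of
    \<open>Phi\<close>.\<close>
  have "?I < \<infinity>"
  proof -
    have "?I \<le> (\<integral>\<^sup>+ u. layer_weight ?a u * ennreal (min 1 (C * u powr - ?g)) \<partial>lborel)"
    proof (intro nn_integral_mono)
      fix u :: real
      show "layer_weight ?a u * ennreal (Phi_lim k u) \<le> layer_weight ?a u * ennreal (min 1 (C * u powr - ?g))"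
      proof (cases "0 < u")
        case True
        have "Phi_lim k u \<le> C * u powr - ?g"
          by (intro tendsto_upperbound[OF Phi_tendsto[OF True]] eventually_mono[OF eventually_ge_at_top[of n0]] decay True) auto
        then show ?thesis using Phi_lim_le_1[of u k] True by (intro mult_left_mono ennreal_leI) auto
      qed (simp add: layer_weight_def)
    qed
    also have "\<dots> < \<infinity>" using q s C by (intro layer_weight_decay_finite) auto
    finally show ?thesis .
  qed
  then have I2: "?I\<^sup>2 < \<infinity>" by (simp add: power2_eq_square ennreal_mult_less_top)
  have "(\<lambda>N. ennreal (c\<^sup>2 * r N) * B (N - 2)) \<longlonglongrightarrow> ennreal (c\<^sup>2 * 1) * ?I\<^sup>2"
    by (intro tendsto_mult_ennreal tendsto_ennrealI tendsto_intros rlim Blim) (use I2 in auto)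
  also have "ennreal (c\<^sup>2 * 1) * ?I\<^sup>2 = (G_functional q f)\<^sup>2"
  proof -
    have "0 \<le> c" unfolding c_def using k q by (intro divide_nonneg_nonneg less_imp_le[OF Gamma_real_pos]) auto
    then have "ennreal (c\<^sup>2 * 1) * ?I\<^sup>2 = (ennreal c * ?I)\<^sup>2"
      by (simp add: power_mult_distrib ennreal_power)
    also have "ennreal c * ?I = G_functional q f"
      unfolding c_def by (rule Gamma_quotient_Phi_lim_moment[OF k q(2)])
    finally show ?thesis .
  qed
  finally have "(\<lambda>N. ennreal (c\<^sup>2 / real N) * K + ennreal (c\<^sup>2 * r N) * B (N - 2)) \<longlonglongrightarrow> 0 + (G_functional q f)\<^sup>2"
    by (intro tendsto_add K0)
  moreover have "eventually (\<lambda>N. (\<integral>\<^sup>+ \<omega>. ennreal ((knn_estimator k N q (\<lambda>i. X i \<omega>))\<^sup>2) \<partial>M) \<le>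
      ennreal (c\<^sup>2 / real N) * K + ennreal (c\<^sup>2 * r N) * B (N - 2)) sequentially"
    using eventually_gt_at_top[of "k + 1"] eventually_ge_at_top[of "n0 + 1"]
  proof eventually_elim
    case (elim N)
    have "(\<integral>\<^sup>+ \<omega>. ennreal ((knn_estimator k N q (\<lambda>i. X i \<omega>))\<^sup>2) \<partial>M) \<le> ennreal (c\<^sup>2 / real N) * D (N - 1) + ennreal (c\<^sup>2 * r N) * B (N - 2)"
      unfolding c_def D_def B_def r_def by (rule estimator_square_bound[OF k elim(1) q(2)])
    also have "\<dots> \<le> ennreal (c\<^sup>2 / real N) * K + ennreal (c\<^sup>2 * r N) * B (N - 2)"
      using elim by (intro add_mono mult_left_mono DK) auto
    finally show ?case .
  qed
  ultimately show thesis by (intro that) auto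
qed

text \<open>Expanding the square, \<open>E (G - g)^2\<close> is at most
  \<open>U N - 2 g E G + g^2\<close>, which tends to \<open>g^2 - 2 g^2 + g^2 = 0\<close>.\<close>

lemma estimator_mean_square_tendsto:
  assumes k: "1 \<le> k" and q: "0 < q" "q < 1"
    and s: "0 < s" "density_moment s f < \<infinity>" "2 * (1 - q) < s / (real CARD('m) + s)"
    and fin: "G_functional q f < \<infinity>"
  shows "(\<lambda>N. \<integral>\<^sup>+ \<omega>. ennreal ((knn_estimator k N q (\<lambda>i. X i \<omega>) - enn2real (G_functional q f))\<^sup>2) \<partial>M) \<longlonglongrightarrow> 0"
proof -
  define g where "g = enn2real (G_functional q f)"
  have g: "0 \<le> g" "G_functional q f = ennreal g" using fin by (auto simp: g_def)
  define E where "E N = (\<integral>\<^sup>+ \<omega>. ennreal (knn_estimator k N q (\<lambda>i. X i \<omega>)) \<partial>M)" for N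
  define R where "R N = (\<integral>\<^sup>+ \<omega>. ennreal ((knn_estimator k N q (\<lambda>i. X i \<omega>) - g)\<^sup>2) \<partial>M)" for N
  obtain U where U: "U \<longlonglongrightarrow> (G_functional q f)\<^sup>2" and
    SU: "eventually (\<lambda>N. (\<integral>\<^sup>+ \<omega>. ennreal ((knn_estimator k N q (\<lambda>i. X i \<omega>))\<^sup>2) \<partial>M) \<le> U N) sequentially"
    by (rule estimator_square_upper_limit[OF k q s])
  have E: "E \<longlonglongrightarrow> ennreal g"
    unfolding E_def g(2)[symmetric] using q by (intro estimator_mean_tendsto[OF k q s(1,2)]) (use s(3) in auto)
  \<comment> \<open>Subtraction in \<open>ennreal\<close> is truncated, so all positive terms are
    collected before it.\<close>
  have lim: "(\<lambda>N. (U N + ennreal (g\<^sup>2)) - ennreal (2 * g) * E N) \<longlonglongrightarrow> 0"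
  proof -
    have "(\<lambda>N. (U N + ennreal (g\<^sup>2)) - ennreal (2 * g) * E N) \<longlonglongrightarrow> (ennreal (g\<^sup>2) + ennreal (g\<^sup>2)) - ennreal (2 * g) * ennreal g"
      using U g by (intro tendsto_diff_ennreal tendsto_add ennreal_tendsto_cmult E) (auto simp: ennreal_power ennreal_mult_eq_top_iff)
    also have "ennreal (2 * g) * ennreal g = ennreal (g\<^sup>2) + ennreal (g\<^sup>2)"
      using g by (simp add: ennreal_mult[symmetric] ennreal_plus[symmetric] power2_eq_square del: ennreal_plus)
    finally show ?thesis by simp
  qed
  have "eventually (\<lambda>N. R N \<le> (U N + ennreal (g\<^sup>2)) - ennreal (2 * g) * E N) sequentially"
    using SU eventually_gt_at_top[of k] order_tendstoD(2)[OF E, of top, simplified]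
  proof eventually_elim
    case (elim N)
    let ?G = "\<lambda>\<omega>. knn_estimator k N q (\<lambda>i. X i \<omega>)"
    note [measurable] = estimator_measurable[OF k elim(2) q(2)]
    have nn: "0 \<le> ?G \<omega>" for \<omega> unfolding knn_estimator_def by (intro mult_nonneg_nonneg sum_nonneg) auto
    have "R N + ennreal (2 * g) * E N = (\<integral>\<^sup>+ \<omega>. ennreal ((?G \<omega> - g)\<^sup>2) + ennreal (2 * g) * ennreal (?G \<omega>) \<partial>M)"
      unfolding R_def E_def by (subst nn_integral_add) (auto simp: nn_integral_cmult)
    also have "\<dots> = (\<integral>\<^sup>+ \<omega>. ennreal ((?G \<omega>)\<^sup>2) + ennreal (g\<^sup>2) \<partial>M)"
    proof (intro nn_integral_cong)
      fix \<omega>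
      have "(?G \<omega> - g)\<^sup>2 + 2 * g * ?G \<omega> = (?G \<omega>)\<^sup>2 + g\<^sup>2" by (simp add: power2_eq_square algebra_simps)
      then show "ennreal ((?G \<omega> - g)\<^sup>2) + ennreal (2 * g) * ennreal (?G \<omega>) = ennreal ((?G \<omega>)\<^sup>2) + ennreal (g\<^sup>2)"
        using g nn[of \<omega>] by (simp add: ennreal_mult[symmetric] ennreal_plus[symmetric] del: ennreal_plus)
    qed
    also have "\<dots> = (\<integral>\<^sup>+ \<omega>. ennreal ((?G \<omega>)\<^sup>2) \<partial>M) + ennreal (g\<^sup>2)"
      by (subst nn_integral_add) (auto simp: M.emeasure_space_1)
    also have "\<dots> \<le> U N + ennreal (g\<^sup>2)" by (intro add_mono elim(1)) auto
    finally have "R N + ennreal (2 * g) * E N \<le> U N + ennreal (g\<^sup>2)" .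
    \<comment> \<open>Cancelling the mixed term is legitimate only because it is finite, which holds
      eventually by convergence of \<open>E\<close>.\<close>
    moreover have "ennreal (2 * g) * E N \<noteq> top" using elim(3) by (simp add: ennreal_mult_eq_top_iff)
    ultimately show ?case by (metis ennreal_add_diff_cancel_right ennreal_minus_mono order_refl)
  qed
  then have "R \<longlonglongrightarrow> 0"
    by (intro tendsto_sandwich[OF _ _ tendsto_const lim]) auto
  then show ?thesis unfolding R_def[abs_def] g_def .
qed

end

text \<open>A number below a supremum lies below some member of the set, so the witness is an order
  whose moment is itself finite.\<close>

lemma critical_moment_gt:
  assumes "0 \<le> c" "ennreal c < critical_moment f"
  obtains s where "0 < s" "c < s" "density_moment s f < \<infinity>"
  using assms unfolding critical_moment_def less_SUP_iff by (auto simp: ennreal_less_iff)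

text \<open>The estimator is nonnegative, so \<open>ennreal\<close> truncates nothing and its
  expectation is a nonnegative integral. For \<open>N \<le> k\<close> the list position in
  \<open>knn_dist\<close> does not exist, but finitely many \<open>N\<close> do not affect the
  limits.\<close>

theorem theorem6:
  fixes f :: "real ^ 'm \<Rightarrow> real"
    and M :: "'w measure"
    and X :: "nat \<Rightarrow> 'w \<Rightarrow> real ^ 'm"
    and q :: real
    and k :: nat
  assumes f_nonneg: "\<And>x. 0 \<le> f x"
    and f_measurable: "f \<in> borel_measurable borel"
    and f_integral: "(\<integral>\<^sup>+ x. ennreal (f x) \<partial>lborel) = 1"
    and M_prob: "prob_space M"
    and X_indep: "prob_space.indep_vars M (\<lambda>_. borel) X {1..}"
    and X_density: "\<And>i. 1 \<le> i \<Longrightarrow> distributed M lborel (X i) (\<lambda>x. ennreal (f x))"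
    and q: "0 < q" "q < 1"
    and k: "1 \<le> k"
  shows "(G_functional q f < \<infinity> \<and>
          critical_moment f > ennreal (real CARD('m) * (1 - q) / q) \<longrightarrow>
            (\<lambda>N. \<integral>\<^sup>+ \<omega>. ennreal (knn_estimator k N q (\<lambda>i. X i \<omega>)) \<partial>M)
              \<longlonglongrightarrow> G_functional q f) \<and>
         (G_functional q f < \<infinity> \<and> q > 1 / 2 \<and>
          critical_moment f > ennreal (2 * real CARD('m) * (1 - q) / (2 * q - 1)) \<longrightarrow>
            (\<lambda>N. \<integral>\<^sup>+ \<omega>. ennreal ((knn_estimator k N q (\<lambda>i. X i \<omega>)
                                - enn2real (G_functional q f))\<^sup>2) \<partial>M)
              \<longlonglongrightarrow> 0)"
proof -
  interpret M: prob_space M by fact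
  interpret knn_sample f M X
    by unfold_locales (use f_nonneg f_measurable f_integral X_indep X_density in auto)
  show ?thesis
  proof (intro conjI impI; elim conjE)
    assume "critical_moment f > ennreal (real CARD('m) * (1 - q) / q)"
    then obtain s where s: "0 < s" "real CARD('m) * (1 - q) / q < s" "density_moment s f < \<infinity>"
      using q by (elim critical_moment_gt[rotated]) auto
    \<comment> \<open>Equivalent to \<open>m * (1 - q) < q * s\<close> after adding
      \<open>(1 - q) * s\<close> to both sides, with \<open>m\<close> the dimension.\<close>
    have "(1 - q) * (real CARD('m) + s) < s" using s q by (simp add: field_simps)
    then have "1 - q < s / (real CARD('m) + s)" using s by (simp add: pos_less_divide_eq add_pos_pos)
    with s show "(\<lambda>N. \<integral>\<^sup>+ \<omega>. ennreal (knn_estimator k N q (\<lambda>i. X i \<omega>)) \<partial>M) \<longlonglongrightarrow> G_functional q f"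
      by (intro estimator_mean_tendsto[OF k q s(1)]) auto
  next
    assume fin: "G_functional q f < \<infinity>" and q2: "q > 1 / 2"
      and "critical_moment f > ennreal (2 * real CARD('m) * (1 - q) / (2 * q - 1))"
    then obtain s where s: "0 < s" "2 * real CARD('m) * (1 - q) / (2 * q - 1) < s" "density_moment s f < \<infinity>"
      using q by (elim critical_moment_gt[rotated]) auto
    \<comment> \<open>The bound \<open>q > 1/2\<close> makes the denominator positive.\<close>
    have "2 * real CARD('m) * (1 - q) < s * (2 * q - 1)"
      using s(2) q2 by (simp add: pos_divide_less_eq)
    then have "2 * (1 - q) * (real CARD('m) + s) < s" by (simp add: algebra_simps)
    then have "2 * (1 - q) < s / (real CARD('m) + s)" using s by (simp add: pos_less_divide_eq add_pos_pos)
    with s fin show "(\<lambda>N. \<integral>\<^sup>+ \<omega>. ennreal ((knn_estimator k N q (\<lambda>i. X i \<omega>) - enn2real (G_functional q f))\<^sup>2) \<partial>M) \<longlonglongrightarrow> 0"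
      by (intro estimator_mean_square_tendsto[OF k q s(1)]) auto
  qed
qed

end
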